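(* Let $f_1(\theta)=\sin(\theta/2)$ and $f_2(\theta)=1/\sin(\theta/2)$ if $\alpha\le\theta\le2\pi-\alpha$, and $f_1(\theta)=f_2(\theta)=0$ for all other $\theta\in[0,2\pi]$. Then for fixed $s>0$, $\alpha=2s/n$ and $n\to\infty$, $$D_{n-1}(f_1)=2^{-n}n^{1/4}\left(\sqrt\pi\,2^{1/12}e^{3\zeta'(-1)}e^{-s^2/2}J_0(is)+o(1)\right),$$ $$D_{n-1}(f_2)=2^{n-1}n^{1/4}\left(\sqrt\pi\,2^{1/12}e^{3\zeta'(-1)}e^{-s^2/2}F(s)+o(1)\right),$$ where $$F(s)=\frac1\pi\int_0^\infty\frac{\cos\sqrt{x+s^2}}{x+s^2}\,J_0(\sqrt x)\,dx,$$ $\zeta'$ is the derivative of Riemann's zeta function, and $J_0$ is the Bessel function of the first kind of order $0$.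
   Context: For an integrable $f$ on the unit circle, $D_n(f)=\det T_n(f)$, where $T_n(f)$ is the $(n+1)\times(n+1)$ Toeplitz matrix with entries $$(T_n(f))_{jk}=\frac1{2\pi}\int_0^{2\pi}e^{-i(j-k)\theta}f(\theta)\,d\theta,\qquad j,k=0,1,\dots,n.$$ Here the functions $f_1,f_2$ depend on $n$ through $\alpha=2s/n$. *)

theory Defs
  imports
    "HOL-Complex_Analysis.Complex_Analysis"
    "HOL-Library.Landau_Symbols"
    "Jordan_Normal_Form.Determinant"
begin

(* The qualified names are needed because HOL-Analysis has its own, type-indexed mat and det. *)
definition toeplitz :: "nat \<Rightarrow> (real \<Rightarrow> complex) \<Rightarrow> complex Matrix.mat" where
  "toeplitz n f = Matrix.mat (n + 1) (n + 1) (\<lambda>(j, k).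
     1 / (2 * of_real pi) *
     (LBINT \<theta>:{0..2 * pi}. exp (- \<i> * (of_nat j - of_nat k) * of_real \<theta>) * f \<theta>))"

definition toeplitz_det :: "nat \<Rightarrow> (real \<Rightarrow> complex) \<Rightarrow> complex" where
  "toeplitz_det n f = Determinant.det (toeplitz n f)"

definition f1 :: "real \<Rightarrow> real \<Rightarrow> complex" where
  "f1 \<alpha> \<theta> = (if \<alpha> \<le> \<theta> \<and> \<theta> \<le> 2 * pi - \<alpha> then of_real (sin (\<theta> / 2)) else 0)"

definition f2 :: "real \<Rightarrow> real \<Rightarrow> complex" where
  "f2 \<alpha> \<theta> = (if \<alpha> \<le> \<theta> \<and> \<theta> \<le> 2 * pi - \<alpha> then of_real (1 / sin (\<theta> / 2)) else 0)"

definition bessel_J :: "nat \<Rightarrow> 'a \<Rightarrow> 'a :: {real_normed_field, banach}" where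
  "bessel_J m z = (\<Sum>k. (-1) ^ k / (fact k * fact (k + m)) * (z / 2) ^ (2 * k + m))"

(* The Riemann zeta function as the analytic continuation of its Dirichlet series. By the
   identity theorem its values away from 1 are uniquely determined; the value at the pole 1
   is left arbitrary. *)
definition zeta :: "complex \<Rightarrow> complex" where
  "zeta = (SOME f. f holomorphic_on - {1} \<and>
     (\<forall>z. Re z > 1 \<longrightarrow> (\<lambda>n. 1 / of_nat (n + 1) powr z) sums f z))"

(* The integrand is O(x powr (- 5 / 4)) at infinity, so the improper integral converges
   absolutely and is an ordinary Lebesgue integral. *)
definition F_int :: "real \<Rightarrow> real" where
  "F_int s = 1 / pi *
     (LBINT x:{0..}. cos (sqrt (x + s\<^sup>2)) / (x + s\<^sup>2) * bessel_J 0 (sqrt x))"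

end

theory Submission
  imports Defs "HOL-Real_Asymp.Real_Asymp" "HOL-Probability.Sinc_Integral"
begin

text \<open>
  Put \<open>t = \<theta> / 2\<close>, \<open>c = cos t\<close> and \<open>g = cos (s / n)\<close>. Up to a unimodular factor the \<open>j\<close>-th exponential is
  \<open>cis ((2 * j - (n - 1)) * t)\<close>, a combination of the functions \<open>c ^ a\<close> and \<open>c ^ a * sin t\<close> with prescribed
  parity of \<open>a < n\<close>, and the weights become \<open>2\<close> and \<open>2 / (1 - c\<^sup>2)\<close> on \<open>{- g..g}\<close>. By parity the Gram
  determinant is a product of squared norms of monic orthogonal polynomials, half of them with
  respect to the weight itself and half with respect to the weight times \<open>1 - c\<^sup>2\<close>; the change of
  basis is normalised by the case \<open>f = 1\<close>, where the determinant is 1. All these norms are explicit in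
  terms of Legendre polynomials and their functions of the second kind, by Christoffel's and
  Uvarov's formulas, and the products telescope to \<open>g ^ n\<^sup>2\<close> times a constant depending on \<open>n\<close>
  times a single Legendre function at the point 1, outside \<open>{- g..g}\<close>.

  The constants are hyperfactorials, whence \<open>\<zeta>'(-1)\<close> through Euler-Maclaurin summation. The
  Legendre functions tend to \<open>J\<^sub>0(is) = I\<^sub>0(s)\<close> and to a multiple of \<open>K\<^sub>0(s)\<close>. Finally
  \<open>\<pi> F(s) = 2 K\<^sub>0(s)\<close>: with \<open>\<Phi>(x) = J\<^sub>0(sqrt x)\<close>, the integral of \<open>\<Phi>(x) / (x + s\<^sup>2)\<close> over \<open>x > 0\<close> is
  computed by a Laplace transform, and the remaining integral of
  \<open>\<Phi>(x) (cos (sqrt (x + s\<^sup>2)) - 1) / (x + s\<^sup>2)\<close> vanishes because as a function of \<open>s\<^sup>2\<close> it is a solution of the modified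
  Bessel equation that is smooth at 0 and tends to 0 at infinity.
\<close>

section \<open>The zeta function and its derivative at -1\<close>

text \<open>The change of basis is never computed: it contributes the same factor to every Toeplitz
  determinant of a given size, so one known determinant fixes it. In both final formulas the product
  of the Legendre norms behaves like a multiple of n powr (- 1 / 4) and the monic normalisation
  contributes sqrt (pi * n); this is the origin of n powr (1 / 4) and of sqrt pi. For F the obstacle
  is that cos (sqrt y) / y is singular at y = 0, so that its integral is not smooth at s = 0 and the
  differential equation alone cannot identify it. Splitting off 1 / y leaves an entire kernel, but
  then an inhomogeneous term appears, namely the same integral with the second derivative of cos
  (sqrt y) as kernel, and this has to be shown to vanish beforehand. Absolute convergence rests
  throughout on J_0(sqrt x) = O(x powr (- 1 / 4)), obtained from an energy estimate.\<close>

lemma has_field_derivative_minus_powr: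
  fixes a x :: complex
  assumes "Re x < Re y"
  shows "((\<lambda>x. (y - x) powr a) has_field_derivative - a * (y - x) powr (a - 1)) (at x within S)"
proof -
  have "y - x \<notin> \<real>\<^sub>\<le>\<^sub>0"
    using assms by (auto simp: complex_nonpos_Reals_iff)
  hence "((\<lambda>z. z powr a) has_field_derivative a * (y - x) powr (a - 1)) (at (y - x))"
    by (rule has_field_derivative_powr)
  moreover have "((\<lambda>x. y - x) has_field_derivative - 1) (at x within S)"
    by (auto intro!: derivative_eq_intros)
  ultimately have "((\<lambda>x. (y - x) powr a) has_field_derivative a * (y - x) powr (a - 1) * - 1) (at x within S)"
    by (rule DERIV_chain2)
  thus ?thesis by simp
qed

text \<open>The error of the binomial expansion of (N - 1) powr a about N, cut off after order
  \<open>m\<close>. For N \<ge> 2 it is entire in \<open>a\<close>.\<close>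

definition powr_rem :: "nat \<Rightarrow> complex \<Rightarrow> nat \<Rightarrow> complex" where
  "powr_rem m a N = of_nat (N - 1) powr a
     - (\<Sum>k\<le>m. (-1) ^ k * (a gchoose k) * of_nat N powr (a - of_nat k))"

text \<open>Taylor's formula for x -> (N - x) powr a on the segment from 0 to 1. There N - x stays
  between N / 2 and N, so an exponent of either sign costs at most a power of 2. The constant is
  uniform in norm a \<le> B, as locally uniform convergence requires.\<close>

lemma powr_rem_bound:
  fixes B :: real
  shows "\<exists>C. \<forall>a N. norm a \<le> B \<longrightarrow> N \<ge> 2 \<longrightarrow> norm (powr_rem m a N) \<le> C * real N powr (Re a - real m - 1)"
proof (cases "B \<ge> 0")
  case B: True
  define C where "C = (\<Prod>j\<le>m. B + real j) * 2 powr (B + real m + 1) / fact m"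
  show ?thesis
  proof (intro exI allI impI)
    fix a :: complex and N :: nat
    assume a: "norm a \<le> B" and N: "N \<ge> 2"
    define S where "S = complex_of_real ` {0..1}"
    define f where "f = (\<lambda>i x. (-1) ^ i * (\<Prod>j<i. a - of_nat j) * (of_nat N - x) powr (a - of_nat i))"
    define t where "t = Re a - real m - 1"
    have cS: "convex S"
      unfolding S_def by (intro convex_linear_image) (auto simp: linear_of_real)
    have der: "(f i has_field_derivative f (Suc i) x) (at x within S)" if "x \<in> S" for i x
    proof -
      have "Re x < Re (of_nat N)" using that N by (auto simp: S_def)
      from has_field_derivative_minus_powr[OF this, of "a - of_nat i" S]
      show ?thesis unfolding f_def
        by (rule DERIV_cmult[THEN DERIV_cong]) (simp add: algebra_simps)
    qed
    have bd: "norm (f (Suc m) x) \<le> (\<Prod>j\<le>m. B + real j) * (2 powr (B + real m + 1) * real N powr t)"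
      if x: "x \<in> S" for x
    proof -
      obtain u where u: "x = of_real u" "0 \<le> u" "u \<le> 1" using x by (auto simp: S_def)
      have pos: "real N - u > 0" "real N - u \<ge> real N / 2" "real N - u \<le> real N" using u N by auto
      have "norm (\<Prod>j<Suc m. a - of_nat j) \<le> (\<Prod>j<Suc m. B + real j)"
        unfolding prod_norm[symmetric]
      proof (rule prod_mono, safe)
        fix j show "norm (a - of_nat j) \<le> B + real j"
          using norm_triangle_ineq4[of a "of_nat j"] a by simp
      qed simp
      hence 1: "norm (\<Prod>j<Suc m. a - of_nat j) \<le> (\<Prod>j\<le>m. B + real j)"
        by (simp add: lessThan_Suc_atMost)
      have "norm ((of_nat N - x) powr (a - of_nat (Suc m))) = (real N - u) powr t"
      proof -
        have eq: "of_nat N - x = of_real (real N - u)" using u by simp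
        have "norm (of_real (real N - u) powr (a - of_nat (Suc m))) = (real N - u) powr Re (a - of_nat (Suc m))"
          using pos(1) norm_powr_real_powr[of "of_real (real N - u)" "a - of_nat (Suc m)"] by simp
        moreover have "Re (a - of_nat (Suc m)) = t" by (simp add: t_def)
        ultimately show ?thesis unfolding eq by simp
      qed
      also have "\<dots> = ((real N - u) / real N) powr t * real N powr t"
        using pos N by (subst powr_mult[symmetric]) auto
      also have "((real N - u) / real N) powr t \<le> 2 powr (B + real m + 1)"
      proof -
        define q where "q = (real N - u) / real N"
        have q: "1 / 2 \<le> q" "q \<le> 1" "q > 0" using pos N by (auto simp: q_def field_simps)
        have "- t \<le> B + real m + 1"
          using a abs_Re_le_cmod[of a] by (simp add: t_def)
        have "q powr t = (1 / q) powr (- t)" using q by (simp add: powr_divide powr_minus divide_simps)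
        also have "\<dots> \<le> (1 / q) powr (B + real m + 1)"
          using q \<open>- t \<le> _\<close> by (intro powr_mono) auto
        also have "\<dots> \<le> 2 powr (B + real m + 1)"
          using q B by (intro powr_mono2) (auto simp: field_simps)
        finally show ?thesis by (simp add: q_def)
      qed
      finally have 2: "norm ((of_nat N - x) powr (a - of_nat (Suc m))) \<le> 2 powr (B + real m + 1) * real N powr t"
        by (simp add: mult_right_mono)
      show ?thesis unfolding f_def norm_mult
        using mult_mono[OF 1 2] B by (simp add: norm_power prod_nonneg)
    qed
    have "norm (f 0 1 - (\<Sum>i\<le>m. f i 0 * (1 - 0) ^ i / fact i))
        \<le> (\<Prod>j\<le>m. B + real j) * (2 powr (B + real m + 1) * real N powr t) * norm (1 - 0 :: complex) ^ Suc m / fact m"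
      by (rule complex_Taylor[of S, OF cS der bd]) (auto simp: S_def image_iff)
    moreover have "f i 0 * (1 - 0) ^ i / fact i = (-1) ^ i * (a gchoose i) * of_nat N powr (a - of_nat i)" for i
      by (simp add: f_def gbinomial_prod_rev atLeast0LessThan)
    moreover have "f 0 1 = of_nat (N - 1) powr a" using N by (simp add: f_def of_nat_diff)
    ultimately show "norm (powr_rem m a N) \<le> C * real N powr (Re a - real m - 1)"
      by (simp add: powr_rem_def C_def t_def mult_ac)
  qed
next
  case False
  thus ?thesis by (meson norm_ge_zero order_trans)
qed

lemma powr_rem_holomorphic: "N \<ge> 2 \<Longrightarrow> g holomorphic_on A \<Longrightarrow> (\<lambda>s. powr_rem m (g s) N) holomorphic_on A"
  unfolding powr_rem_def gbinomial_prod_rev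
  by (intro holomorphic_intros) auto

text \<open>Half the distance of \<open>z\<close> to the boundary line serves as radius: on that
  ball the exponents are at most - 1 - \<delta>, so the Weierstrass test applies with one convergent
  majorant.\<close>

lemma halfplane_uniform_sums:
  fixes f :: "nat \<Rightarrow> complex \<Rightarrow> complex" and m :: real
  assumes bd: "\<And>B. \<exists>C. \<forall>s N. norm s \<le> B \<longrightarrow> norm (f N s) \<le> C * real (N + 2) powr (- Re s - m)"
  assumes z: "Re z > 1 - m"
  obtains d where "d > 0" "cball z d \<subseteq> {s. Re s > 1 - m}"
    "uniform_limit (cball z d) (\<lambda>n s. \<Sum>N<n. f N s) (\<lambda>s. \<Sum>N. f N s) sequentially"
    "\<And>s. s \<in> cball z d \<Longrightarrow> summable (\<lambda>N. f N s)"
proof -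
  define \<delta> where "\<delta> = (Re z - (1 - m)) / 2"
  have \<delta>: "\<delta> > 0" using z by (simp add: \<delta>_def)
  obtain C where C: "\<And>s N. norm s \<le> norm z + \<delta> \<Longrightarrow> norm (f N s) \<le> C * real (N + 2) powr (- Re s - m)"
    using bd[of "norm z + \<delta>"] by blast
  have re: "Re s \<ge> Re z - \<delta>" "norm s \<le> norm z + \<delta>" if "s \<in> cball z \<delta>" for s
  proof -
    show "Re s \<ge> Re z - \<delta>"
      using that abs_Re_le_cmod[of "z - s"] by (simp add: dist_norm)
    show "norm s \<le> norm z + \<delta>"
      using that norm_triangle_ineq4[of z "z - s"] by (simp add: dist_norm)
  qed
  have C0: "C \<ge> 0"
  proof -
    have "0 \<le> C * real (0 + 2) powr (- Re z - m)"
      using C[of z 0] \<delta> order_trans[OF norm_ge_zero] by simp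
    thus ?thesis by (simp add: zero_le_mult_iff)
  qed
  have bound: "norm (f N s) \<le> C * real (N + 2) powr (- 1 - \<delta>)" if "s \<in> cball z \<delta>" for N s
  proof -
    have "norm (f N s) \<le> C * real (N + 2) powr (- Re s - m)" by (rule C[OF re(2)[OF that]])
    also have "\<dots> \<le> C * real (N + 2) powr (- 1 - \<delta>)"
      using re(1)[OF that] C0 by (intro mult_left_mono powr_mono) (auto simp: \<delta>_def field_simps)
    finally show ?thesis .
  qed
  have sm: "summable (\<lambda>N. C * real (N + 2) powr (- 1 - \<delta>))"
    using \<delta> summable_real_powr_iff[of "- 1 - \<delta>"]
    by (intro summable_mult, subst summable_iff_shift) auto
  show ?thesis
  proof (rule that[OF \<delta>])
    show "cball z \<delta> \<subseteq> {s. Re s > 1 - m}"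
      using re(1) \<delta> by (force simp: \<delta>_def field_simps)
    show "uniform_limit (cball z \<delta>) (\<lambda>n s. \<Sum>N<n. f N s) (\<lambda>s. \<Sum>N. f N s) sequentially"
      by (rule Weierstrass_m_test[OF bound sm])
    show "summable (\<lambda>N. f N s)" if "s \<in> cball z \<delta>" for s
      by (rule summable_comparison_test'[OF sm]) (use bound[OF that] in auto)
  qed
qed

lemma halfplane_holomorphic_suminf:
  fixes f :: "nat \<Rightarrow> complex \<Rightarrow> complex" and m :: real
  assumes bd: "\<And>B. \<exists>C. \<forall>s N. norm s \<le> B \<longrightarrow> norm (f N s) \<le> C * real (N + 2) powr (- Re s - m)"
  assumes hol: "\<And>N. f N holomorphic_on {s. Re s > 1 - m}"
  shows "(\<lambda>s. \<Sum>N. f N s) holomorphic_on {s. Re s > 1 - m}"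
proof (rule holomorphic_uniform_sequence)
  show "open {s. Re s > 1 - m}" by (rule open_halfspace_Re_gt)
  show "(\<lambda>s. \<Sum>N<n. f N s) holomorphic_on {s. Re s > 1 - m}" for n
    by (intro holomorphic_intros hol)
  fix z assume "z \<in> {s. Re s > 1 - m}"
  hence z: "Re z > 1 - m" by simp
  from halfplane_uniform_sums[OF bd z]
  show "\<exists>d>0. cball z d \<subseteq> {s. 1 - m < Re s} \<and>
      uniform_limit (cball z d) (\<lambda>n s. \<Sum>N<n. f N s) (\<lambda>s. \<Sum>N. f N s) sequentially"
    by metis
qed

lemma powr_rem_uniform_bound:
  fixes B :: real
  shows "\<exists>C. \<forall>s N. norm s \<le> B \<longrightarrow>
    norm (powr_rem m (of_nat 1 - s) (N + 2)) \<le> C * real (N + 2) powr (- Re s - real m)"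
proof -
  obtain C where C: "\<And>a N. norm a \<le> B + 1 \<Longrightarrow> N \<ge> 2 \<Longrightarrow> norm (powr_rem m a N) \<le> C * real N powr (Re a - real m - 1)"
    using powr_rem_bound[of "B + 1" m] by blast
  show ?thesis
  proof (intro exI allI impI)
    fix s :: complex and N :: nat assume "norm s \<le> B"
    hence "norm (1 - s) \<le> B + 1" using norm_triangle_ineq4[of 1 s] by simp
    from C[OF this, of "N + 2"]
    show "norm (powr_rem m (of_nat 1 - s) (N + 2)) \<le> C * real (N + 2) powr (- Re s - real m)"
      by simp
  qed
qed

section \<open>Analytic continuation of the Dirichlet series\<close>

abbreviation dirichlet :: "complex \<Rightarrow> complex" where
  "dirichlet s \<equiv> (\<Sum>n. 1 / of_nat (n + 1) powr s)"

lemma dirichlet_sums: "Re s > 1 \<Longrightarrow> (\<lambda>n. 1 / of_nat (n + 1) powr s) sums dirichlet s"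
proof -
  assume s: "Re s > 1"
  have "summable (\<lambda>n. of_nat (n + 1) powr (- s))"
  proof (rule summable_norm_cancel)
    have "summable (\<lambda>n. real (n + 1) powr (- Re s))"
      by (rule summable_ignore_initial_segment) (use s in \<open>simp add: summable_real_powr_iff\<close>)
    thus "summable (\<lambda>n. norm (of_nat (n + 1) powr (- s) :: complex))"
      by (simp add: norm_powr_real_powr)
  qed
  thus ?thesis by (simp add: powr_minus divide_simps summable_sums)
qed

lemma dirichlet_sums':
  assumes "Re s > 1"
  shows "(\<lambda>n. of_nat (n + 2) powr (- s)) sums (dirichlet s - 1)"
proof -
  have "(\<lambda>n. 1 / of_nat (Suc n + 1) powr s) sums (dirichlet s - 1)"
    using dirichlet_sums[OF assms] by (subst sums_Suc_iff) simp
  thus ?thesis by (simp add: powr_minus divide_simps)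
qed

lemma of_nat_powr_tendsto_0:
  assumes "Re a < 0"
  shows "(\<lambda>n. of_nat (n + k) powr a :: complex) \<longlonglongrightarrow> 0"
proof -
  have "(\<lambda>n. real (n + k) powr (Re a)) \<longlonglongrightarrow> 0"
    by (rule LIMSEQ_ignore_initial_segment) (rule tendsto_neg_powr[OF assms filterlim_real_sequentially])
  hence "(\<lambda>n. norm (of_nat (n + k) powr a :: complex)) \<longlonglongrightarrow> 0"
    by (rule Lim_transform_eventually)
       (auto intro!: eventually_mono[OF eventually_gt_at_top[of 0]] simp: norm_powr_real_powr)
  thus ?thesis by (rule tendsto_norm_zero_cancel)
qed

text \<open>Expanding \<open>(N - 1) powr (1 - s)\<close> around \<open>N\<close> and summing the telescoping series expresses
  the zeta function at \<open>s\<close> through its values at \<open>s + 1, s + 2, \<dots>\<close>.\<close>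

lemma dirichlet_shift:
  assumes s: "Re s > 1" and m: "m \<ge> 1"
  shows "(s - 1) * (dirichlet s - 1) = 1
    - (\<Sum>k=2..m. pochhammer (s - 1) (k - 1) / fact k * ((s + of_nat (k - 1) - 1) * (dirichlet (s + of_nat (k - 1)) - 1)))
    - (\<Sum>N. powr_rem m (of_nat 1 - s) (N + 2))"
proof -
  define a where "a = 1 - s"
  define c where "c = (\<lambda>k. (-1) ^ k * (a gchoose k))"
  have a: "Re a < 0" using s by (simp add: a_def)
  have tel: "(\<lambda>N. of_nat (N + 2 - 1) powr a - of_nat (N + 2) powr a) sums (1 - 0 :: complex)"
  proof -
    have "(\<lambda>n. of_nat (n + 1) powr a - of_nat (Suc n + 1) powr a) sums (of_nat (0 + 1) powr a - 0 :: complex)"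
      by (rule telescope_sums'[OF of_nat_powr_tendsto_0[OF a]])
    thus ?thesis by (simp add: algebra_simps numeral_2_eq_2)
  qed
  have "(\<lambda>N. c k * of_nat (N + 2) powr (a - of_nat k)) sums (c k * (dirichlet (s + of_nat (k - 1)) - 1))"
    if "k \<in> {1..m}" for k
  proof -
    have "a - of_nat k = - (s + of_nat (k - 1))" using that by (simp add: a_def of_nat_diff)
    moreover have "Re (s + of_nat (k - 1)) > 1" using s by simp
    ultimately show ?thesis using dirichlet_sums' by (intro sums_mult) metis
  qed
  hence "(\<lambda>N. \<Sum>k=1..m. c k * of_nat (N + 2) powr (a - of_nat k)) sums
      (\<Sum>k=1..m. c k * (dirichlet (s + of_nat (k - 1)) - 1))"
    by (rule sums_sum)
  from sums_diff[OF tel this]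
  have "(\<lambda>N. powr_rem m a (N + 2)) sums (1 - (\<Sum>k=1..m. c k * (dirichlet (s + of_nat (k - 1)) - 1)))"
  proof -
    have "powr_rem m a N = of_nat (N - 1) powr a - of_nat N powr a
       - (\<Sum>k=1..m. c k * of_nat N powr (a - of_nat k))" for N
      unfolding powr_rem_def atMost_atLeast0
      by (subst sum.atLeast_Suc_atMost) (simp_all add: c_def)
    thus ?thesis using \<open>(\<lambda>N. _ - (\<Sum>k=1..m. _)) sums _\<close> by simp
  qed
  hence R: "(\<Sum>N. powr_rem m a (N + 2)) = 1 - (\<Sum>k=1..m. c k * (dirichlet (s + of_nat (k - 1)) - 1))"
    by (simp add: sums_iff)
  have "(\<Sum>k=1..m. c k * (dirichlet (s + of_nat (k - 1)) - 1)) =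
      (s - 1) * (dirichlet s - 1) + (\<Sum>k=2..m. c k * (dirichlet (s + of_nat (k - 1)) - 1))"
    using m by (subst sum.atLeast_Suc_atMost) (auto simp: c_def a_def numeral_2_eq_2)
  \<comment> \<open>The last factor of the Pochhammer symbol is split off: with w = s + k - 1 it
    equals w - 1 and removes the pole of the series at w = 1, so that the right-hand side can be
    continued.\<close>
  also have "(\<Sum>k=2..m. c k * (dirichlet (s + of_nat (k - 1)) - 1)) =
     (\<Sum>k=2..m. pochhammer (s - 1) (k - 1) / fact k * ((s + of_nat (k - 1) - 1) * (dirichlet (s + of_nat (k - 1)) - 1)))"
  proof (rule sum.cong)
    fix k assume "k \<in> {2..m}"
    then obtain j where j: "k = Suc j" by (cases k) auto
    have "c k = pochhammer (s - 1) k / fact k"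
      by (simp add: c_def a_def gbinomial_pochhammer flip: mult.assoc power_add)
    also have "pochhammer (s - 1) k = pochhammer (s - 1) (k - 1) * (s + of_nat (k - 1) - 1)"
      by (simp add: j pochhammer_Suc algebra_simps)
    finally show "c k * (dirichlet (s + of_nat (k - 1)) - 1) =
      pochhammer (s - 1) (k - 1) / fact k * ((s + of_nat (k - 1) - 1) * (dirichlet (s + of_nat (k - 1)) - 1))"
      by simp
  qed simp
  finally show ?thesis using R by (simp add: a_def)
qed

text \<open>The factor s - 1 removes the pole, so all domains are full half-planes. The induction
  step reads \<open>dirichlet_shift\<close> as a definition: the arguments s + 1, s + 2, ... fall
  into the previous half-plane, and the remainder series of order \<open>Suc j\<close> converges one
  unit further to the left.\<close>

lemma zeta_halfplane:
  "\<exists>g. g holomorphic_on {s. Re s > 1 - real j} \<and> (\<forall>s. Re s > 1 \<longrightarrow> g s = (s - 1) * (dirichlet s - 1))"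
proof (induction j)
  case 0
  have *: "(\<lambda>s. \<Sum>N. of_nat (N + 2) powr (- s) :: complex) holomorphic_on {s. Re s > 1 - 0}"
  proof (rule halfplane_holomorphic_suminf)
    show "\<exists>C. \<forall>s N. norm s \<le> B \<longrightarrow> norm (of_nat (N + 2) powr (- s) :: complex) \<le> C * real (N + 2) powr (- Re s - 0)" for B
      by (intro exI[of _ 1]) (auto simp: norm_powr_real_powr)
  qed (auto intro!: holomorphic_intros)
  show ?case
    by (rule exI[of _ "\<lambda>s. (s - 1) * (\<Sum>N. of_nat (N + 2) powr (- s))"])
       (use * dirichlet_sums' in \<open>auto intro!: holomorphic_intros simp: sums_iff\<close>)
next
  case (Suc j)
  then obtain g where g: "g holomorphic_on {s. Re s > 1 - real j}"
    and g': "\<And>s. Re s > 1 \<Longrightarrow> g s = (s - 1) * (dirichlet s - 1)" by blast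
  define m where "m = Suc j"
  define h where "h = (\<lambda>s. 1
    - (\<Sum>k=2..m. pochhammer (s - 1) (k - 1) / fact k * g (s + of_nat (k - 1)))
    - (\<Sum>N. powr_rem m (of_nat 1 - s) (N + 2)))"
  have "(\<lambda>s. \<Sum>N. powr_rem m (of_nat 1 - s) (N + 2)) holomorphic_on {s. Re s > 1 - real m}"
    by (rule halfplane_holomorphic_suminf[OF powr_rem_uniform_bound])
       (auto intro!: powr_rem_holomorphic holomorphic_intros)
  moreover have "(g \<circ> (\<lambda>s. s + of_nat (k - 1))) holomorphic_on {s. Re s > 1 - real m}" if "k \<in> {2..m}" for k
    by (rule holomorphic_on_compose_gen[OF _ g]) (use that in \<open>auto intro!: holomorphic_intros simp: m_def of_nat_diff\<close>)
  ultimately have "h holomorphic_on {s. Re s > 1 - real m}"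
    unfolding h_def o_def pochhammer_prod by (intro holomorphic_intros) auto
  moreover have "h s = (s - 1) * (dirichlet s - 1)" if "Re s > 1" for s
    using dirichlet_shift[OF that, of m] that unfolding h_def by (simp add: g' m_def)
  ultimately show ?case unfolding m_def by blast
qed

text \<open>\<open>zeta\<close> is a choice, so a witness is required before any of its properties
  can be used. The continuations to larger and larger half-planes agree on overlaps by the identity
  theorem and are glued; division by s - 1 restores the pole.\<close>

lemma zeta_exists: "\<exists>f. f holomorphic_on - {1} \<and>
     (\<forall>z. Re z > 1 \<longrightarrow> (\<lambda>n. 1 / of_nat (n + 1) powr z) sums f z)"
proof -
  obtain g where g: "\<And>j. g j holomorphic_on {s. Re s > 1 - real j}"
    and g': "\<And>j s. Re s > 1 \<Longrightarrow> g j s = (s - 1) * (dirichlet s - 1)" using zeta_halfplane by metis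
  have agree: "g i s = g j s" if "i \<le> j" "Re s > 1 - real i" for i j s
  proof (rule analytic_continuation_open[where s = "{s. Re s > 1}" and s' = "{s. Re s > 1 - real i}" and f = "g i" and g = "g j"])
    show "{s. Re s > 1} \<noteq> {}" by (auto intro: exI[of _ 2])
    show "g j holomorphic_on {s. Re s > 1 - real i}" by (rule holomorphic_on_subset[OF g]) (use that in auto)
    show "connected {s. Re s > 1 - real i}" by (intro convex_connected convex_halfspace_Re_gt)
  qed (use g g' that in \<open>auto simp: open_halfspace_Re_gt\<close>)
  define G where "G = (\<lambda>s. g (nat \<lceil>2 - Re s\<rceil>) s)"
  have G: "G s = g j s" if "Re s > 1 - real j" for s j
  proof -
    have "Re s > 1 - real (nat \<lceil>2 - Re s\<rceil>)" by linarith
    thus ?thesis unfolding G_def using agree that by (metis nle_le)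
  qed
  have "G holomorphic_on UNIV"
    unfolding holomorphic_on_def
  proof
    fix z :: complex
    define j where "j = nat \<lceil>2 - Re z\<rceil>"
    have z: "z \<in> {s. Re s > 1 - real j}" unfolding j_def mem_Collect_eq by linarith
    have "G holomorphic_on {s. Re s > 1 - real j}"
      using g[of j] by (subst holomorphic_cong[OF refl, of _ G "g j"]) (auto simp: G)
    thus "G field_differentiable at z within UNIV"
      using z holomorphic_on_imp_differentiable_at open_halfspace_Re_gt by auto
  qed
  hence "(\<lambda>s. G s / (s - 1) + 1) holomorphic_on - {1}"
    by (intro holomorphic_intros) (auto elim: holomorphic_on_subset)
  moreover have "(\<lambda>n. 1 / of_nat (n + 1) powr z) sums (G z / (z - 1) + 1)" if "Re z > 1" for z
  proof -
    have "z \<noteq> 1" using that by auto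
    moreover have "G z = (z - 1) * (dirichlet z - 1)" using G[of 0 z] g'[of z 0] that by simp
    ultimately have "G z / (z - 1) + 1 = dirichlet z" by simp
    thus ?thesis using dirichlet_sums[OF that] by metis
  qed
  ultimately show ?thesis by blast
qed

lemma zeta_holomorphic: "zeta holomorphic_on - {1}"
  and zeta_sums: "Re z > 1 \<Longrightarrow> (\<lambda>n. 1 / of_nat (n + 1) powr z) sums zeta z"
proof -
  have "zeta holomorphic_on - {1} \<and> (\<forall>z. Re z > 1 \<longrightarrow> (\<lambda>n. 1 / of_nat (n + 1) powr z) sums zeta z)"
    unfolding zeta_def by (rule someI_ex[OF zeta_exists])
  thus "zeta holomorphic_on - {1}" "Re z > 1 \<Longrightarrow> (\<lambda>n. 1 / of_nat (n + 1) powr z) sums zeta z" by blast+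
qed

section \<open>Euler-Maclaurin summation and the derivative of zeta at -1\<close>

text \<open>This is s - 1 times the Euler-Maclaurin approximation of zeta(s); the coefficient 1 / 12
  is half the second Bernoulli number. The factor s - 1 cancels the pole at 1. The last correction
  is kept because it moves the region of convergence to Re s > - 2, past the point - 1.\<close>

definition zeta_EM :: "nat \<Rightarrow> complex \<Rightarrow> complex" where
  "zeta_EM N s = (s - 1) * (\<Sum>n=1..N. of_nat n powr (- s)) + of_nat N powr (1 - s)
     - (s - 1) / 2 * of_nat N powr (- s) + (s - 1) * s / 12 * of_nat N powr (- s - 1)"

text \<open>The remainders have orders 3, 2 and 1 because the exponents 1 - s, - s and - s - 1
  differ by one: all of them are then of size N powr (- Re s - 3), and all larger terms cancel. With
  every power written as a multiple of M powr (a - 3) this is a polynomial identity.\<close>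

lemma zeta_EM_step:
  assumes "N \<ge> 1"
  shows "zeta_EM (Suc N) s - zeta_EM N s = - powr_rem 3 (1 - s) (Suc N)
     - (1 - s) / 2 * powr_rem 2 (- s) (Suc N) - (s - 1) * s / 12 * powr_rem 1 (- s - 1) (Suc N)"
proof -
  define a where "a = 1 - s"
  have s: "s = 1 - a" by (simp add: a_def)
  define M :: complex where "M = of_nat (Suc N)"
  define x where "x = M powr (a - 3)"
  have "M \<noteq> 0" by (simp add: M_def del: of_nat_Suc)
  hence p: "M powr (a - 3 + of_nat k) = M ^ k * x" for k :: nat
    unfolding x_def by (simp add: powr_add powr_nat')
  have p0: "M powr a = M ^ 3 * x" and p1: "M powr (a - 1) = M ^ 2 * x" and p2: "M powr (a - 2) = M * x"
    using p[of 3] p[of 2] p[of 1] by simp_all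
  have S: "(\<Sum>n=1..Suc N. of_nat n powr (- (1 - a))) = (\<Sum>n=1..N. of_nat n powr (- (1 - a))) + M ^ 2 * x"
    by (simp add: M_def[symmetric] p1[symmetric] del: of_nat_Suc)
  have eq: "a - 1 - 1 = a - 2" "a - 1 - 2 = a - 3" "a - 2 - 1 = a - 3" "- (1 - a) = a - 1"
     "- (1 - a) - 1 = a - 2" "1 - (1 - a) = a" by simp_all
  have g: "a gchoose 0 = 1" "a gchoose 1 = a" "a gchoose 2 = a * (a - 1) / 2"
     "a gchoose 3 = a * (a - 1) * (a - 2) / 6" for a :: complex
    by (simp_all add: gbinomial_prod_rev numeral_2_eq_2 numeral_3_eq_3)
  show ?thesis
    unfolding s zeta_EM_def powr_rem_def S unfolding M_def[symmetric]
    by (simp add: atMost_nat_numeral atMost_Suc eq g p0 p1 p2 x_def[symmetric] del: sum.cl_ivl_Suc)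
       (simp add: algebra_simps power2_eq_square power3_eq_cube add_divide_distrib diff_divide_distrib)
qed

lemma zeta_EM_eq: "zeta_EM (Suc n) s = zeta_EM 1 s + (\<Sum>N<n. zeta_EM (Suc (Suc N)) s - zeta_EM (Suc N) s)"
  using sum_lessThan_telescope[of "\<lambda>N. zeta_EM (Suc N) s" n] by (simp del: sum_lessThan_telescope)

lemma zeta_EM_holomorphic: "N \<ge> 1 \<Longrightarrow> zeta_EM N holomorphic_on A"
  unfolding zeta_EM_def by (intro holomorphic_intros) auto

lemma zeta_EM_step_bound:
  "\<exists>C. \<forall>s N. norm s \<le> B \<longrightarrow>
    norm (zeta_EM (Suc (Suc N)) s - zeta_EM (Suc N) s) \<le> C * real (N + 2) powr (- Re s - 3)"
proof (cases "B \<ge> 0")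
  case True
  obtain C1 where C1: "\<And>a N. norm a \<le> B + 1 \<Longrightarrow> N \<ge> 2 \<Longrightarrow> norm (powr_rem 3 a N) \<le> C1 * real N powr (Re a - 3 - 1)"
    using powr_rem_bound[of "B + 1" 3] by auto
  obtain C2 where C2: "\<And>a N. norm a \<le> B + 1 \<Longrightarrow> N \<ge> 2 \<Longrightarrow> norm (powr_rem 2 a N) \<le> C2 * real N powr (Re a - 2 - 1)"
    using powr_rem_bound[of "B + 1" 2] by auto
  obtain C3 where C3: "\<And>a N. norm a \<le> B + 1 \<Longrightarrow> N \<ge> 2 \<Longrightarrow> norm (powr_rem 1 a N) \<le> C3 * real N powr (Re a - 1 - 1)"
    using powr_rem_bound[of "B + 1" 1] by auto
  show ?thesis
  proof (intro exI allI impI)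
    fix s :: complex and N :: nat assume s: "norm s \<le> B"
    define Y where "Y = real (N + 2) powr (- Re s - 3)"
    have n: "norm (1 - s) \<le> B + 1" "norm (- s) \<le> B + 1" "norm (- s - 1) \<le> B + 1" "norm (s - 1) \<le> B + 1"
      using s norm_triangle_ineq4[of 1 s] norm_triangle_ineq4[of "- s" 1] norm_triangle_ineq4[of "s" 1] by simp_all
    have b1: "norm (powr_rem 3 (1 - s) (N + 2)) \<le> C1 * Y" using C1[OF n(1), of "N + 2"] by (simp add: Y_def algebra_simps)
    have b2: "norm (powr_rem 2 (- s) (N + 2)) \<le> C2 * Y" using C2[OF n(2), of "N + 2"] by (simp add: Y_def algebra_simps)
    have b3: "norm (powr_rem 1 (- s - 1) (N + 2)) \<le> C3 * Y" using C3[OF n(3), of "N + 2"] by (simp add: Y_def algebra_simps)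
    have b4: "norm (s - 1) * norm s \<le> (B + 1) * B"
      using n s True by (intro mult_mono) auto
    have "norm (zeta_EM (Suc (Suc N)) s - zeta_EM (Suc N) s) =
       norm (- powr_rem 3 (1 - s) (N + 2) - (1 - s) / 2 * powr_rem 2 (- s) (N + 2) - (s - 1) * s / 12 * powr_rem 1 (- s - 1) (N + 2))"
      by (subst zeta_EM_step) (simp_all add: numeral_2_eq_2)
    also have "\<dots> \<le> norm (powr_rem 3 (1 - s) (N + 2)) + norm ((1 - s) / 2 * powr_rem 2 (- s) (N + 2))
        + norm ((s - 1) * s / 12 * powr_rem 1 (- s - 1) (N + 2))"
      by (rule order_trans[OF norm_triangle_ineq4 add_right_mono])
         (rule order_trans[OF norm_triangle_ineq4], simp)
    also have "\<dots> \<le> C1 * Y + (B + 1) / 2 * (C2 * Y) + (B + 1) * B / 12 * (C3 * Y)"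
      unfolding norm_mult norm_divide
      using n s True b4 by (intro add_mono mult_mono b1 b2 b3 divide_right_mono) auto
    finally show "norm (zeta_EM (Suc (Suc N)) s - zeta_EM (Suc N) s) \<le>
       (C1 + (B + 1) / 2 * C2 + (B + 1) * B / 12 * C3) * real (N + 2) powr (- Re s - 3)"
      by (simp only: Y_def[symmetric] distrib_right mult.assoc)
  qed
next
  case False
  thus ?thesis by (meson norm_ge_zero order_trans)
qed

definition zeta_EM_lim :: "complex \<Rightarrow> complex" where
  "zeta_EM_lim s = zeta_EM 1 s + (\<Sum>N. zeta_EM (Suc (Suc N)) s - zeta_EM (Suc N) s)"

lemma zeta_EM_uniform:
  assumes "Re z > - 2"
  obtains d where "d > 0" "cball z d \<subseteq> {s. Re s > - 2}"
    "uniform_limit (cball z d) (\<lambda>n. zeta_EM (Suc n)) zeta_EM_lim sequentially"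
proof -
  have z: "Re z > 1 - 3" using assms by simp
  obtain d where d: "d > 0" "cball z d \<subseteq> {s. Re s > 1 - 3}"
    "uniform_limit (cball z d) (\<lambda>n s. \<Sum>N<n. zeta_EM (Suc (Suc N)) s - zeta_EM (Suc N) s)
       (\<lambda>s. \<Sum>N. zeta_EM (Suc (Suc N)) s - zeta_EM (Suc N) s) sequentially"
    by (rule halfplane_uniform_sums[of "\<lambda>N s. zeta_EM (Suc (Suc N)) s - zeta_EM (Suc N) s", OF zeta_EM_step_bound z])
  have "uniform_limit (cball z d) (\<lambda>n s. zeta_EM 1 s + (\<Sum>N<n. zeta_EM (Suc (Suc N)) s - zeta_EM (Suc N) s))
       zeta_EM_lim sequentially"
    unfolding zeta_EM_lim_def by (intro uniform_limit_intros d(3))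
  moreover have "(\<lambda>n. zeta_EM (Suc n)) = (\<lambda>n s. zeta_EM 1 s + (\<Sum>N<n. zeta_EM (Suc (Suc N)) s - zeta_EM (Suc N) s))"
    by (intro ext zeta_EM_eq)
  ultimately have "uniform_limit (cball z d) (\<lambda>n. zeta_EM (Suc n)) zeta_EM_lim sequentially"
    by simp
  thus ?thesis using that[of d] d by simp
qed

text \<open>Identity theorem on the half-plane without the point 1: where Re s > 1 the three
  correction terms tend to 0. \<open>zeta\<close> has no prescribed value at 1, which is why the
  right-hand side falls back to \<open>zeta_EM_lim 1\<close> there.\<close>

lemma zeta_EM_lim_eq:
  assumes "Re s > - 2"
  shows "zeta_EM_lim s = (if s = 1 then zeta_EM_lim 1 else (s - 1) * zeta s)"
proof (cases "s = 1")
  case False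
  have "zeta_EM_lim s = (s - 1) * zeta s"
  proof (rule analytic_continuation_open[where s = "{s. Re s > 1}" and s' = "{s. Re s > - 2} - {1}"
      and f = zeta_EM_lim and g = "\<lambda>s. (s - 1) * zeta s"])
    show "open {s::complex. 1 < Re s}" by (rule open_halfspace_Re_gt)
    show "open ({s::complex. - 2 < Re s} - {1})" by (intro open_Diff open_halfspace_Re_gt) auto
    show "{s. Re s > 1} \<noteq> {}" by (auto intro: exI[of _ 2])
    show "connected ({s::complex. - 2 < Re s} - {1})"
      by (intro connected_open_delete convex_connected convex_halfspace_Re_gt open_halfspace_Re_gt) auto
    show "zeta_EM_lim holomorphic_on {s. - 2 < Re s} - {1}"
    proof (rule holomorphic_on_subset[OF holomorphic_uniform_sequence])
      show "open {s::complex. - 2 < Re s}" by (rule open_halfspace_Re_gt)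
      show "zeta_EM (Suc n) holomorphic_on {s. - 2 < Re s}" for n by (rule zeta_EM_holomorphic) simp
      fix x assume "x \<in> {s. - 2 < Re s}"
      thus "\<exists>d>0. cball x d \<subseteq> {s. - 2 < Re s} \<and> uniform_limit (cball x d) (\<lambda>n. zeta_EM (Suc n)) zeta_EM_lim sequentially"
        using zeta_EM_uniform[of x] by (metis mem_Collect_eq)
    qed auto
    show "(\<lambda>s. (s - 1) * zeta s) holomorphic_on {s. - 2 < Re s} - {1}"
      by (intro holomorphic_intros holomorphic_on_subset[OF zeta_holomorphic]) auto
    show "s \<in> {s. - 2 < Re s} - {1}" using False assms by auto
    show "{s. 1 < Re s} \<subseteq> {s. - 2 < Re s} - {1}" by auto
    fix z assume "z \<in> {s. Re s > 1}"
    hence z: "Re z > 1" by simp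
    have "Re z > - 2" using z by simp
    then obtain d where d: "d > 0" "uniform_limit (cball z d) (\<lambda>n. zeta_EM (Suc n)) zeta_EM_lim sequentially"
      by (rule zeta_EM_uniform)
    hence l1: "(\<lambda>n. zeta_EM (Suc n) z) \<longlonglongrightarrow> zeta_EM_lim z"
      using tendsto_uniform_limitI[OF d(2), of z] by simp
    have "(\<lambda>n. \<Sum>k<n. 1 / of_nat (k + 1) powr z) \<longlonglongrightarrow> zeta z"
      using zeta_sums[OF z] by (simp add: sums_def)
    hence "(\<lambda>n. \<Sum>k<Suc n. 1 / of_nat (k + 1) powr z) \<longlonglongrightarrow> zeta z"
      by (rule LIMSEQ_Suc)
    moreover have "(\<Sum>k<Suc n. 1 / of_nat (k + 1) powr z) = (\<Sum>n=1..Suc n. of_nat n powr (- z))" for n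
      by (rule sum.reindex_bij_witness[of _ "\<lambda>k. k - 1" Suc]) (auto simp: powr_minus divide_simps)
    ultimately have "(\<lambda>n. \<Sum>n=1..Suc n. of_nat n powr (- z)) \<longlonglongrightarrow> zeta z" by simp
    hence "(\<lambda>n. zeta_EM (n + 1) z) \<longlonglongrightarrow> (z - 1) * zeta z + 0 - (z - 1) / 2 * 0 + (z - 1) * z / 12 * 0"
      unfolding zeta_EM_def using z by (intro tendsto_intros of_nat_powr_tendsto_0) auto
    thus "zeta_EM_lim z = (z - 1) * zeta z"
      using LIMSEQ_unique[OF l1] by simp
  qed
  thus ?thesis using False by simp
qed simp

lemma sum_of_nat_1: "2 * (\<Sum>n=1..N. of_nat n :: complex) = of_nat N * (of_nat N + 1)"
proof (induction N)
  case (Suc N)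
  have "2 * (\<Sum>n=1..Suc N. of_nat n :: complex) = 2 * (\<Sum>n=1..N. of_nat n) + 2 * of_nat (Suc N)"
    by (simp add: distrib_left del: of_nat_Suc)
  thus ?case unfolding Suc.IH by (simp add: algebra_simps)
qed simp

text \<open>A locally uniform limit of holomorphic functions may be differentiated. The derivative
  of (s - 1) * zeta s at - 1 is zeta(-1) - 2 zeta'(-1), whence the affine rescaling at the
  end.\<close>

lemma zeta_minus_one_deriv_limit:
  "(\<lambda>N. complex_of_real ((real N ^ 2 / 2 + real N / 2 + 1 / 12) * ln (real N) - real N ^ 2 / 4 + 1 / 12
     - (\<Sum>n=1..N. real n * ln (real n)))) \<longlonglongrightarrow> deriv zeta (- 1)"
proof -
  have m1: "Re (- 1) > - 2" by simp
  obtain d where d: "d > 0" "cball (- 1) d \<subseteq> {s. Re s > - 2}"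
      "uniform_limit (cball (- 1) d) (\<lambda>n. zeta_EM (Suc n)) zeta_EM_lim sequentially"
    by (rule zeta_EM_uniform[OF m1])
  have zh: "zeta field_differentiable at (- 1)"
    by (rule holomorphic_on_imp_differentiable_at[OF zeta_holomorphic]) auto
  have "(\<lambda>n. zeta_EM (Suc n) (- 1)) \<longlonglongrightarrow> zeta_EM_lim (- 1)"
    using tendsto_uniform_limitI[OF d(3), of "- 1"] d(1) by simp
  \<comment> \<open>The Euler-Maclaurin formula is exact at - 1: the corrections reduce the sum N (N
    + 1) / 2 to the constant - 1 / 12, here multiplied by s - 1 = - 2.\<close>
  moreover have "zeta_EM (Suc n) (- 1) = 1 / 6" for n
    using sum_of_nat_1[of "Suc n"] unfolding zeta_EM_def
    by (simp add: powr_nat' algebra_simps power2_eq_square del: of_nat_Suc sum.cl_ivl_Suc)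
  ultimately have "zeta_EM_lim (- 1) = 1 / 6"
    by (simp add: LIMSEQ_const_iff)
  hence "- 2 * zeta (- 1) = 1 / 6" using zeta_EM_lim_eq[of "- 1"] by simp
  hence "(- 2 * zeta (- 1)) / - 2 = (1 / 6) / - 2" by (simp only:)
  hence z1: "zeta (- 1) = - 1 / 12" by simp
  have "(\<lambda>n. deriv (zeta_EM (Suc n)) (- 1)) \<longlonglongrightarrow> deriv zeta_EM_lim (- 1)"
  proof (rule deriv_complex_uniform_limit[where A = "ball (- 1) d"])
    show "uniform_limit (ball (- 1) d) (\<lambda>n. zeta_EM (Suc n)) zeta_EM_lim sequentially"
      by (rule uniform_limit_on_subset[OF d(3) ball_subset_cball])
    show "\<forall>\<^sub>F n in sequentially. zeta_EM (Suc n) holomorphic_on ball (- 1) d"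
      by (intro always_eventually allI zeta_EM_holomorphic) simp
  qed (use d(1) in simp_all)
  also have "deriv zeta_EM_lim (- 1) = deriv (\<lambda>s. (s - 1) * zeta s) (- 1)"
  proof (rule deriv_cong_ev)
    have "eventually (\<lambda>s. s \<in> ball (- 1) (min d 1)) (nhds (- 1 :: complex))"
      using d(1) by (intro eventually_nhds_in_open) auto
    thus "eventually (\<lambda>s. zeta_EM_lim s = (s - 1) * zeta s) (nhds (- 1))"
    proof eventually_elim
      case (elim s)
      hence "s \<in> cball (- 1) d" "s \<noteq> 1" by (auto simp: dist_norm)
      hence "Re s > - 2" "s \<noteq> 1" using d(2) by blast+
      thus ?case using zeta_EM_lim_eq[of s] by simp
    qed
  qed simp
  also have "\<dots> = - 1 / 12 - 2 * deriv zeta (- 1)"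
    by (rule DERIV_imp_deriv)
       (use field_differentiable_derivI[OF zh] z1 in \<open>auto intro!: derivative_eq_intros\<close>)
  finally have L: "(\<lambda>n. deriv (zeta_EM (Suc n)) (- 1)) \<longlonglongrightarrow> - 1 / 12 - 2 * deriv zeta (- 1)" .
  have D: "deriv (zeta_EM N) (- 1) = of_real (- 1 / 12 - 2 * ((real N ^ 2 / 2 + real N / 2 + 1 / 12) * ln (real N) - real N ^ 2 / 4 + 1 / 12
     - (\<Sum>n=1..N. real n * ln (real n))))" if N: "N \<ge> 1" for N
  proof -
    have pw: "((\<lambda>s. of_nat n powr (g s)) has_field_derivative g' * (of_real (ln (real n)) * of_nat n powr (g s))) (at s)"
      if "n \<ge> 1" "(g has_field_derivative g') (at s)" for n :: nat and g :: "complex \<Rightarrow> complex" and g' s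
    proof -
      have "Ln (of_nat n) = of_real (ln (real n))" using that(1) by (intro Ln_of_nat) auto
      thus ?thesis using that by (auto simp: powr_def intro!: derivative_eq_intros)
    qed
    have sm: "((\<lambda>s. \<Sum>n=1..N. of_nat n powr (- s)) has_field_derivative (\<Sum>n=1..N. - 1 * (of_real (ln (real n)) * of_nat n powr (- s)))) (at s)" for s :: complex
      by (intro DERIV_sum pw) (auto intro!: derivative_eq_intros)
    define d where "d = (1 - 0) * (\<Sum>n=1..N. of_nat n powr (- (- 1))) + (\<Sum>n=1..N. - 1 * (of_real (ln (real n)) * of_nat n powr (- (- 1)))) * (- 1 - 1)
        + - 1 * (of_real (ln (real N)) * of_nat N powr (1 - (- 1)))
        - (1 / 2 * of_nat N powr (- (- 1)) + (- 1 * (of_real (ln (real N)) * of_nat N powr (- (- 1)))) * ((- 1 - 1) / 2))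
        + ((2 * (- 1) - 1) / 12 * of_nat N powr (- (- 1) - 1) + (- 1 * (of_real (ln (real N)) * of_nat N powr (- (- 1) - 1))) * ((- 1 - 1) * (- 1 :: complex) / 12))"
    have "(zeta_EM N has_field_derivative d) (at (- 1))"
      unfolding zeta_EM_def d_def
      by (intro DERIV_add DERIV_diff DERIV_mult sm pw N)
         (auto intro!: derivative_eq_intros)
    hence "deriv (zeta_EM N) (- 1) = d" by (rule DERIV_imp_deriv)
    also have "\<dots> = of_real (- 1 / 12 - 2 * ((real N ^ 2 / 2 + real N / 2 + 1 / 12) * ln (real N) - real N ^ 2 / 4 + 1 / 12
     - (\<Sum>n=1..N. real n * ln (real n))))"
    proof -
      have "(\<Sum>n=1..N. of_nat n :: complex) = of_nat N * (of_nat N + 1) / 2"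
        using sum_of_nat_1[of N] by (metis nonzero_mult_div_cancel_left zero_neq_numeral)
      thus ?thesis using N unfolding d_def
        by (simp add: powr_nat' sum_negf algebra_simps power2_eq_square sum_distrib_left add_divide_distrib)
    qed
    finally show ?thesis .
  qed
  define u where "u = (\<lambda>N. (real N ^ 2 / 2 + real N / 2 + 1 / 12) * ln (real N) - real N ^ 2 / 4 + 1 / 12
     - (\<Sum>n=1..N. real n * ln (real n)))"
  have "deriv (zeta_EM (Suc n)) (- 1) = complex_of_real (- 1 / 12 - 2 * u (Suc n))" for n
    unfolding u_def by (rule D) simp
  hence "(\<lambda>n. complex_of_real (- 1 / 12 - 2 * u (Suc n))) \<longlonglongrightarrow> - 1 / 12 - 2 * deriv zeta (- 1)"
    using L by (simp only:)
  hence "(\<lambda>n. (- 1 / 12 - complex_of_real (- 1 / 12 - 2 * u (Suc n))) / 2) \<longlonglongrightarrow> (- 1 / 12 - (- 1 / 12 - 2 * deriv zeta (- 1))) / 2"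
    by (intro tendsto_intros) auto
  hence "(\<lambda>n. complex_of_real (u (Suc n))) \<longlonglongrightarrow> deriv zeta (- 1)" by simp
  thus ?thesis unfolding u_def by (rule LIMSEQ_imp_Suc)
qed

section \<open>The Glaisher-Kinkelin constant\<close>

definition stirling_diff :: "nat \<Rightarrow> real" where
  "stirling_diff n = ln (fact n) - (real n + 1 / 2) * ln (real n) + real n"

lemma stirling_diff_step:
  assumes "n \<ge> 1"
  shows "stirling_diff n - stirling_diff (Suc n) = (real n + 1 / 2) * ln (1 + 1 / real n) - 1"
proof -
  have 1: "ln (fact (Suc n) :: real) = ln (real (Suc n)) + ln (fact n)"
    unfolding fact_Suc by (subst ln_mult) auto
  have 2: "ln (1 + 1 / real n) = ln (real (Suc n)) - ln (real n)"
  proof -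
    have "1 + 1 / real n = real (Suc n) / real n" using assms by (simp add: field_simps)
    thus ?thesis using assms by (simp add: ln_div)
  qed
  show ?thesis
    unfolding stirling_diff_def 1 2 by (simp add: algebra_simps)
qed

lemma stirling_diff_convergent: "convergent stirling_diff"
proof -
  have "(\<lambda>n. (real n + 1 / 2) * ln (1 + 1 / real n) - 1) \<in> O(\<lambda>n. 1 / real n ^ 2)"
    by real_asymp
  moreover have "summable (\<lambda>n. norm (1 / real n ^ 2))"
    using inverse_power_summable[of 2, where ?'a = real] by (simp add: divide_simps)
  ultimately have "summable (\<lambda>n. (real n + 1 / 2) * ln (1 + 1 / real n) - 1)"
    by (rule summable_comparison_test_bigo[rotated])
  hence "summable (\<lambda>n. (real (Suc n) + 1 / 2) * ln (1 + 1 / real (Suc n)) - 1)"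
    by (subst summable_Suc_iff)
  hence "summable (\<lambda>n. stirling_diff (Suc n) - stirling_diff (Suc (Suc n)))"
    by (subst stirling_diff_step) simp_all
  hence "convergent (\<lambda>n. \<Sum>k<n. stirling_diff (Suc k) - stirling_diff (Suc (Suc k)))"
    by (simp add: summable_iff_convergent)
  hence "convergent (\<lambda>n. stirling_diff (Suc 0) - stirling_diff (Suc n))"
    by (simp only: sum_lessThan_telescope'[of "\<lambda>n. stirling_diff (Suc n)"])
  from convergent_diff[OF convergent_const[of "stirling_diff (Suc 0)"] this]
  have "convergent (\<lambda>n. stirling_diff (Suc n))" by simp
  thus ?thesis by (rule convergent_Suc_iff[THEN iffD1])
qed

lemma wallis_fact:
  "(\<Prod>k=1..n. (4*real k^2) / (4*real k^2 - 1)) = 16 ^ n * fact n ^ 4 / (fact (2 * n) ^ 2 * (2 * real n + 1))"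
proof (induction n)
  case (Suc n)
  have "(\<Prod>k=1..Suc n. (4*real k^2) / (4*real k^2 - 1)) =
     (\<Prod>k=1..n. (4*real k^2) / (4*real k^2 - 1)) * (4*real (Suc n)^2 / (4*real (Suc n)^2 - 1))"
    unfolding prod.cl_ivl_Suc by simp
  also have "\<dots> = 16 ^ n * fact n ^ 4 / (fact (2 * n) ^ 2 * (2 * real n + 1)) * (4*real (Suc n)^2 / (4*real (Suc n)^2 - 1))"
    by (simp only: Suc.IH)
  also have "4*real (Suc n)^2 - 1 = (2 * real n + 1) * (2 * real n + 3)"
    by (simp add: power2_eq_square algebra_simps)
  also have "16 ^ n * fact n ^ 4 / (fact (2 * n) ^ 2 * (2 * real n + 1)) * (4*real (Suc n)^2 / ((2 * real n + 1) * (2 * real n + 3)))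
    = 16 ^ Suc n * fact (Suc n) ^ 4 / (fact (2 * Suc n) ^ 2 * (2 * real (Suc n) + 1))"
  proof -
    have f: "fact (2 * Suc n) = (2 * real n + 2) * (2 * real n + 1) * fact (2 * n)"
      by (simp add: algebra_simps)
    define x where "x = real n"
    have p: "x \<ge> 0" by (simp add: x_def)
    define A where "A = (fact n :: real)"
    define B where "B = (fact (2 * n) :: real)"
    have nz: "B \<noteq> 0" "x + 1 \<noteq> 0" "2 * x + 1 \<noteq> 0" "2 * x + 3 \<noteq> 0" "2 * x + 2 \<noteq> 0"
      using p by (auto simp: B_def)
    have "16 ^ n * A ^ 4 / (B\<^sup>2 * (2 * x + 1)) * (4 * (x + 1)\<^sup>2 / ((2 * x + 1) * (2 * x + 3))) =
      16 ^ n * 16 * ((x + 1) * A) ^ 4 / (((2 * x + 2) * (2 * x + 1) * B)\<^sup>2 * (2 * (x + 1) + 1))"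
    proof -
      have e: "2 * x + 2 = 2 * (x + 1)" "2 * (x + 1) + 1 = 2 * x + 3" by simp_all
      show ?thesis unfolding e using nz
        by (simp add: divide_simps power_mult_distrib) (simp add: power2_eq_square power4_eq_xxxx algebra_simps)
    qed
    thus ?thesis unfolding f by (simp add: A_def B_def x_def algebra_simps)
  qed
  finally show ?case .
qed simp

text \<open>Twice the limit is the limit of 4 \<open>stirling_diff n\<close> - 2
  \<open>stirling_diff (2 * n)\<close>, in which the growing terms cancel and the logarithm of the
  Wallis product remains.\<close>

lemma stirling_diff_limit: "stirling_diff \<longlonglongrightarrow> ln (2 * pi) / 2"
proof -
  obtain L where L: "stirling_diff \<longlonglongrightarrow> L"
    using stirling_diff_convergent by (auto simp: convergent_def)
  have "filterlim (\<lambda>n::nat. 2 * n) sequentially sequentially"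
    by real_asymp
  from filterlim_compose[OF L this] have L2: "(\<lambda>n. stirling_diff (2 * n)) \<longlonglongrightarrow> L" .
  have A: "(\<lambda>n. 4 * stirling_diff n - 2 * stirling_diff (2 * n)) \<longlonglongrightarrow> 4 * L - 2 * L"
    by (intro tendsto_intros L L2)
  have B: "(\<lambda>n. ln (\<Prod>k=1..n. (4*real k^2) / (4*real k^2 - 1)) + ln ((2 * real n + 1) / real n) + ln 2)
     \<longlonglongrightarrow> ln (pi / 2) + ln 2 + ln 2"
  proof (intro tendsto_intros wallis)
    show "(\<lambda>n. (2 * real n + 1) / real n) \<longlonglongrightarrow> 2" by real_asymp
  qed simp_all
  have E: "eventually (\<lambda>n. ln (\<Prod>k=1..n. (4*real k^2) / (4*real k^2 - 1)) + ln ((2 * real n + 1) / real n) + ln 2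
     = 4 * stirling_diff n - 2 * stirling_diff (2 * n)) sequentially"
    using eventually_gt_at_top[of 0]
  proof eventually_elim
    case (elim n)
    have "ln (16::real) = 4 * ln 2" using ln_realpow[of 2 4] by simp
    thus ?case using elim unfolding wallis_fact stirling_diff_def
      by (simp add: ln_mult ln_div ln_realpow) (simp add: algebra_simps)
  qed
  have "4 * L - 2 * L = ln (pi / 2) + ln 2 + ln 2"
    by (rule LIMSEQ_unique[OF A Lim_transform_eventually[OF B E]])
  hence "L = ln (2 * pi) / 2" by (simp add: ln_div ln_mult)
  with L show ?thesis by (simp only:)
qed

lemma eventually_decreasing_ge_limit:
  fixes f :: "nat \<Rightarrow> real"
  assumes "eventually (\<lambda>n. f (Suc n) \<le> f n) sequentially" "f \<longlonglongrightarrow> L"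
  shows "eventually (\<lambda>n. L \<le> f n) sequentially"
proof -
  obtain N where N: "\<And>n. n \<ge> N \<Longrightarrow> f (Suc n) \<le> f n"
    using assms(1) by (auto simp: eventually_at_top_linorder)
  have "L \<le> f n" if "n \<ge> N" for n
  proof (rule LIMSEQ_le_const2[OF assms(2)], rule exI[of _ n], safe)
    fix m assume "n \<le> m"
    thus "f m \<le> f n" by (induction m rule: dec_induct) (use N that in \<open>auto intro: order_trans\<close>)
  qed
  thus ?thesis by (auto simp: eventually_at_top_linorder)
qed

text \<open>The next Stirling term matters because ln n! is later multiplied by n. The decrements of
  \<open>stirling_diff\<close> are asymptotic to 1 / (12 n^2) and those of c / n to c / n^2; so the
  difference of the two sequences is eventually decreasing for c < 1 / 12, eventually increasing for
  c > 1 / 12, and lies on the corresponding side of its limit.\<close>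

lemma stirling_diff_second_order:
  "(\<lambda>n. real n * (stirling_diff n - ln (2 * pi) / 2)) \<longlonglongrightarrow> 1 / 12"
proof (rule order_tendstoI)
  define L where "L = ln (2 * pi) / 2"
  have lim: "(\<lambda>n. stirling_diff n - c / real n) \<longlonglongrightarrow> L" for c
  proof -
    have "(\<lambda>n. stirling_diff n - c / real n) \<longlonglongrightarrow> L - 0"
      unfolding L_def by (intro tendsto_diff stirling_diff_limit) real_asymp
    thus ?thesis by simp
  qed
  have step: "stirling_diff n - c / real n - (stirling_diff (Suc n) - c / real (Suc n)) =
      (real n + 1 / 2) * ln (1 + 1 / real n) - 1 - c * (1 / real n - 1 / (real n + 1))" if "n \<ge> 1" for n c
    using stirling_diff_step[OF that] by (simp add: algebra_simps)
  fix a :: real assume a: "a < 1 / 12"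
  \<comment> \<open>The midpoint leaves a margin: monotonicity yields a weak inequality for
    \<open>c\<close>, hence a strict one for \<open>a\<close>.\<close>
  define c where "c = (a + 1 / 12) / 2"
  have c: "a < c" "c < 1 / 12" using a by (auto simp: c_def)
  have "eventually (\<lambda>n. (real n + 1 / 2) * ln (1 + 1 / real n) - 1 - c * (1 / real n - 1 / (real n + 1)) \<ge> 0) sequentially"
    using c by real_asymp
  hence "eventually (\<lambda>n. stirling_diff (Suc n) - c / real (Suc n) \<le> stirling_diff n - c / real n) sequentially"
    using eventually_ge_at_top[of 1]
  proof eventually_elim
    case (elim n)
    thus ?case using step[of n c] by linarith
  qed
  from eventually_decreasing_ge_limit[OF this lim]
  show "eventually (\<lambda>n. a < real n * (stirling_diff n - L)) sequentially"
    using eventually_gt_at_top[of 0]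
  proof eventually_elim
    case (elim n)
    hence "c \<le> real n * (stirling_diff n - L)" by (simp add: field_simps)
    thus ?case using c by simp
  qed
next
  define L where "L = ln (2 * pi) / 2"
  have lim: "(\<lambda>n. c / real n - stirling_diff n) \<longlonglongrightarrow> - L" for c
  proof -
    have "(\<lambda>n. c / real n - stirling_diff n) \<longlonglongrightarrow> 0 - L"
      unfolding L_def by (intro tendsto_diff stirling_diff_limit) real_asymp
    thus ?thesis by simp
  qed
  have step: "stirling_diff n - c / real n - (stirling_diff (Suc n) - c / real (Suc n)) =
      (real n + 1 / 2) * ln (1 + 1 / real n) - 1 - c * (1 / real n - 1 / (real n + 1))" if "n \<ge> 1" for n c
    using stirling_diff_step[OF that] by (simp add: algebra_simps)
  fix a :: real assume a: "a > 1 / 12"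
  define c where "c = (a + 1 / 12) / 2"
  have c: "a > c" "c > 1 / 12" using a by (auto simp: c_def)
  have "eventually (\<lambda>n. (real n + 1 / 2) * ln (1 + 1 / real n) - 1 - c * (1 / real n - 1 / (real n + 1)) \<le> 0) sequentially"
    using c by real_asymp
  hence "eventually (\<lambda>n. c / real (Suc n) - stirling_diff (Suc n) \<le> c / real n - stirling_diff n) sequentially"
    using eventually_ge_at_top[of 1]
  proof eventually_elim
    case (elim n)
    thus ?case using step[of n c] by linarith
  qed
  from eventually_decreasing_ge_limit[OF this lim]
  show "eventually (\<lambda>n. a > real n * (stirling_diff n - L)) sequentially"
    using eventually_gt_at_top[of 0]
  proof eventually_elim
    case (elim n)
    hence "c \<ge> real n * (stirling_diff n - L)" by (simp add: field_simps)
    thus ?case using c by simp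
  qed
qed

lemma central_binomial_asymptotics:
  "(\<lambda>n. 4 ^ n * fact n ^ 2 / fact (2 * n) / sqrt (real n)) \<longlonglongrightarrow> sqrt pi"
proof -
  have A: "(\<lambda>n. sqrt ((\<Prod>k=1..n. (4*real k^2) / (4*real k^2 - 1)) * ((2 * real n + 1) / real n))) \<longlonglongrightarrow> sqrt (pi / 2 * 2)"
    by (intro tendsto_intros wallis) real_asymp
  have E: "eventually (\<lambda>n. sqrt ((\<Prod>k=1..n. (4*real k^2) / (4*real k^2 - 1)) * ((2 * real n + 1) / real n))
     = 4 ^ n * fact n ^ 2 / fact (2 * n) / sqrt (real n)) sequentially"
    using eventually_gt_at_top[of 0]
  proof eventually_elim
    case (elim n)
    have eq: "(\<Prod>k=1..n. (4*real k^2) / (4*real k^2 - 1)) * ((2 * real n + 1) / real n) = (4 ^ n * fact n ^ 2 / fact (2 * n))\<^sup>2 / real n"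
    proof -
      have "(16 :: real) ^ n = (4 ^ n)\<^sup>2" by (simp add: power2_eq_square flip: power_mult_distrib)
      thus ?thesis unfolding wallis_fact using elim
        by (simp add: power_divide power_mult_distrib flip: power_mult)
    qed
    show ?case unfolding eq by (simp add: real_sqrt_divide)
  qed
  from Lim_transform_eventually[OF A E] show ?thesis by simp
qed

section \<open>Hyperfactorials and the product of the Legendre norms\<close>

definition xlnx_sum :: "nat \<Rightarrow> real" where
  "xlnx_sum n = (\<Sum>k=1..n. real k * ln (real k))"

lemma sum_ln_fact: "(\<Sum>k<n. ln (fact k :: real)) = real n * ln (fact n) - xlnx_sum n"
proof (induction n)
  case (Suc n)
  have "ln (fact (Suc n) :: real) = ln (real (Suc n)) + ln (fact n)"
    unfolding fact_Suc by (subst ln_mult) auto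
  thus ?case using Suc by (simp add: xlnx_sum_def algebra_simps)
qed (simp add: xlnx_sum_def)

lemma sum_ln_fact_double: "(\<Sum>k<n. ln (fact (2 * k) :: real) + ln (fact (2 * k + 1))) = (\<Sum>k<2 * n. ln (fact k))"
  by (induction n) simp_all

text \<open>This is 4 ^ k / pi times the squared norm of the monic Legendre polynomial on the
  interval from -1 to 1. The scaling removes the geometric decay of the norms, so that their product
  varies only like a power of n.\<close>

definition legendre_factor :: "nat \<Rightarrow> real" where
  "legendre_factor k = 2 * 16 ^ k * fact k ^ 4 / (fact (2 * k) * fact (2 * k + 1)) / pi"

lemma legendre_factor_pos: "legendre_factor k > 0"
  by (simp add: legendre_factor_def)

lemma ln_legendre_factor_prod:
  "ln (\<Prod>k<n. legendre_factor k) = 2 * ln 2 * real n * (real n - 1) + real n * ln 2 - real n * ln pi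
     + 4 * (real n * ln (fact n) - xlnx_sum n) - (2 * real n * ln (fact (2 * n)) - xlnx_sum (2 * n))"
proof -
  have "ln (16::real) = 4 * ln 2" using ln_realpow[of 2 4] by simp
  hence 1: "ln (legendre_factor k) = ln 2 - ln pi + 4 * ln 2 * real k + 4 * ln (fact k) - (ln (fact (2 * k)) + ln (fact (2 * k + 1)))" for k
    unfolding legendre_factor_def by (simp add: ln_mult ln_div ln_realpow del: fact_Suc)
  have "ln (\<Prod>k<n. legendre_factor k) = (\<Sum>k<n. ln (legendre_factor k))"
    by (rule ln_prod) (auto simp: legendre_factor_pos less_imp_neq[OF legendre_factor_pos, symmetric])
  also have "\<dots> = (\<Sum>k<n. ln 2 - ln pi + 4 * ln 2 * real k) + 4 * (\<Sum>k<n. ln (fact k)) - (\<Sum>k<2*n. ln (fact k))"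
    unfolding 1 sum_ln_fact_double[symmetric] by (simp add: sum.distrib sum_subtractf sum_distrib_left)
  also have "(\<Sum>k<n. ln 2 - ln pi + 4 * ln 2 * real k) = 2 * ln 2 * real n * (real n - 1) + real n * ln 2 - real n * ln pi"
    by (induction n) (auto simp: algebra_simps)
  finally show ?thesis unfolding sum_ln_fact by simp
qed

text \<open>In the logarithm of the product, u(n) and u(2 n) enter with weights 4 and - 1, so
  zeta'(-1) occurs 4 - 1 = 3 times. The Stirling corrections contribute (4 - 1) / 12, which cancels
  the - 1 / 4 left by the hyperfactorials; ln 2 / 12 comes from ln (2 n) in the hyperfactorial of
  index 2 n.\<close>

lemma legendre_factor_prod_limit:
  obtains z where "deriv zeta (- 1) = complex_of_real z"
    "(\<lambda>n. (\<Prod>k<n. legendre_factor k) * real n powr (1 / 4)) \<longlonglongrightarrow> 2 powr (1 / 12) * exp (3 * z)"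
proof -
  define u where "u = (\<lambda>N. (real N ^ 2 / 2 + real N / 2 + 1 / 12) * ln (real N) - real N ^ 2 / 4 + 1 / 12 - xlnx_sum N)"
  define z where "z = Re (deriv zeta (- 1))"
  have lim: "(\<lambda>N. complex_of_real (u N)) \<longlonglongrightarrow> deriv zeta (- 1)"
    unfolding u_def xlnx_sum_def by (rule zeta_minus_one_deriv_limit)
  \<comment> \<open>A limit of real numbers, so zeta'(-1) is real and the rest can be done with real
    exponentials.\<close>
  have "(\<lambda>N. Im (complex_of_real (u N))) \<longlonglongrightarrow> Im (deriv zeta (- 1))" by (intro tendsto_intros lim)
  hence z: "deriv zeta (- 1) = complex_of_real z"
    by (simp add: z_def complex_eq_iff LIMSEQ_const_iff)
  have "(\<lambda>N. Re (complex_of_real (u N))) \<longlonglongrightarrow> Re (deriv zeta (- 1))" by (intro tendsto_intros lim)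
  hence u: "u \<longlonglongrightarrow> z" by (simp add: z_def)
  define r where "r = (\<lambda>n. real n * (stirling_diff n - ln (2 * pi) / 2))"
  have r: "r \<longlonglongrightarrow> 1 / 12" unfolding r_def by (rule stirling_diff_second_order)
  have d: "filterlim (\<lambda>n::nat. 2 * n) sequentially sequentially" by real_asymp
  have "(\<lambda>n. exp (ln 2 / 12 - 1 / 4 + 4 * r n - r (2 * n) + 4 * u n - u (2 * n))) \<longlonglongrightarrow>
     exp (ln 2 / 12 - 1 / 4 + 4 * (1 / 12) - 1 / 12 + 4 * z - z)"
    by (intro tendsto_intros r u filterlim_compose[OF r d] filterlim_compose[OF u d])
  also have "exp (ln 2 / 12 - 1 / 4 + 4 * (1 / 12) - 1 / 12 + 4 * z - z) = 2 powr (1 / 12) * exp (3 * z)"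
    by (simp add: powr_def flip: exp_add)
  finally have main: "(\<lambda>n. exp (ln 2 / 12 - 1 / 4 + 4 * r n - r (2 * n) + 4 * u n - u (2 * n))) \<longlonglongrightarrow> 2 powr (1 / 12) * exp (3 * z)" .
  have "eventually (\<lambda>n. exp (ln 2 / 12 - 1 / 4 + 4 * r n - r (2 * n) + 4 * u n - u (2 * n)) =
      (\<Prod>k<n. legendre_factor k) * real n powr (1 / 4)) sequentially"
    using eventually_gt_at_top[of 0]
  proof eventually_elim
    case (elim n)
    define l where "l = ln (real n)"
    have l2: "ln (2 * real n) = ln 2 + l" using elim by (simp add: ln_mult l_def)
    have lp: "ln (2 * pi) = ln 2 + ln pi" by (simp add: ln_mult)
    have 1: "xlnx_sum N = (real N ^ 2 / 2 + real N / 2 + 1 / 12) * ln (real N) - real N ^ 2 / 4 + 1 / 12 - u N" for N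
      by (simp add: u_def)
    have 2: "real N * ln (fact N) = r N + real N * (ln 2 + ln pi) / 2 + real N * ((real N + 1 / 2) * ln (real N) - real N)" for N
      unfolding r_def stirling_diff_def lp by (simp add: algebra_simps)
    have "ln (\<Prod>k<n. legendre_factor k) + l / 4 = ln 2 / 12 - 1 / 4 + 4 * r n - r (2 * n) + 4 * u n - u (2 * n)"
      unfolding ln_legendre_factor_prod 1 using 2[of n] 2[of "2 * n"]
      by (simp add: l_def[symmetric] l2) (simp add: algebra_simps power2_eq_square add_divide_distrib)
    hence "exp (ln 2 / 12 - 1 / 4 + 4 * r n - r (2 * n) + 4 * u n - u (2 * n)) =
        exp (ln (\<Prod>k<n. legendre_factor k)) * exp (l / 4)"
      by (simp only: exp_add[symmetric])
    also have "exp (ln (\<Prod>k<n. legendre_factor k)) = (\<Prod>k<n. legendre_factor k)"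
      by (intro exp_ln prod_pos) (simp add: legendre_factor_pos)
    also have "exp (l / 4) = real n powr (1 / 4)" using elim by (simp add: powr_def l_def)
    finally show ?case .
  qed
  from iffD1[OF tendsto_cong[OF this] main] show ?thesis by (rule that[OF z])
qed

section \<open>Legendre polynomials on a symmetric interval\<close>

hide_const (open) module.smult

text \<open>Rodrigues' formula on the interval from - g to g; the constant makes the polynomial
  monic.\<close>

definition legendre :: "real \<Rightarrow> nat \<Rightarrow> real poly" where
  "legendre g k = smult (fact k / fact (2 * k)) ((pderiv ^^ k) ([:- (g\<^sup>2), 0, 1:] ^ k))"

definition legendre_norm :: "real \<Rightarrow> nat \<Rightarrow> real" where
  "legendre_norm g k = 2 ^ (2 * k + 1) * fact k ^ 4 / (fact (2 * k) * fact (2 * k + 1)) * g ^ (2 * k + 1)"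

text \<open>Neumann's integral: up to normalisation the Legendre function of the second kind at 1, a
  point outside the interval when g < 1.\<close>

definition legendre_Q :: "real \<Rightarrow> nat \<Rightarrow> real" where
  "legendre_Q g k = integral {- g..g} (\<lambda>x. poly (legendre g k) x / (1 - x))"

lemma poly_reflect_pderiv:
  fixes p :: "real poly"
  assumes "\<And>x. poly p (- x) = c * poly p x"
  shows "poly (pderiv p) (- x) = - c * poly (pderiv p) x"
proof -
  have "p \<circ>\<^sub>p [:0, - 1:] = smult c p"
    by (rule poly_eq_poly_eq_iff[THEN iffD1]) (simp add: fun_eq_iff poly_pcompose assms)
  hence "pderiv (p \<circ>\<^sub>p [:0, - 1:]) = smult c (pderiv p)"
    by (simp add: pderiv_smult)
  hence "poly (pderiv (p \<circ>\<^sub>p [:0, - 1:])) x = c * poly (pderiv p) x"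
    by simp
  thus ?thesis by (simp add: pderiv_pcompose pderiv_pCons poly_pcompose)
qed

lemma poly_legendre_minus: "poly (legendre g k) (- x) = (- 1) ^ k * poly (legendre g k) x"
proof -
  have "poly ((pderiv ^^ j) ([:- (g\<^sup>2), 0, 1:] ^ k)) (- x) = (- 1) ^ j * poly ((pderiv ^^ j) ([:- (g\<^sup>2), 0, 1:] ^ k)) x" for j x
  proof (induction j arbitrary: x)
    case (Suc j)
    from poly_reflect_pderiv[OF this] show ?case by simp
  qed simp
  thus ?thesis by (simp add: legendre_def)
qed

lemma degree_legendre: "degree (legendre g k) \<le> k"
  and coeff_legendre_self: "coeff (legendre g k) k = 1"
proof -
  define R where "R = [:- (g\<^sup>2), 0, 1:] ^ k"
  have R: "degree R = 2 * k" "coeff R (2 * k) = 1"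
  proof -
    show d: "degree R = 2 * k" by (simp add: R_def degree_power_eq)
    have "lead_coeff R = 1" by (simp add: R_def lead_coeff_power)
    thus "coeff R (2 * k) = 1" by (simp add: d)
  qed
  show "degree (legendre g k) \<le> k"
    unfolding legendre_def using R(1) by (simp add: R_def[symmetric] degree_higher_pderiv)
  have "pochhammer (real (Suc k)) k = fact (2 * k) / fact k"
    using pochhammer_fact[of "2 * k", where ?'a = real] pochhammer_product[of k "2 * k" "1 :: real"]
    by (simp add: pochhammer_fact[symmetric] field_simps)
  thus "coeff (legendre g k) k = 1"
    unfolding legendre_def R_def[symmetric] using R(2) by (simp add: coeff_higher_pderiv mult_2)
qed

lemma power_dvd_pderiv:
  fixes q :: "real poly"
  assumes "q ^ Suc m dvd r"
  shows "q ^ m dvd pderiv r"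
proof -
  obtain s where "r = q ^ Suc m * s" using assms by (elim dvdE)
  hence "pderiv r = q ^ Suc m * pderiv s + s * pderiv (q ^ Suc m)"
    by (simp only: pderiv_mult)
  also have "pderiv (q ^ Suc m) = smult (of_nat (Suc m)) (q ^ m) * pderiv q"
    by (rule pderiv_power_Suc)
  also have "q ^ Suc m * pderiv s + s * (smult (of_nat (Suc m)) (q ^ m) * pderiv q) =
      q ^ m * (smult (of_nat (Suc m)) (pderiv q) * s + q * pderiv s)"
    by (simp add: algebra_simps)
  finally have "pderiv r = q ^ m * (smult (of_nat (Suc m)) (pderiv q) * s + q * pderiv s)" .
  thus ?thesis by simp
qed

lemma power_dvd_higher_pderiv:
  fixes q :: "real poly"
  shows "j \<le> k \<Longrightarrow> q ^ (k - j) dvd (pderiv ^^ j) (q ^ k)"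
proof (induction j)
  case (Suc j)
  hence "q ^ Suc (k - Suc j) dvd (pderiv ^^ j) (q ^ k)" by (simp add: Suc_diff_Suc)
  thus ?case using power_dvd_pderiv by simp
qed simp

lemma integral_poly_by_parts:
  fixes p :: "real poly" and f f' :: "real \<Rightarrow> real"
  assumes g: "g \<ge> 0" and "poly p g = 0" "poly p (- g) = 0"
  assumes f: "\<And>x. x \<in> {- g..g} \<Longrightarrow> (f has_real_derivative f' x) (at x within {- g..g})"
  assumes f': "continuous_on {- g..g} f'"
  shows "integral {- g..g} (\<lambda>x. poly (pderiv p) x * f x) = - integral {- g..g} (\<lambda>x. poly p x * f' x)"
proof -
  have fc: "continuous_on {- g..g} f"
    using f DERIV_continuous continuous_on_eq_continuous_within by blast
  have "((\<lambda>x. poly (pderiv p) x * f x + poly p x * f' x) has_integral (poly p g * f g - poly p (- g) * f (- g))) {- g..g}"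
  proof (rule fundamental_theorem_of_calculus)
    fix x assume x: "x \<in> {- g..g}"
    have "((\<lambda>x. poly p x * f x) has_real_derivative poly (pderiv p) x * f x + f' x * poly p x) (at x within {- g..g})"
      by (rule DERIV_mult[OF has_field_derivative_at_within[OF poly_DERIV] f[OF x]])
    thus "((\<lambda>x. poly p x * f x) has_vector_derivative poly (pderiv p) x * f x + poly p x * f' x) (at x within {- g..g})"
      by (simp add: has_real_derivative_iff_has_vector_derivative mult.commute)
  qed (use g in simp)
  hence "integral {- g..g} (\<lambda>x. poly (pderiv p) x * f x + poly p x * f' x) = 0"
    using assms(2,3) by (simp add: integral_unique)
  moreover have "integral {- g..g} (\<lambda>x. poly (pderiv p) x * f x + poly p x * f' x) =
     integral {- g..g} (\<lambda>x. poly (pderiv p) x * f x) + integral {- g..g} (\<lambda>x. poly p x * f' x)"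
    by (intro integral_add integrable_continuous_interval continuous_intros fc f')
  ultimately show ?thesis by simp
qed

text \<open>All boundary terms vanish because the derivatives of order below \<open>k\<close> still
  contain the factor x^2 - g^2; the sign (- 1) ^ k turns x^2 - g^2 into g^2 - x^2. The family
  \<open>G\<close> lists the derivatives of the test function, so that monomials and 1 / (1 - x) are
  covered at once.\<close>

lemma integral_higher_pderiv_power:
  fixes G :: "nat \<Rightarrow> real \<Rightarrow> real"
  assumes g: "g \<ge> 0"
  assumes G: "\<And>i x. i < k \<Longrightarrow> x \<in> {- g..g} \<Longrightarrow> (G i has_real_derivative G (Suc i) x) (at x within {- g..g})"
  assumes Gk: "continuous_on {- g..g} (G k)"
  shows "integral {- g..g} (\<lambda>x. poly ((pderiv ^^ k) ([:- (g\<^sup>2), 0, 1:] ^ k)) x * G 0 x)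
    = integral {- g..g} (\<lambda>x. (g\<^sup>2 - x\<^sup>2) ^ k * G k x)"
proof -
  define Q where "Q = [:- (g\<^sup>2), 0, 1:]"
  have Gc: "continuous_on {- g..g} (G i)" if "i \<le> k" for i
  proof (cases "i = k")
    case False
    thus ?thesis using that G[of i] DERIV_continuous continuous_on_eq_continuous_within by (metis le_neq_implies_less)
  qed (use Gk in simp)
  have "integral {- g..g} (\<lambda>x. poly ((pderiv ^^ k) (Q ^ k)) x * G 0 x) =
     (- 1) ^ j * integral {- g..g} (\<lambda>x. poly ((pderiv ^^ (k - j)) (Q ^ k)) x * G j x)" if "j \<le> k" for j
    using that
  proof (induction j)
    case (Suc j)
    define i where "i = k - Suc j"
    have i: "k - j = Suc i" "i < k" using Suc.prems by (auto simp: i_def)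
    have "Q dvd Q ^ (k - i)" using i by (intro dvd_power) auto
    also have "\<dots> dvd (pderiv ^^ i) (Q ^ k)" using i by (intro power_dvd_higher_pderiv) auto
    finally obtain s where s: "(pderiv ^^ i) (Q ^ k) = Q * s" by (elim dvdE)
    have "poly ((pderiv ^^ i) (Q ^ k)) g = 0" "poly ((pderiv ^^ i) (Q ^ k)) (- g) = 0"
      unfolding s by (simp_all add: Q_def power2_eq_square)
    from integral_poly_by_parts[OF g this, of "G j" "G (Suc j)"] G[of j] Gc[of "Suc j"] Suc.prems
    have "integral {- g..g} (\<lambda>x. poly (pderiv ((pderiv ^^ i) (Q ^ k))) x * G j x) =
       - integral {- g..g} (\<lambda>x. poly ((pderiv ^^ i) (Q ^ k)) x * G (Suc j) x)" by auto
    with Suc.IH Suc.prems show ?case unfolding i(1) i_def[symmetric] by simp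
  qed simp
  from this[of k] have "integral {- g..g} (\<lambda>x. poly ((pderiv ^^ k) (Q ^ k)) x * G 0 x) =
     integral {- g..g} (\<lambda>x. (- 1) ^ k * (poly (Q ^ k) x * G k x))" by simp
  also have "(\<lambda>x. (- 1) ^ k * (poly (Q ^ k) x * G k x)) = (\<lambda>x. (g\<^sup>2 - x\<^sup>2) ^ k * G k x)"
  proof
    fix x
    have "(- 1) ^ k * poly (Q ^ k) x = (- 1 * (x * x - g\<^sup>2)) ^ k"
      unfolding power_mult_distrib by (simp add: Q_def)
    thus "(- 1) ^ k * (poly (Q ^ k) x * G k x) = (g\<^sup>2 - x\<^sup>2) ^ k * G k x"
      by (simp add: power2_eq_square)
  qed
  finally show ?thesis by (simp add: Q_def)
qed

lemma integral_legendre_by_parts: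
  fixes G :: "nat \<Rightarrow> real \<Rightarrow> real"
  assumes g: "g \<ge> 0"
  assumes G: "\<And>i x. i < k \<Longrightarrow> x \<in> {- g..g} \<Longrightarrow> (G i has_real_derivative G (Suc i) x) (at x within {- g..g})"
  assumes Gk: "continuous_on {- g..g} (G k)"
  shows "integral {- g..g} (\<lambda>x. poly (legendre g k) x * G 0 x)
    = fact k / fact (2 * k) * integral {- g..g} (\<lambda>x. (g\<^sup>2 - x\<^sup>2) ^ k * G k x)"
  using integral_higher_pderiv_power[OF assms] by (simp add: legendre_def mult.assoc)

text \<open>The derivative of x (g^2 - x^2) ^ (k + 1) has integral 0 and is a combination of the
  integrands for k and k + 1, which gives a recursion.\<close>

lemma integral_semicircle_power:
  fixes g :: real
  assumes g: "g \<ge> 0"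
  shows "integral {- g..g} (\<lambda>x. (g\<^sup>2 - x\<^sup>2) ^ k) = 2 ^ (2 * k + 1) * fact k ^ 2 / fact (2 * k + 1) * g ^ (2 * k + 1)"
proof (induction k)
  case 0
  show ?case using g by simp
next
  case (Suc k)
  define I where "I = (\<lambda>k. integral {- g..g} (\<lambda>x. (g\<^sup>2 - x\<^sup>2) ^ k))"
  have "((\<lambda>x. (2 * real k + 3) * (g\<^sup>2 - x\<^sup>2) ^ Suc k - (2 * real k + 2) * g\<^sup>2 * (g\<^sup>2 - x\<^sup>2) ^ k) has_integral
      (g * (g\<^sup>2 - g\<^sup>2) ^ Suc k - (- g) * (g\<^sup>2 - (- g)\<^sup>2) ^ Suc k)) {- g..g}"
  proof (rule fundamental_theorem_of_calculus)
    fix x assume "x \<in> {- g..g}"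
    have "((\<lambda>x. x * (g\<^sup>2 - x\<^sup>2) ^ Suc k) has_real_derivative
       (g\<^sup>2 - x\<^sup>2) ^ Suc k + x * (real (Suc k) * (g\<^sup>2 - x\<^sup>2) ^ k * (- 2 * x))) (at x within {- g..g})"
      by (auto intro!: derivative_eq_intros simp del: power_Suc)
    also have "(g\<^sup>2 - x\<^sup>2) ^ Suc k + x * (real (Suc k) * (g\<^sup>2 - x\<^sup>2) ^ k * (- 2 * x)) =
       (2 * real k + 3) * (g\<^sup>2 - x\<^sup>2) ^ Suc k - (2 * real k + 2) * g\<^sup>2 * (g\<^sup>2 - x\<^sup>2) ^ k"
      by (simp add: algebra_simps power2_eq_square)
    finally show "((\<lambda>x. x * (g\<^sup>2 - x\<^sup>2) ^ Suc k) has_vector_derivative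
       (2 * real k + 3) * (g\<^sup>2 - x\<^sup>2) ^ Suc k - (2 * real k + 2) * g\<^sup>2 * (g\<^sup>2 - x\<^sup>2) ^ k) (at x within {- g..g})"
      by (simp add: has_real_derivative_iff_has_vector_derivative)
  qed (use g in simp)
  hence "integral {- g..g} (\<lambda>x. (2 * real k + 3) * (g\<^sup>2 - x\<^sup>2) ^ Suc k - (2 * real k + 2) * g\<^sup>2 * (g\<^sup>2 - x\<^sup>2) ^ k) = 0"
    by (simp add: integral_unique)
  moreover have "integral {- g..g} (\<lambda>x. (2 * real k + 3) * (g\<^sup>2 - x\<^sup>2) ^ Suc k - (2 * real k + 2) * g\<^sup>2 * (g\<^sup>2 - x\<^sup>2) ^ k)
     = (2 * real k + 3) * I (Suc k) - (2 * real k + 2) * g\<^sup>2 * I k"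
    unfolding I_def
    by (subst integral_diff) (auto intro!: integrable_continuous_interval continuous_intros simp del: power_Suc)
  ultimately have "I (Suc k) = (2 * real k + 2) * g\<^sup>2 * I k / (2 * real k + 3)"
    by (simp add: field_simps)
  also have "I k = 2 ^ (2 * k + 1) * fact k ^ 2 / fact (2 * k + 1) * g ^ (2 * k + 1)"
    using Suc.IH by (simp add: I_def)
  also have "(2 * real k + 2) * g\<^sup>2 * (2 ^ (2 * k + 1) * (fact k)\<^sup>2 / fact (2 * k + 1) * g ^ (2 * k + 1)) / (2 * real k + 3) =
     2 ^ (2 * Suc k + 1) * fact (Suc k) ^ 2 / fact (2 * Suc k + 1) * g ^ (2 * Suc k + 1)"
  proof -
    define F where "F = (fact (2 * k + 1) :: real)"
    define x where "x = real k"
    have p: "x \<ge> 0" "F > 0" by (auto simp: x_def F_def)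
    have "fact (2 * Suc k + 1) = (2 * real k + 3) * (2 * real k + 2) * F"
      by (simp add: F_def algebra_simps)
    moreover have "(2 * x + 2) * g\<^sup>2 * (2 ^ (2 * k + 1) * (fact k)\<^sup>2 / F * g ^ (2 * k + 1)) / (2 * x + 3) =
      2 ^ (2 * k + 1) * 4 * ((x + 1) * fact k) ^ 2 / ((2 * x + 3) * (2 * x + 2) * F) * (g ^ (2 * k + 1) * g\<^sup>2)"
    proof -
      have e: "2 * x + 2 = 2 * (x + 1)" by simp
      show ?thesis unfolding e using p by (simp add: divide_simps) (simp add: power2_eq_square algebra_simps)
    qed
    ultimately show ?thesis by (simp add: F_def[symmetric] x_def power2_eq_square mult_ac del: fact_Suc) (simp add: F_def algebra_simps)
  qed
  finally show ?case by (simp only: I_def)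
qed

lemma integral_legendre_monomial:
  assumes g: "g \<ge> 0" and l: "l \<le> k"
  shows "integral {- g..g} (\<lambda>x. poly (legendre g k) x * x ^ l) = (if l = k then legendre_norm g k else 0)"
proof -
  define G where "G = (\<lambda>i x. poly ((pderiv ^^ i) (monom 1 l)) x :: real)"
  have "integral {- g..g} (\<lambda>x. poly (legendre g k) x * G 0 x) =
     fact k / fact (2 * k) * integral {- g..g} (\<lambda>x. (g\<^sup>2 - x\<^sup>2) ^ k * G k x)"
    by (rule integral_legendre_by_parts[OF g])
       (auto simp: G_def intro!: continuous_intros has_field_derivative_at_within[OF poly_DERIV])
  also have "G 0 = (\<lambda>x. x ^ l)" by (simp add: G_def poly_monom fun_eq_iff)
  also have "G k = (\<lambda>x. if l = k then fact k else 0)"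
  proof
    fix x
    have "coeff ((pderiv ^^ k) (monom 1 l)) i = (if l = k \<and> i = 0 then fact k else 0 :: real)" for i
      using l by (auto simp: coeff_higher_pderiv pochhammer_fact)
    hence "(pderiv ^^ k) (monom 1 l) = (if l = k then [:fact k:] else 0 :: real poly)"
      by (intro poly_eqI) (auto simp: coeff_pCons split: nat.splits)
    thus "G k x = (if l = k then fact k else 0)" by (simp add: G_def)
  qed
  finally show ?thesis
    using integral_semicircle_power[OF g, of k]
    by (auto simp: legendre_norm_def power2_eq_square power4_eq_xxxx mult_ac)
qed

text \<open>The i-th derivative of 1 / (1 - x) is i! / (1 - x) ^ (i + 1). The new integrand is
  nonnegative, while that of the definition oscillates; both positivity and the limit for large k
  are read off from this form.\<close>

lemma legendre_Q_eq:
  assumes g: "0 \<le> g" "g < 1"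
  shows "legendre_Q g k = fact k ^ 2 / fact (2 * k) * integral {- g..g} (\<lambda>x. (g\<^sup>2 - x\<^sup>2) ^ k / (1 - x) ^ Suc k)"
proof -
  define G where "G = (\<lambda>i x. fact i / (1 - x) ^ Suc i :: real)"
  have nz: "1 - x \<noteq> 0" if "x \<in> {- g..g}" for x using that g by auto
  have "integral {- g..g} (\<lambda>x. poly (legendre g k) x * G 0 x) =
     fact k / fact (2 * k) * integral {- g..g} (\<lambda>x. (g\<^sup>2 - x\<^sup>2) ^ k * G k x)"
  proof (rule integral_legendre_by_parts[OF g(1)])
    fix i x assume x: "x \<in> {- g..g}"
    define y where "y = 1 - x"
    have y: "y \<noteq> 0" using nz[OF x] by (simp add: y_def)
    have "((\<lambda>x. (1 - x) ^ Suc i) has_real_derivative (1 + real i) * (- 1 * (1 - x) ^ i)) (at x within {- g..g})"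
      by (intro DERIV_power_Suc) (auto intro!: derivative_eq_intros)
    from DERIV_divide[OF DERIV_const[of "fact i"] this]
    have "(G i has_real_derivative (0 * y ^ Suc i - fact i * ((1 + real i) * (- 1 * y ^ i))) / (y ^ Suc i * y ^ Suc i)) (at x within {- g..g})"
      using y unfolding G_def y_def by simp
    also have "(0 * y ^ Suc i - fact i * ((1 + real i) * (- 1 * y ^ i))) / (y ^ Suc i * y ^ Suc i) = G (Suc i) x"
      unfolding G_def y_def[symmetric] using y by (simp add: field_simps)
    finally show "(G i has_real_derivative G (Suc i) x) (at x within {- g..g})" .
  next
    show "continuous_on {- g..g} (G k)"
      unfolding G_def using nz by (intro continuous_intros) auto
  qed
  also have "(\<lambda>x. (g\<^sup>2 - x\<^sup>2) ^ k * G k x) = (\<lambda>x. fact k * ((g\<^sup>2 - x\<^sup>2) ^ k / (1 - x) ^ Suc k))"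
    by (auto simp: G_def)
  also have "integral {- g..g} \<dots> = fact k * integral {- g..g} (\<lambda>x. (g\<^sup>2 - x\<^sup>2) ^ k / (1 - x) ^ Suc k)"
    by (rule integral_mult_right)
  finally have "integral {- g..g} (\<lambda>x. poly (legendre g k) x * G 0 x) =
    fact k ^ 2 / fact (2 * k) * integral {- g..g} (\<lambda>x. (g\<^sup>2 - x\<^sup>2) ^ k / (1 - x) ^ Suc k)"
    by (simp only: power2_eq_square times_divide_eq_left mult.assoc)
  thus ?thesis by (simp add: legendre_Q_def G_def del: power_Suc)
qed

lemma legendre_Q_pos:
  assumes g: "0 < g" "g < 1"
  shows "legendre_Q g k > 0"
proof -
  have nz: "1 - x > 0" if "x \<in> {- g..g}" for x using that g by auto
  have nz': "(1 - x) ^ Suc k \<noteq> 0" if "x \<in> {- g..g}" for x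
    using zero_less_power[OF nz[OF that], of "Suc k"] by linarith
  have c: "continuous_on {- g..g} (\<lambda>x. (g\<^sup>2 - x\<^sup>2) ^ k / (1 - x) ^ Suc k)"
    using nz' by (intro continuous_intros) blast
  have nn: "(g\<^sup>2 - x\<^sup>2) ^ k / (1 - x) ^ Suc k \<ge> 0" if "x \<in> {- g..g}" for x
  proof -
    have "x\<^sup>2 \<le> g\<^sup>2" using that by (intro abs_le_square_iff[THEN iffD1]) auto
    thus ?thesis using nz[OF that] by (intro divide_nonneg_pos zero_le_power zero_less_power) auto
  qed
  have "integral {- g..g} (\<lambda>x. (g\<^sup>2 - x\<^sup>2) ^ k / (1 - x) ^ Suc k) \<noteq> 0"
  proof
    assume "integral {- g..g} (\<lambda>x. (g\<^sup>2 - x\<^sup>2) ^ k / (1 - x) ^ Suc k) = 0"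
    hence "\<forall>x\<in>{- g..g}. (g\<^sup>2 - x\<^sup>2) ^ k / (1 - x) ^ Suc k = 0"
      using integral_eq_0_iff[OF c _ nn] g by simp
    from bspec[OF this, of 0] show False using g by simp
  qed
  moreover have "integral {- g..g} (\<lambda>x. (g\<^sup>2 - x\<^sup>2) ^ k / (1 - x) ^ Suc k) \<ge> 0"
    by (rule integral_nonneg[OF integrable_continuous_interval[OF c] nn])
  ultimately show ?thesis using g by (simp add: legendre_Q_eq del: power_Suc)
qed

lemma higher_pderiv_linear_power:
  "j \<le> m \<Longrightarrow> (pderiv ^^ j) ([:a, 1:] ^ m) = smult (fact m / fact (m - j)) ([:a, 1:] ^ (m - j) :: real poly)"
proof (induction j)
  case (Suc j)
  then obtain i where i: "m - j = Suc i" "m - Suc j = i" by (cases "m - j") auto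
  have "(pderiv ^^ Suc j) ([:a, 1:] ^ m) = pderiv (smult (fact m / fact (Suc i)) ([:a, 1:] ^ Suc i))"
    using Suc i by simp
  also have "\<dots> = smult (fact m / fact (Suc i) * real (Suc i)) ([:a, 1:] ^ i)"
    by (simp add: pderiv_smult pderiv_power_Suc pderiv_pCons del: power_Suc)
  also have "fact m / fact (Suc i) * real (Suc i) = fact m / fact i"
    unfolding fact_Suc by (simp del: of_nat_Suc)
  finally show ?case unfolding i .
qed simp

text \<open>Expansion in powers of x - g, using x^2 - g^2 = (x - g) ((x - g) + 2 g). For 0 < g < 1
  all terms are positive.\<close>

lemma poly_legendre_1:
  "poly (legendre g n) 1 = fact n / fact (2 * n) *
     (\<Sum>k\<le>n. real (n choose k) * (2 * g) ^ (n - k) * (fact (n + k) / fact k) * (1 - g) ^ k)"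
proof -
  have "[:- (g\<^sup>2), 0, 1:] = [:- g, 1:] * ([:- g, 1:] + [:2 * g:])"
    by (simp add: power2_eq_square)
  hence "[:- (g\<^sup>2), 0, 1:] ^ n = [:- g, 1:] ^ n * ([:- g, 1:] + [:2 * g:]) ^ n"
    by (simp only: power_mult_distrib)
  also have "\<dots> = (\<Sum>k\<le>n. smult (real (n choose k) * (2 * g) ^ (n - k)) ([:- g, 1:] ^ (n + k)))"
    unfolding binomial_ring sum_distrib_left
    by (intro sum.cong refl) (simp add: power_add poly_const_pow mult_ac of_nat_poly)
  finally have "(pderiv ^^ n) ([:- (g\<^sup>2), 0, 1:] ^ n) =
     (\<Sum>k\<le>n. smult (real (n choose k) * (2 * g) ^ (n - k)) ((pderiv ^^ n) ([:- g, 1:] ^ (n + k))))"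
    by (simp only: higher_pderiv_sum higher_pderiv_smult)
  also have "poly \<dots> 1 = (\<Sum>k\<le>n. real (n choose k) * (2 * g) ^ (n - k) * (fact (n + k) / fact k) * (1 - g) ^ k)"
    by (simp add: poly_sum higher_pderiv_linear_power mult.assoc)
  finally show ?thesis by (simp add: legendre_def)
qed

lemma poly_legendre_1_pos:
  assumes g: "0 < g" "g < 1"
  shows "poly (legendre g n) 1 > 0"
  unfolding poly_legendre_1 using g by (intro mult_pos_pos sum_pos) auto

section \<open>Orthogonal polynomials for the weights 1 - x^2 and 1 / (1 - x^2)\<close>

definition monic_parity :: "nat \<Rightarrow> real poly \<Rightarrow> bool" where
  "monic_parity k r \<longleftrightarrow> degree r \<le> k \<and> coeff r k = 1 \<and> (\<forall>x. poly r (- x) = (- 1) ^ k * poly r x)"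

text \<open>The polynomial is hidden behind the quantifier because the determinant depends only on
  the norm. Only monomials of the parity of \<open>k\<close> are tested: for an even weight the
  remaining integrands are odd.\<close>

definition orthogonal_norm :: "real \<Rightarrow> (real \<Rightarrow> real) \<Rightarrow> nat \<Rightarrow> real \<Rightarrow> bool" where
  "orthogonal_norm g w k N \<longleftrightarrow> (\<exists>r. monic_parity k r \<and>
     (\<forall>l\<le>k. even (k + l) \<longrightarrow> integral {- g..g} (\<lambda>x. poly r x * x ^ l * w x) = (if l = k then N else 0)))"

lemma monic_parity_legendre: "monic_parity k (legendre g k)"
  by (simp add: monic_parity_def degree_legendre coeff_legendre_self poly_legendre_minus)

lemma orthogonal_norm_legendre:
  "g \<ge> 0 \<Longrightarrow> orthogonal_norm g (\<lambda>_. 1) k (legendre_norm g k)"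
  unfolding orthogonal_norm_def
  by (rule exI[of _ "legendre g k"]) (auto simp: monic_parity_legendre integral_legendre_monomial)

lemma poly_legendre_integrable: "(\<lambda>x. poly (legendre g k) x * x ^ l) integrable_on {- g..g}"
  by (intro integrable_continuous_interval continuous_intros)

text \<open>The combination D of the Legendre polynomials of degrees k + 2 and k that vanishes at 1
  vanishes by parity at - 1 too, so r = D / (x^2 - 1) is a monic polynomial of degree k. Since r (1
  - x^2) = - D, orthogonality is inherited and the norm picks up the coefficient \<rho>.\<close>

lemma orthogonal_norm_christoffel:
  assumes g: "0 < g" "g < 1"
  shows "orthogonal_norm g (\<lambda>x. 1 - x\<^sup>2) k
    (legendre_norm g k * (poly (legendre g (k + 2)) 1 / poly (legendre g k) 1))"
proof -
  define \<rho> where "\<rho> = poly (legendre g (k + 2)) 1 / poly (legendre g k) 1"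
  define D where "D = legendre g (k + 2) - smult \<rho> (legendre g k)"
  have D1: "poly D 1 = 0"
    using poly_legendre_1_pos[OF g, of k] by (simp add: D_def \<rho>_def)
  have Dm: "poly D (- x) = (- 1) ^ k * poly D x" for x
    by (simp add: D_def poly_legendre_minus algebra_simps)
  have dD: "degree D \<le> k + 2"
    unfolding D_def
    by (intro degree_diff_le degree_legendre order_trans[OF degree_smult_le] order_trans[OF degree_legendre]) auto
  have cD: "coeff D (k + 2) = 1"
    using coeff_legendre_self[of g "k + 2"] le_less_trans[OF degree_legendre[of g k], of "k + 2"]
    by (simp add: D_def coeff_eq_0)
  obtain E where E: "D = [:- 1, 1:] * E"
    using D1 poly_eq_0_iff_dvd by blast
  have "poly D (- 1) = 0" using Dm[of 1] D1 by simp
  hence "poly E (- 1) = 0" by (simp add: E)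
  then obtain r where r: "E = [:1, 1:] * r"
    using poly_eq_0_iff_dvd[of E "- 1"] by auto
  have Dr: "D = [:- 1, 0, 1:] * r" by (simp add: E r algebra_simps)
  have "r \<noteq> 0" using cD by (auto simp: Dr)
  hence "degree D = 2 + degree r" unfolding Dr by (subst degree_mult_eq) auto
  hence dr: "degree r \<le> k" using dD by simp
  have "coeff D (k + 2) = coeff r k - coeff r (k + 2)"
    by (simp add: Dr)
  hence cr: "coeff r k = 1" using cD dr by (simp add: coeff_eq_0)
  \<comment> \<open>Parity is derived from an identity of polynomials, in which x^2 - 1 can be
    cancelled; a pointwise division would break down at 1 and - 1.\<close>
  have "[:- 1, 0, 1:] * (r \<circ>\<^sub>p [:0, - 1:]) = [:- 1, 0, 1:] * smult ((- 1) ^ k) r"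
  proof (rule poly_eq_poly_eq_iff[THEN iffD1], rule ext)
    fix x
    show "poly ([:- 1, 0, 1:] * (r \<circ>\<^sub>p [:0, - 1:])) x = poly ([:- 1, 0, 1:] * smult ((- 1) ^ k) r) x"
      using Dm[of x] by (simp add: Dr poly_pcompose algebra_simps)
  qed
  hence "r \<circ>\<^sub>p [:0, - 1:] = smult ((- 1) ^ k) r"
    by (metis mult_cancel_left pCons_eq_0_iff one_neq_zero)
  hence "poly (r \<circ>\<^sub>p [:0, - 1:]) x = (- 1) ^ k * poly r x" for x by simp
  hence "monic_parity k r" using dr cr by (simp add: monic_parity_def poly_pcompose)
  moreover have "integral {- g..g} (\<lambda>x. poly r x * x ^ l * (1 - x\<^sup>2)) = (if l = k then legendre_norm g k * \<rho> else 0)"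
    if l: "l \<le> k" for l
  proof -
    have "(\<lambda>x. poly r x * x ^ l * (1 - x\<^sup>2)) =
      (\<lambda>x. \<rho> * (poly (legendre g k) x * x ^ l) - poly (legendre g (k + 2)) x * x ^ l)"
    proof
      fix x
      have "poly r x * (1 - x\<^sup>2) = - poly D x" by (simp add: Dr power2_eq_square algebra_simps)
      also have "\<dots> = \<rho> * poly (legendre g k) x - poly (legendre g (k + 2)) x"
        by (simp add: D_def)
      finally show "poly r x * x ^ l * (1 - x\<^sup>2) =
         \<rho> * (poly (legendre g k) x * x ^ l) - poly (legendre g (k + 2)) x * x ^ l"
        by (metis (no_types, opaque_lifting) left_diff_distrib mult.assoc mult.commute)
    qed
    hence "integral {- g..g} (\<lambda>x. poly r x * x ^ l * (1 - x\<^sup>2)) =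
       \<rho> * integral {- g..g} (\<lambda>x. poly (legendre g k) x * x ^ l) - integral {- g..g} (\<lambda>x. poly (legendre g (k + 2)) x * x ^ l)"
      by (simp only: integral_diff[OF integrable_on_mult_right[OF poly_legendre_integrable] poly_legendre_integrable] integral_mult_right)
    also have "\<dots> = (if l = k then legendre_norm g k * \<rho> else 0)"
      using l g by (simp add: integral_legendre_monomial)
    finally show ?thesis .
  qed
  ultimately show ?thesis unfolding orthogonal_norm_def \<rho>_def by blast
qed

lemma integral_odd:
  fixes f :: "real \<Rightarrow> real"
  assumes "\<And>x. f (- x) = - f x"
  shows "integral {- g..g} f = 0"
proof -
  have "integral {- g..g} f = integral {- g..g} (\<lambda>x. f (- x))"
    using Henstock_Kurzweil_Integration.integral_reflect_real[of g "- g" f] by simp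
  also have "\<dots> = - integral {- g..g} f" by (simp add: assms)
  finally show ?thesis by simp
qed

text \<open>The counterpart of Christoffel's formula for division of the weight by \<open>1 - x\<^sup>2\<close>: the monic
  orthogonal polynomial is the combination of \<open>legendre g k\<close> and \<open>legendre g (k - 2)\<close> whose
  function of the second kind vanishes at 1.\<close>

definition uvarov_norm :: "real \<Rightarrow> nat \<Rightarrow> real" where
  "uvarov_norm g k = (if k < 2 then legendre_Q g k
     else legendre_norm g (k - 2) * (legendre_Q g k / legendre_Q g (k - 2)))"

text \<open>Since 1 / (1 - x) = (1 + x) / (1 - x^2), two integrals arise, and the one with odd
  integrand vanishes. A function of the second kind at 1 is thus a moment for the weight 1 / (1 -
  x^2), with the lowest exponent of the right parity.\<close>

lemma integral_parity_over_one_minus_square: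
  fixes p :: "real poly"
  assumes g: "0 < g" "g < 1" and p: "\<And>x. poly p (- x) = (- 1) ^ k * poly p x"
  shows "integral {- g..g} (\<lambda>x. poly p x * x ^ (k mod 2) * (1 / (1 - x\<^sup>2))) = integral {- g..g} (\<lambda>x. poly p x / (1 - x))"
proof -
  have nz: "1 - x \<noteq> 0" "1 - x\<^sup>2 \<noteq> 0" "1 + x \<noteq> 0" if "x \<in> {- g..g}" for x
  proof -
    have "x < 1" "- 1 < x" using that g by auto
    thus "1 - x \<noteq> 0" "1 + x \<noteq> 0" by simp_all
    thus "1 - x\<^sup>2 \<noteq> 0" by (auto simp: power2_eq_1_iff)
  qed
  have int: "(\<lambda>x. poly p x * x ^ l * (1 / (1 - x\<^sup>2))) integrable_on {- g..g}" for l
    using nz by (intro integrable_continuous_interval continuous_intros) auto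
  define l where "l = 1 - k mod 2"
  have "integral {- g..g} (\<lambda>x. poly p x / (1 - x)) =
    integral {- g..g} (\<lambda>x. poly p x * x ^ (k mod 2) * (1 / (1 - x\<^sup>2)) + poly p x * x ^ l * (1 / (1 - x\<^sup>2)))"
  proof (rule integral_cong)
    fix x assume x: "x \<in> {- g..g}"
    have "x ^ (k mod 2) + x ^ l = 1 + x"
      by (cases "even k") (auto simp: l_def mod_2_eq_odd)
    moreover have "poly p x / (1 - x) = poly p x * (1 + x) * (1 / (1 - x\<^sup>2))"
    proof -
      have "1 - x\<^sup>2 = (1 - x) * (1 + x)" by (simp add: power2_eq_square algebra_simps)
      thus ?thesis using nz[OF x] by simp
    qed
    ultimately have "poly p x / (1 - x) = poly p x * (x ^ (k mod 2) + x ^ l) * (1 / (1 - x\<^sup>2))"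
      by (simp only:)
    thus "poly p x / (1 - x) = poly p x * x ^ (k mod 2) * (1 / (1 - x\<^sup>2)) + poly p x * x ^ l * (1 / (1 - x\<^sup>2))"
      by (simp only: distrib_left distrib_right)
  qed
  also have "\<dots> = integral {- g..g} (\<lambda>x. poly p x * x ^ (k mod 2) * (1 / (1 - x\<^sup>2)))
      + integral {- g..g} (\<lambda>x. poly p x * x ^ l * (1 / (1 - x\<^sup>2)))"
    by (rule integral_add[OF int int])
  also have "integral {- g..g} (\<lambda>x. poly p x * x ^ l * (1 / (1 - x\<^sup>2))) = 0"
  proof (rule integral_odd)
    fix x :: real
    have "(- 1) ^ k * (- 1) ^ l = (- 1 :: real)"
      by (cases "even k") (auto simp: l_def mod_2_eq_odd)
    thus "poly p (- x) * (- x) ^ l * (1 / (1 - (- x)\<^sup>2)) = - (poly p x * x ^ l * (1 / (1 - x\<^sup>2)))"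
      unfolding p power_minus[of x] by (simp add: algebra_simps)
  qed
  finally show ?thesis by simp
qed

text \<open>Since x^2 / (1 - x^2) = 1 / (1 - x^2) - 1, passing from exponent l to l + 2 changes the
  weighted moment by the unweighted moment of exponent l. The weighted moments start at 0 by the
  choice of \<rho>, and the first nonzero unweighted one, at l = k - 2, produces the norm at
  exponent k.\<close>

lemma orthogonal_norm_uvarov:
  assumes g: "0 < g" "g < 1"
  shows "orthogonal_norm g (\<lambda>x. 1 / (1 - x\<^sup>2)) k (uvarov_norm g k)"
proof (cases "k < 2")
  case True
  define r where "r = legendre g k"
  have "integral {- g..g} (\<lambda>x. poly r x * x ^ l * (1 / (1 - x\<^sup>2))) = (if l = k then legendre_Q g k else 0)"
    if "l \<le> k" "even (k + l)" for l
  proof -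
    have "l = k" using that True by presburger
    moreover have "k mod 2 = k" using True by simp
    ultimately show ?thesis
      using integral_parity_over_one_minus_square[OF g, of r k] by (simp add: r_def poly_legendre_minus legendre_Q_def)
  qed
  thus ?thesis unfolding orthogonal_norm_def
    using True monic_parity_legendre by (intro exI[of _ r]) (auto simp: uvarov_norm_def r_def)
next
  case False
  define m where "m = k - 2"
  have k: "k = m + 2" using False by (simp add: m_def)
  define \<rho> where "\<rho> = legendre_Q g k / legendre_Q g m"
  define r where "r = legendre g k - smult \<rho> (legendre g m)"
  define J where "J = (\<lambda>l. integral {- g..g} (\<lambda>x. poly r x * x ^ l * (1 / (1 - x\<^sup>2))))"
  have par: "poly r (- x) = (- 1) ^ k * poly r x" for x
    by (simp add: r_def poly_legendre_minus k algebra_simps)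
  have nz1: "1 - x \<noteq> 0" if "x \<in> {- g..g}" for x using that g by auto
  have nz: "1 - x\<^sup>2 \<noteq> 0" if "x \<in> {- g..g}" for x using that g by (auto simp: power2_eq_1_iff)
  have int: "(\<lambda>x. poly r x * x ^ l * (1 / (1 - x\<^sup>2))) integrable_on {- g..g}" for l
    using nz by (intro integrable_continuous_interval continuous_intros) auto
  have int': "(\<lambda>x. poly r x * x ^ l) integrable_on {- g..g}" for l
    by (intro integrable_continuous_interval continuous_intros)
  have intq: "(\<lambda>x. poly (legendre g j) x / (1 - x)) integrable_on {- g..g}" for j
    using nz1 by (intro integrable_continuous_interval continuous_intros) auto
  have m: "monic_parity k r"
    unfolding monic_parity_def
  proof (intro conjI allI par)
    show "degree r \<le> k"
      unfolding r_def
      by (intro degree_diff_le degree_legendre order_trans[OF degree_smult_le] order_trans[OF degree_legendre]) (auto simp: k)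
    show "coeff r k = 1"
      using coeff_legendre_self[of g k] le_less_trans[OF degree_legendre[of g m], of k]
      by (simp add: r_def coeff_eq_0 k)
  qed
  have "J (k mod 2) = integral {- g..g} (\<lambda>x. poly (legendre g k) x / (1 - x) - \<rho> * (poly (legendre g m) x / (1 - x)))"
    unfolding J_def integral_parity_over_one_minus_square[OF g par] by (simp add: r_def diff_divide_distrib)
  also have "\<dots> = legendre_Q g k - \<rho> * legendre_Q g m"
    unfolding legendre_Q_def
    by (simp only: integral_diff[OF intq integrable_on_mult_right[OF intq]] integral_mult_right)
  also have "\<dots> = 0" using legendre_Q_pos[OF g, of m] by (simp add: \<rho>_def)
  finally have J0: "J (k mod 2) = 0" .
  have low: "integral {- g..g} (\<lambda>x. poly r x * x ^ l) = (if l = m then - \<rho> * legendre_norm g m else 0)"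
    if "l \<le> m" for l
  proof -
    have "integral {- g..g} (\<lambda>x. poly r x * x ^ l) =
      integral {- g..g} (\<lambda>x. poly (legendre g k) x * x ^ l - \<rho> * (poly (legendre g m) x * x ^ l))"
      by (simp add: r_def algebra_simps)
    also have "\<dots> = integral {- g..g} (\<lambda>x. poly (legendre g k) x * x ^ l) - \<rho> * integral {- g..g} (\<lambda>x. poly (legendre g m) x * x ^ l)"
      by (subst integral_diff) (auto intro!: poly_legendre_integrable integrable_on_mult_right)
    also have "\<dots> = (if l = m then - \<rho> * legendre_norm g m else 0)"
      using that g by (simp add: integral_legendre_monomial k)
    finally show ?thesis .
  qed
  have step: "J (l + 2) = J l - integral {- g..g} (\<lambda>x. poly r x * x ^ l)" for l
  proof -
    have "J (l + 2) = integral {- g..g} (\<lambda>x. poly r x * x ^ l * (1 / (1 - x\<^sup>2)) - poly r x * x ^ l)"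
      unfolding J_def
    proof (rule integral_cong)
      fix x assume "x \<in> {- g..g}"
      from nz[OF this] show "poly r x * x ^ (l + 2) * (1 / (1 - x\<^sup>2)) = poly r x * x ^ l * (1 / (1 - x\<^sup>2)) - poly r x * x ^ l"
        by (simp add: field_simps power2_eq_square)
    qed
    also have "\<dots> = J l - integral {- g..g} (\<lambda>x. poly r x * x ^ l)"
      unfolding J_def by (rule integral_diff[OF int int'])
    finally show ?thesis .
  qed
  have JJ: "J (k mod 2 + 2 * j) = (if k mod 2 + 2 * j = k then \<rho> * legendre_norm g m else 0)" if "k mod 2 + 2 * j \<le> k" for j
    using that
  proof (induction j)
    case 0
    have "k mod 2 \<noteq> k" using False by auto
    thus ?case using J0 by simp
  next
    case (Suc j)
    define l where "l = k mod 2 + 2 * j"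
    have "J (k mod 2 + 2 * Suc j) = J l - integral {- g..g} (\<lambda>x. poly r x * x ^ l)"
      using step[of l] by (simp add: l_def)
    also have "J l = 0" using Suc by (simp add: l_def)
    finally show ?case using low[of l] Suc.prems by (auto simp: l_def k)
  qed
  have "J l = (if l = k then legendre_norm g m * \<rho> else 0)" if "l \<le> k" "even (k + l)" for l
  proof -
    have "l mod 2 = k mod 2" using that by presburger
    hence "l = k mod 2 + 2 * (l div 2)" by presburger
    thus ?thesis using JJ[of "l div 2"] that by (simp add: mult.commute)
  qed
  thus ?thesis unfolding orthogonal_norm_def uvarov_norm_def
    using m False by (intro exI[of _ r]) (auto simp: J_def \<rho>_def m_def)
qed

section \<open>Toeplitz determinants of symmetric weights as products of norms\<close>

lemma coeff_eq_0_of_parity: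
  fixes p :: "real poly"
  assumes "\<And>x. poly p (- x) = (- 1) ^ k * poly p x" "odd (k + a)"
  shows "coeff p a = 0"
proof -
  have "p \<circ>\<^sub>p [:0, - 1:] = smult ((- 1) ^ k) p"
    by (rule poly_eq_poly_eq_iff[THEN iffD1]) (simp add: fun_eq_iff poly_pcompose assms)
  hence "coeff (p \<circ>\<^sub>p [:0, - 1:]) a = (- 1) ^ k * coeff p a" by simp
  hence "(- 1) ^ a * coeff p a = (- 1) ^ k * coeff p a" by (simp add: coeff_pcompose_linear)
  thus ?thesis using assms(2) by (cases "even a"; cases "even k") auto
qed

lemma prod_list_diag_mat:
  "A \<in> carrier_mat n n \<Longrightarrow> prod_list (diag_mat A) = (\<Prod>k<n. A $$ (k, k))"
  using prod.distinct_set_conv_list[of "[0..<n]" "\<lambda>k. A $$ (k, k)"]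
  by (simp add: diag_mat_def atLeast0LessThan)

text \<open>Multiplication from one side suffices: with the unit lower triangular matrix
  \<open>U\<close> of the coefficients, U * A is upper triangular and has the norms on its
  diagonal.\<close>

lemma det_parity_gram:
  fixes G :: "nat \<Rightarrow> nat \<Rightarrow> real"
  assumes par: "\<And>a b. a < n \<Longrightarrow> b < n \<Longrightarrow> odd (a + b) \<Longrightarrow> G a b = 0"
  assumes r: "\<And>k. k < n \<Longrightarrow> monic_parity k (r k)"
  assumes orth: "\<And>k l. k < n \<Longrightarrow> l \<le> k \<Longrightarrow> even (k + l) \<Longrightarrow>
      (\<Sum>a\<le>k. coeff (r k) a * G a l) = (if l = k then N k else 0)"
  shows "Determinant.det (Matrix.mat n n (\<lambda>(a, b). G a b)) = (\<Prod>k<n. N k)"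
proof -
  define U where "U = Matrix.mat n n (\<lambda>(k, a). coeff (r k) a)"
  define A where "A = Matrix.mat n n (\<lambda>(a, b). G a b)"
  have U: "U \<in> carrier_mat n n" and A: "A \<in> carrier_mat n n" by (auto simp: U_def A_def)
  have rd: "degree (r k) \<le> k" "coeff (r k) k = 1" if "k < n" for k
    using r[OF that] by (auto simp: monic_parity_def)
  have rp: "coeff (r k) a = 0" if "k < n" "odd (k + a)" for k a
    using coeff_eq_0_of_parity[of "r k" k a] r[OF that(1)] that(2) by (auto simp: monic_parity_def)
  have rz: "coeff (r k) a = 0" if "k < n" "k < a" for k a
    using rd(1)[OF that(1)] that(2) by (intro coeff_eq_0) simp
  have UA: "(U * A) $$ (k, l) = (\<Sum>a\<le>k. coeff (r k) a * G a l)" if "k < n" "l < n" for k l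
  proof -
    have "(U * A) $$ (k, l) = (\<Sum>a<n. coeff (r k) a * G a l)"
      using that by (simp add: U_def A_def scalar_prod_def atLeast0LessThan)
    also have "\<dots> = (\<Sum>a\<le>k. coeff (r k) a * G a l)"
      using that rz by (intro sum.mono_neutral_right) auto
    finally show ?thesis .
  qed
  have UA': "(U * A) $$ (k, l) = (if l = k then N k else 0)" if kl: "k < n" "l \<le> k" for k l
  proof (cases "even (k + l)")
    case True
    thus ?thesis using UA[of k l] orth[of k l] kl by simp
  next
    case False
    have "(\<Sum>a\<le>k. coeff (r k) a * G a l) = 0"
    proof (intro sum.neutral ballI)
      fix a assume a: "a \<in> {..k}"
      show "coeff (r k) a * G a l = 0"
      proof (cases "even (k + a)")
        case True
        hence "odd (a + l)" using False by auto
        thus ?thesis using par[of a l] a kl by simp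
      qed (use rp kl in auto)
    qed
    moreover have "l \<noteq> k" using False by auto
    ultimately show ?thesis using UA[of k l] kl by simp
  qed
  have "Determinant.det (U * A) = prod_list (diag_mat (U * A))"
  proof (rule det_upper_triangular)
    show "upper_triangular (U * A)"
      using UA' U A by (intro upper_triangularI) auto
    show "U * A \<in> carrier_mat n n" using U A by simp
  qed
  also have "\<dots> = (\<Prod>k<n. (U * A) $$ (k, k))"
    using U A by (intro prod_list_diag_mat) simp
  also have "\<dots> = (\<Prod>k<n. N k)" using UA' by (intro prod.cong) auto
  finally have 1: "Determinant.det (U * A) = (\<Prod>k<n. N k)" .
  have "Determinant.det U = prod_list (diag_mat U)"
    using rz U by (intro det_lower_triangular[OF _ U]) (auto simp: U_def)
  also have "\<dots> = (\<Prod>k<n. U $$ (k, k))" using U by (rule prod_list_diag_mat)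
  also have "\<dots> = 1" using rd by (intro prod.neutral) (auto simp: U_def)
  finally have "Determinant.det U = 1" .
  with 1 show ?thesis using det_mult[OF U A] by (simp add: A_def)
qed

section \<open>The trigonometric change of basis\<close>

text \<open>Under t -> t + pi every exponential of frequency 2 j - (n - 1) is multiplied by (- 1) ^
  (n - 1). The exponent of the sine gives each basis function the same behaviour, and there is
  exactly one of them for each a < n.\<close>

definition half_angle_basis :: "nat \<Rightarrow> nat \<Rightarrow> real \<Rightarrow> real" where
  "half_angle_basis n a t = cos t ^ a * sin t ^ (if even (a + n) then 1 else 0)"

definition half_angle_span :: "nat \<Rightarrow> (real \<Rightarrow> complex) set" where
  "half_angle_span n = {h. \<exists>A. \<forall>t. h t = (\<Sum>a<n. A a * of_real (half_angle_basis n a t))}"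

lemma half_angle_span_add:
  assumes "h1 \<in> half_angle_span n" "h2 \<in> half_angle_span n"
  shows "(\<lambda>t. h1 t + h2 t) \<in> half_angle_span n"
proof -
  obtain A B where "\<And>t. h1 t = (\<Sum>a<n. A a * of_real (half_angle_basis n a t))"
    "\<And>t. h2 t = (\<Sum>a<n. B a * of_real (half_angle_basis n a t))"
    using assms unfolding half_angle_span_def by blast
  thus ?thesis unfolding half_angle_span_def
    by (intro CollectI exI[of _ "\<lambda>a. A a + B a"]) (simp add: sum.distrib distrib_right)
qed

lemma half_angle_span_scale:
  assumes "h \<in> half_angle_span n"
  shows "(\<lambda>t. c * h t) \<in> half_angle_span n"
proof -
  obtain A where "\<And>t. h t = (\<Sum>a<n. A a * of_real (half_angle_basis n a t))"
    using assms unfolding half_angle_span_def by blast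
  thus ?thesis unfolding half_angle_span_def
    by (intro CollectI exI[of _ "\<lambda>a. c * A a"]) (simp add: sum_distrib_left mult.assoc)
qed

lemma half_angle_span_sum:
  assumes "\<And>i. i \<in> I \<Longrightarrow> h i \<in> half_angle_span n" "finite I"
  shows "(\<lambda>t. \<Sum>i\<in>I. h i t) \<in> half_angle_span n"
  using assms(2,1)
proof (induction I)
  case empty
  show ?case unfolding half_angle_span_def by (intro CollectI exI[of _ "\<lambda>_. 0"]) simp
next
  case (insert i I)
  thus ?case using half_angle_span_add[of "h i" n "\<lambda>t. \<Sum>i\<in>I. h i t"] by simp
qed

lemma half_angle_span_basis:
  assumes "a < n"
  shows "(\<lambda>t. of_real (half_angle_basis n a t)) \<in> half_angle_span n"
  unfolding half_angle_span_def
proof (intro CollectI exI[of _ "\<lambda>b. if b = a then 1 else 0"] allI)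
  fix t
  have "(\<Sum>b<n. (if b = a then 1 else 0) * complex_of_real (half_angle_basis n b t)) =
    (\<Sum>b<n. if b = a then complex_of_real (half_angle_basis n b t) else 0)"
    by (intro sum.cong) auto
  thus "complex_of_real (half_angle_basis n a t) = (\<Sum>b<n. (if b = a then 1 else 0) * complex_of_real (half_angle_basis n b t))"
    using assms by simp
qed

lemma half_angle_span_mult:
  assumes f: "\<And>a. a < n \<Longrightarrow> (\<lambda>t. f t * of_real (half_angle_basis n a t)) \<in> half_angle_span m"
    and h: "h \<in> half_angle_span n"
  shows "(\<lambda>t. f t * h t) \<in> half_angle_span m"
proof -
  obtain A where A: "\<And>t. h t = (\<Sum>a<n. A a * of_real (half_angle_basis n a t))"
    using h unfolding half_angle_span_def by blast
  have "(\<lambda>t. \<Sum>a<n. A a * (f t * of_real (half_angle_basis n a t))) \<in> half_angle_span m"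
    by (intro half_angle_span_sum half_angle_span_scale f) auto
  thus ?thesis by (simp add: A sum_distrib_left mult_ac)
qed

lemma half_angle_span_cos:
  assumes "h \<in> half_angle_span n"
  shows "(\<lambda>t. of_real (cos t) * h t) \<in> half_angle_span (Suc n)"
proof (rule half_angle_span_mult[OF _ assms])
  fix a assume "a < n"
  have "complex_of_real (cos t) * of_real (half_angle_basis n a t) = of_real (half_angle_basis (Suc n) (Suc a) t)" for t
    by (simp add: half_angle_basis_def)
  thus "(\<lambda>t. complex_of_real (cos t) * of_real (half_angle_basis n a t)) \<in> half_angle_span (Suc n)"
    using half_angle_span_basis[of "Suc a" "Suc n"] \<open>a < n\<close> by simp
qed

text \<open>If a sine factor is already present, sin^2 = 1 - cos^2 leads back to the basis, at the
  price of the exponent a + 2.\<close>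

lemma half_angle_span_sin:
  assumes "h \<in> half_angle_span n"
  shows "(\<lambda>t. of_real (sin t) * h t) \<in> half_angle_span (Suc n)"
proof (rule half_angle_span_mult[OF _ assms])
  fix a assume a: "a < n"
  show "(\<lambda>t. complex_of_real (sin t) * of_real (half_angle_basis n a t)) \<in> half_angle_span (Suc n)"
  proof (cases "even (a + n)")
    case False
    hence "complex_of_real (sin t) * of_real (half_angle_basis n a t) = of_real (half_angle_basis (Suc n) a t)" for t
      by (simp add: half_angle_basis_def)
    thus ?thesis using half_angle_span_basis[of a "Suc n"] a by simp
  next
    case True
    \<comment> \<open>As a and n have the same parity, a < n forces a + 2 \<le> n.\<close>
    hence a2: "a + 2 < Suc n" using a by presburger
    have "complex_of_real (sin t) * of_real (half_angle_basis n a t) =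
      of_real (half_angle_basis (Suc n) a t) + (- 1) * of_real (half_angle_basis (Suc n) (a + 2) t)" for t
    proof -
      have "sin t * half_angle_basis n a t = cos t ^ a * (sin t)\<^sup>2"
        using True by (simp add: half_angle_basis_def power2_eq_square)
      also have "\<dots> = half_angle_basis (Suc n) a t - half_angle_basis (Suc n) (a + 2) t"
        unfolding sin_squared_eq
        using True by (simp add: half_angle_basis_def algebra_simps power2_eq_square)
      finally show ?thesis by (simp flip: of_real_mult of_real_diff)
    qed
    moreover have "(\<lambda>t. complex_of_real (half_angle_basis (Suc n) a t) + (- 1) * of_real (half_angle_basis (Suc n) (a + 2) t)) \<in> half_angle_span (Suc n)"
      using a a2 by (intro half_angle_span_add half_angle_span_scale half_angle_span_basis) auto
    ultimately show ?thesis by simp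
  qed
qed

lemma half_angle_span_cis:
  "(\<lambda>t. cis t ^ j * cis (- t) ^ k) \<in> half_angle_span (Suc (j + k))"
proof (induction j)
  case 0
  show ?case
  proof (induction k)
    case 0
    show ?case using half_angle_span_basis[of 0 1] by (simp add: half_angle_basis_def)
  next
    case (Suc k)
    define h where "h = (\<lambda>t. cis t ^ 0 * cis (- t) ^ k)"
    have "(\<lambda>t. of_real (cos t) * h t + - \<i> * (of_real (sin t) * h t)) \<in> half_angle_span (Suc (Suc (0 + k)))"
      using Suc by (intro half_angle_span_add half_angle_span_scale half_angle_span_cos half_angle_span_sin) (auto simp: h_def)
    moreover have "of_real (cos t) * h t + - \<i> * (of_real (sin t) * h t) = cis t ^ 0 * cis (- t) ^ Suc k" for t
    proof -
      have "cis (- t) = of_real (cos t) + - \<i> * of_real (sin t)" by (simp add: complex_eq_iff)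
      thus ?thesis unfolding h_def power_Suc by (simp only: distrib_right mult.assoc mult.left_commute mult_1 power_0)
    qed
    ultimately show ?case by simp
  qed
next
  case (Suc j)
  define h where "h = (\<lambda>t. cis t ^ j * cis (- t) ^ k)"
  have "(\<lambda>t. of_real (cos t) * h t + \<i> * (of_real (sin t) * h t)) \<in> half_angle_span (Suc (Suc (j + k)))"
    using Suc by (intro half_angle_span_add half_angle_span_scale half_angle_span_cos half_angle_span_sin) (auto simp: h_def)
  moreover have "of_real (cos t) * h t + \<i> * (of_real (sin t) * h t) = cis t ^ Suc j * cis (- t) ^ k" for t
  proof -
    have "cis t = of_real (cos t) + \<i> * of_real (sin t)" by (simp add: complex_eq_iff)
    thus ?thesis unfolding h_def power_Suc by (simp only: distrib_right mult.assoc)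
  qed
  ultimately show ?case by simp
qed

lemma half_angle_expansion:
  obtains A :: "nat \<Rightarrow> nat \<Rightarrow> complex" where
    "\<And>j t. j < n \<Longrightarrow> cis ((2 * real j - (real n - 1)) * t) = (\<Sum>a<n. A j a * of_real (half_angle_basis n a t))"
proof -
  have "\<exists>A. \<forall>t. cis ((2 * real j - (real n - 1)) * t) = (\<Sum>a<n. A a * of_real (half_angle_basis n a t))" if "j < n" for j
  proof -
    have "cis t ^ j * cis (- t) ^ (n - 1 - j) = cis ((2 * real j - (real n - 1)) * t)" for t
      using that by (simp add: Complex.DeMoivre cis_mult of_nat_diff algebra_simps)
    moreover have "Suc (j + (n - 1 - j)) = n" using that by simp
    ultimately show ?thesis using half_angle_span_cis[of j "n - 1 - j"] unfolding half_angle_span_def by auto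
  qed
  then obtain A where "\<And>j. j < n \<Longrightarrow> \<forall>t. cis ((2 * real j - (real n - 1)) * t) = (\<Sum>a<n. A j a * of_real (half_angle_basis n a t))"
    by metis
  thus ?thesis using that by blast
qed

definition half_angle_gram :: "real \<Rightarrow> (real \<Rightarrow> real) \<Rightarrow> nat \<Rightarrow> nat \<Rightarrow> nat \<Rightarrow> real" where
  "half_angle_gram \<alpha> h n a b = 1 / (2 * pi) *
     integral {\<alpha>..2 * pi - \<alpha>} (\<lambda>\<theta>. half_angle_basis n a (\<theta> / 2) * half_angle_basis n b (\<theta> / 2) * h \<theta>)"

lemma has_integral_of_real_complex:
  fixes f :: "real \<Rightarrow> real"
  assumes "(f has_integral I) S"
  shows "((\<lambda>x. complex_of_real (f x)) has_integral of_real I) S"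
  using has_integral_linear[OF assms bounded_linear_of_real] by (simp add: o_def)

lemma set_integral_truncated:
  fixes h :: "real \<Rightarrow> real" and e f :: "real \<Rightarrow> complex"
  assumes \<alpha>: "0 \<le> \<alpha>" and h: "continuous_on {\<alpha>..2 * pi - \<alpha>} h" and e: "continuous_on UNIV e"
    and f: "\<And>\<theta>. f \<theta> = (if \<alpha> \<le> \<theta> \<and> \<theta> \<le> 2 * pi - \<alpha> then of_real (h \<theta>) else 0)"
  shows "(LBINT \<theta>:{0..2 * pi}. e \<theta> * f \<theta>) = integral {\<alpha>..2 * pi - \<alpha>} (\<lambda>\<theta>. e \<theta> * of_real (h \<theta>))"
proof -
  have "(LBINT \<theta>:{0..2 * pi}. e \<theta> * f \<theta>) = (LBINT \<theta>:{\<alpha>..2 * pi - \<alpha>}. e \<theta> * of_real (h \<theta>))"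
    unfolding set_lebesgue_integral_def
    by (intro Bochner_Integration.integral_cong refl) (use \<alpha> in \<open>auto simp: f indicator_def\<close>)
  also have "\<dots> = integral {\<alpha>..2 * pi - \<alpha>} (\<lambda>\<theta>. e \<theta> * of_real (h \<theta>))"
    by (intro set_borel_integral_eq_integral(2) borel_integrable_atLeastAtMost' continuous_intros
        continuous_on_subset[OF e] h) auto
  finally show ?thesis .
qed

lemma continuous_on_half_angle_basis [continuous_intros]:
  "continuous_on S (\<lambda>\<theta>. half_angle_basis n a (\<theta> / 2))"
  unfolding half_angle_basis_def by (intro continuous_intros) auto

lemma half_angle_gram_has_integral:
  assumes "continuous_on {\<alpha>..2 * pi - \<alpha>} h"
  shows "((\<lambda>\<theta>. half_angle_basis n a (\<theta> / 2) * half_angle_basis n b (\<theta> / 2) * h \<theta>) has_integral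
     2 * pi * half_angle_gram \<alpha> h n a b) {\<alpha>..2 * pi - \<alpha>}"
proof -
  have "(\<lambda>\<theta>. half_angle_basis n a (\<theta> / 2) * half_angle_basis n b (\<theta> / 2) * h \<theta>) integrable_on {\<alpha>..2 * pi - \<alpha>}"
    by (intro integrable_continuous_interval continuous_intros assms)
  thus ?thesis by (simp add: half_angle_gram_def has_integral_integral)
qed

text \<open>The Toeplitz matrix is conj A * G * A^T with the coefficient matrix A, so
  \<open>C\<close> is the squared modulus of det A. It is obtained before \<alpha>, \<open>h\<close>
  and \<open>f\<close> are fixed and depends on \<open>n\<close> alone, which permits fixing it by
  one particular weight.\<close>

lemma toeplitz_det_gram:
  assumes n: "n \<ge> 1"
  obtains C :: real where
    "\<And>\<alpha> h f. 0 \<le> \<alpha> \<Longrightarrow> continuous_on {\<alpha>..2 * pi - \<alpha>} h \<Longrightarrow>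
      (\<And>\<theta>. f \<theta> = (if \<alpha> \<le> \<theta> \<and> \<theta> \<le> 2 * pi - \<alpha> then of_real (h \<theta>) else 0)) \<Longrightarrow>
      toeplitz_det (n - 1) f = of_real (C * Determinant.det (Matrix.mat n n (\<lambda>(a, b). half_angle_gram \<alpha> h n a b)))"
proof -
  obtain A :: "nat \<Rightarrow> nat \<Rightarrow> complex" where A:
    "\<And>j t. j < n \<Longrightarrow> cis ((2 * real j - (real n - 1)) * t) = (\<Sum>a<n. A j a * of_real (half_angle_basis n a t))"
    using half_angle_expansion[of n] by blast
  define MA where "MA = Matrix.mat n n (\<lambda>(j, a). A j a)"
  have MA: "MA \<in> carrier_mat n n" by (simp add: MA_def)
  show ?thesis
  proof (rule that)
    fix \<alpha> :: real and h f
    assume \<alpha>: "0 \<le> \<alpha>" and h: "continuous_on {\<alpha>..2 * pi - \<alpha>} h"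
      and f: "\<And>\<theta>. f \<theta> = (if \<alpha> \<le> \<theta> \<and> \<theta> \<le> 2 * pi - \<alpha> then complex_of_real (h \<theta>) else 0)"
    define G where "G = half_angle_gram \<alpha> h n"
    define MG where "MG = Matrix.mat n n (\<lambda>(a, b). G a b)"
    have MG: "MG \<in> carrier_mat n n" by (simp add: MG_def)
    have entry: "toeplitz (n - 1) f $$ (j, k) = (\<Sum>a<n. \<Sum>b<n. cnj (A j a) * A k b * of_real (G a b))"
      if jk: "j < n" "k < n" for j k
    proof -
      have e: "exp (- \<i> * (of_nat j - of_nat k) * of_real \<theta>) =
         (\<Sum>a<n. \<Sum>b<n. cnj (A j a) * A k b * of_real (half_angle_basis n a (\<theta> / 2) * half_angle_basis n b (\<theta> / 2)))" for \<theta>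
      proof -
        have "exp (- \<i> * (of_nat j - of_nat k) * of_real \<theta>) = cis ((real k - real j) * \<theta>)"
          by (simp add: cis_conv_exp algebra_simps)
        \<comment> \<open>The common shift n - 1 of the frequencies cancels between the two factors;
          it makes the frequencies symmetric about 0.\<close>
        also have "\<dots> = cnj (cis ((2 * real j - (real n - 1)) * (\<theta> / 2))) * cis ((2 * real k - (real n - 1)) * (\<theta> / 2))"
          by (simp add: cis_cnj cis_mult algebra_simps add_divide_distrib diff_divide_distrib)
        also have "\<dots> = (\<Sum>a<n. cnj (A j a) * of_real (half_angle_basis n a (\<theta> / 2))) * (\<Sum>b<n. A k b * of_real (half_angle_basis n b (\<theta> / 2)))"
          by (simp only: A[OF jk(1)] A[OF jk(2)] cnj_sum complex_cnj_mult complex_cnj_complex_of_real)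
        also have "\<dots> = (\<Sum>a<n. \<Sum>b<n. cnj (A j a) * A k b * of_real (half_angle_basis n a (\<theta> / 2) * half_angle_basis n b (\<theta> / 2)))"
          unfolding sum_product by (intro sum.cong refl) (simp add: mult_ac)
        finally show ?thesis .
      qed
      have "toeplitz (n - 1) f $$ (j, k) = 1 / (2 * of_real pi) *
         (LBINT \<theta>:{0..2 * pi}. exp (- \<i> * (of_nat j - of_nat k) * of_real \<theta>) * f \<theta>)"
        using jk n by (simp add: toeplitz_def)
      also have "(LBINT \<theta>:{0..2 * pi}. exp (- \<i> * (of_nat j - of_nat k) * of_real \<theta>) * f \<theta>) =
         integral {\<alpha>..2 * pi - \<alpha>} (\<lambda>\<theta>. exp (- \<i> * (of_nat j - of_nat k) * of_real \<theta>) * of_real (h \<theta>))"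
        by (rule set_integral_truncated[OF \<alpha> h _ f]) (intro continuous_intros)
      also have "\<dots> = (\<Sum>a<n. \<Sum>b<n. cnj (A j a) * A k b * of_real (2 * pi * G a b))"
      proof (rule integral_unique)
        have "((\<lambda>\<theta>. \<Sum>a<n. \<Sum>b<n. cnj (A j a) * A k b * of_real (half_angle_basis n a (\<theta> / 2) * half_angle_basis n b (\<theta> / 2) * h \<theta>))
          has_integral (\<Sum>a<n. \<Sum>b<n. cnj (A j a) * A k b * of_real (2 * pi * G a b))) {\<alpha>..2 * pi - \<alpha>}"
          unfolding G_def
          by (intro has_integral_sum has_integral_mult_right has_integral_of_real_complex half_angle_gram_has_integral h) auto
        thus "((\<lambda>\<theta>. exp (- \<i> * (of_nat j - of_nat k) * of_real \<theta>) * of_real (h \<theta>))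
          has_integral (\<Sum>a<n. \<Sum>b<n. cnj (A j a) * A k b * of_real (2 * pi * G a b))) {\<alpha>..2 * pi - \<alpha>}"
          unfolding e by (simp add: sum_distrib_right mult.assoc)
      qed
      also have "1 / (2 * of_real pi) * \<dots> = (\<Sum>a<n. \<Sum>b<n. cnj (A j a) * A k b * of_real (G a b))"
        unfolding sum_distrib_left by (intro sum.cong refl) simp
      finally show ?thesis .
    qed
    have "toeplitz (n - 1) f = map_mat cnj MA * (map_mat of_real MG * transpose_mat MA)"
    proof (rule eq_matI)
      fix j k assume "j < dim_row (map_mat cnj MA * (map_mat of_real MG * transpose_mat MA))"
        "k < dim_col (map_mat cnj MA * (map_mat of_real MG * transpose_mat MA))"
      hence jk: "j < n" "k < n" by (simp_all add: MA_def)
      show "toeplitz (n - 1) f $$ (j, k) = (map_mat cnj MA * (map_mat of_real MG * transpose_mat MA)) $$ (j, k)"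
        unfolding entry[OF jk] using jk
        by (simp add: MA_def MG_def scalar_prod_def atLeast0LessThan sum_distrib_left mult_ac)
    qed (use n in \<open>simp_all add: toeplitz_def MA_def\<close>)
    hence "toeplitz_det (n - 1) f = Determinant.det (map_mat cnj MA) * (Determinant.det (map_mat of_real MG) * Determinant.det (transpose_mat MA))"
      unfolding toeplitz_det_def using MA MG by (simp add: det_mult[where n = n])
    also have "\<dots> = cnj (Determinant.det MA) * (of_real (Determinant.det MG) * Determinant.det MA)"
    proof -
      have "comm_ring_hom cnj" by unfold_locales auto
      thus ?thesis using MA by (simp add: comm_ring_hom.hom_det of_real_hom.hom_det det_transpose)
    qed
    also have "\<dots> = of_real ((norm (Determinant.det MA))\<^sup>2 * Determinant.det MG)"
      using complex_norm_square[of "Determinant.det MA"] by (simp add: mult_ac)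
    finally show "toeplitz_det (n - 1) f =
       of_real ((norm (Determinant.det MA))\<^sup>2 * Determinant.det (Matrix.mat n n (\<lambda>(a, b). half_angle_gram \<alpha> h n a b)))"
      by (simp add: MG_def G_def)
  qed
qed

text \<open>The reflection \<theta> -> 2 pi - \<theta> changes the sign of cos (\<theta> / 2) and
  fixes sin (\<theta> / 2).\<close>

lemma half_angle_gram_odd:
  assumes h: "continuous_on {\<alpha>..2 * pi - \<alpha>} h" "\<And>\<theta>. h (2 * pi - \<theta>) = h \<theta>"
    and \<alpha>: "\<alpha> \<le> pi" and odd: "odd (a + b)"
  shows "half_angle_gram \<alpha> h n a b = 0"
proof -
  define F where "F = (\<lambda>\<theta>. half_angle_basis n a (\<theta> / 2) * half_angle_basis n b (\<theta> / 2) * h \<theta>)"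
  have F: "continuous_on {\<alpha>..2 * pi - \<alpha>} F" unfolding F_def by (intro continuous_intros h)
  have odd': "F (2 * pi - \<theta>) = - F \<theta>" for \<theta>
  proof -
    have sc: "sin ((2 * pi - \<theta>) / 2) = sin (\<theta> / 2)" "cos ((2 * pi - \<theta>) / 2) = - cos (\<theta> / 2)"
      using sin_pi_minus[of "\<theta> / 2"] cos_pi_minus[of "\<theta> / 2"] by (simp_all add: diff_divide_distrib)
    have E: "(- cos (\<theta> / 2)) ^ a * (- cos (\<theta> / 2)) ^ b = - (cos (\<theta> / 2) ^ a * cos (\<theta> / 2) ^ b)"
      using odd by (simp add: power_add[symmetric])
    let ?e = "\<lambda>a. if even (a + n) then 1 else 0 :: nat"
    have "F (2 * pi - \<theta>) = ((- cos (\<theta> / 2)) ^ a * (- cos (\<theta> / 2)) ^ b) * (sin (\<theta> / 2) ^ ?e a * sin (\<theta> / 2) ^ ?e b * h \<theta>)"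
      unfolding F_def half_angle_basis_def sc h(2) by (simp only: mult_ac)
    also have "\<dots> = - F \<theta>"
      unfolding E F_def half_angle_basis_def by (simp only: mult_ac mult_minus_left mult_minus_right)
    finally show ?thesis .
  qed
  \<comment> \<open>The substitution rule treats both orientations by a difference of two integrals;
    over the reversed limits the interval is empty, or a point if \<alpha> = pi, and that integral
    is 0.\<close>
  have "((\<lambda>x. - 1 *\<^sub>R F (2 * pi - x)) has_integral
      integral {2 * pi - \<alpha>..2 * pi - (2 * pi - \<alpha>)} F - integral {2 * pi - (2 * pi - \<alpha>)..2 * pi - \<alpha>} F) {\<alpha>..2 * pi - \<alpha>}"
    by (rule has_integral_substitution_general[where s = "{}" and c = \<alpha> and d = "2 * pi - \<alpha>"])
       (use \<alpha> in \<open>auto intro!: F continuous_intros derivative_eq_intros\<close>)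
  moreover have "(\<lambda>x. - 1 *\<^sub>R F (2 * pi - x)) = F" by (simp add: odd' fun_eq_iff)
  moreover have "integral {2 * pi - \<alpha>..2 * pi - (2 * pi - \<alpha>)} F = 0"
    using \<alpha> by (cases "\<alpha> = pi") auto
  moreover have "2 * pi - (2 * pi - \<alpha>) = \<alpha>" by simp
  ultimately have "(F has_integral 0 - integral {\<alpha>..2 * pi - \<alpha>} F) {\<alpha>..2 * pi - \<alpha>}"
    by (simp only:)
  hence "integral {\<alpha>..2 * pi - \<alpha>} F = 0 - integral {\<alpha>..2 * pi - \<alpha>} F"
    by (rule integral_unique)
  hence "integral {\<alpha>..2 * pi - \<alpha>} F = 0" by linarith
  thus ?thesis by (simp add: half_angle_gram_def F_def)
qed

text \<open>For k + n even the two sine factors of the Gram entries combine to an extra weight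
  sin^2, which the orthogonality hypothesis takes into account.\<close>

lemma toeplitz_det_orthogonal:
  assumes n: "n \<ge> 1"
  obtains C :: real where
    "\<And>\<alpha> h f r N. 0 \<le> \<alpha> \<Longrightarrow> \<alpha> \<le> pi \<Longrightarrow> continuous_on {\<alpha>..2 * pi - \<alpha>} h \<Longrightarrow>
      (\<And>\<theta>. h (2 * pi - \<theta>) = h \<theta>) \<Longrightarrow>
      (\<And>\<theta>. f \<theta> = (if \<alpha> \<le> \<theta> \<and> \<theta> \<le> 2 * pi - \<alpha> then of_real (h \<theta>) else 0)) \<Longrightarrow>
      (\<And>k. k < n \<Longrightarrow> monic_parity k (r k)) \<Longrightarrow>
      (\<And>k l. k < n \<Longrightarrow> l \<le> k \<Longrightarrow> even (k + l) \<Longrightarrow>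
         1 / (2 * pi) * integral {\<alpha>..2 * pi - \<alpha>} (\<lambda>\<theta>. poly (r k) (cos (\<theta> / 2)) * cos (\<theta> / 2) ^ l *
            (sin (\<theta> / 2))\<^sup>2 ^ (if even (k + n) then 1 else 0) * h \<theta>) = (if l = k then N k else 0)) \<Longrightarrow>
      toeplitz_det (n - 1) f = of_real (C * (\<Prod>k<n. N k))"
proof -
  obtain C where C: "\<And>\<alpha> h f. 0 \<le> \<alpha> \<Longrightarrow> continuous_on {\<alpha>..2 * pi - \<alpha>} h \<Longrightarrow>
      (\<And>\<theta>. f \<theta> = (if \<alpha> \<le> \<theta> \<and> \<theta> \<le> 2 * pi - \<alpha> then of_real (h \<theta>) else 0)) \<Longrightarrow>
      toeplitz_det (n - 1) f = of_real (C * Determinant.det (Matrix.mat n n (\<lambda>(a, b). half_angle_gram \<alpha> h n a b)))"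
    using toeplitz_det_gram[OF n] by blast
  show ?thesis
  proof (rule that)
    fix \<alpha> :: real and h :: "real \<Rightarrow> real" and f :: "real \<Rightarrow> complex" and r :: "nat \<Rightarrow> real poly" and N :: "nat \<Rightarrow> real"
    assume \<alpha>: "0 \<le> \<alpha>" "\<alpha> \<le> pi" and h: "continuous_on {\<alpha>..2 * pi - \<alpha>} h"
      and hs: "\<And>\<theta>. h (2 * pi - \<theta>) = h \<theta>"
      and f: "\<And>\<theta>. f \<theta> = (if \<alpha> \<le> \<theta> \<and> \<theta> \<le> 2 * pi - \<alpha> then of_real (h \<theta>) else 0)"
      and r: "\<And>k. k < n \<Longrightarrow> monic_parity k (r k)"
      and orth: "\<And>k l. k < n \<Longrightarrow> l \<le> k \<Longrightarrow> even (k + l) \<Longrightarrow>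
         1 / (2 * pi) * integral {\<alpha>..2 * pi - \<alpha>} (\<lambda>\<theta>. poly (r k) (cos (\<theta> / 2)) * cos (\<theta> / 2) ^ l *
            (sin (\<theta> / 2))\<^sup>2 ^ (if even (k + n) then 1 else 0) * h \<theta>) = (if l = k then N k else 0)"
    have "Determinant.det (Matrix.mat n n (\<lambda>(a, b). half_angle_gram \<alpha> h n a b)) = (\<Prod>k<n. N k)"
    proof (rule det_parity_gram[OF _ r])
      fix a b :: nat assume "odd (a + b)"
      thus "half_angle_gram \<alpha> h n a b = 0" by (rule half_angle_gram_odd[OF h hs \<alpha>(2)])
    next
      fix k l assume kl: "k < n" "l \<le> k" "even (k + l)"
      define \<epsilon> :: nat where "\<epsilon> = (if even (k + n) then 1 else 0)"
      have rz: "coeff (r k) a = 0" if "odd (k + a)" for a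
        using coeff_eq_0_of_parity[of "r k" k a] r[OF kl(1)] that by (auto simp: monic_parity_def)
      have deg: "degree (r k) \<le> k" using r[OF kl(1)] by (simp add: monic_parity_def)
      have "((\<lambda>\<theta>. \<Sum>a\<le>k. coeff (r k) a * (half_angle_basis n a (\<theta> / 2) * half_angle_basis n l (\<theta> / 2) * h \<theta>)) has_integral
         (\<Sum>a\<le>k. coeff (r k) a * (2 * pi * half_angle_gram \<alpha> h n a l))) {\<alpha>..2 * pi - \<alpha>}"
        by (intro has_integral_sum has_integral_mult_right half_angle_gram_has_integral h) auto
      moreover have "(\<Sum>a\<le>k. coeff (r k) a * (half_angle_basis n a (\<theta> / 2) * half_angle_basis n l (\<theta> / 2) * h \<theta>)) =
         poly (r k) (cos (\<theta> / 2)) * cos (\<theta> / 2) ^ l * (sin (\<theta> / 2))\<^sup>2 ^ \<epsilon> * h \<theta>" for \<theta>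
      proof -
        have "poly (r k) (cos (\<theta> / 2)) = (\<Sum>a\<le>k. coeff (r k) a * cos (\<theta> / 2) ^ a)"
          unfolding poly_altdef using deg by (intro sum.mono_neutral_left) (auto simp: coeff_eq_0)
        hence "poly (r k) (cos (\<theta> / 2)) * cos (\<theta> / 2) ^ l * (sin (\<theta> / 2))\<^sup>2 ^ \<epsilon> * h \<theta> =
          (\<Sum>a\<le>k. coeff (r k) a * cos (\<theta> / 2) ^ a * cos (\<theta> / 2) ^ l * (sin (\<theta> / 2))\<^sup>2 ^ \<epsilon> * h \<theta>)"
          by (simp only: sum_distrib_right)
        also have "\<dots> = (\<Sum>a\<le>k. coeff (r k) a * (half_angle_basis n a (\<theta> / 2) * half_angle_basis n l (\<theta> / 2) * h \<theta>))"
        proof (rule sum.cong)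
          fix a
          show "coeff (r k) a * cos (\<theta> / 2) ^ a * cos (\<theta> / 2) ^ l * (sin (\<theta> / 2))\<^sup>2 ^ \<epsilon> * h \<theta> =
             coeff (r k) a * (half_angle_basis n a (\<theta> / 2) * half_angle_basis n l (\<theta> / 2) * h \<theta>)"
          \<comment> \<open>Coefficients of the wrong parity vanish, so every surviving
            \<open>a\<close> carries the same sine exponent as \<open>k\<close> and
            \<open>l\<close>.\<close>
          proof (cases "even (k + a)")
            case True
            hence "even (a + n) = even (k + n)" "even (l + n) = even (k + n)" using kl(3) by auto
            thus ?thesis by (simp add: half_angle_basis_def \<epsilon>_def power2_eq_square)
          qed (simp add: rz)
        qed simp
        finally show ?thesis by simp
      qed
      ultimately have "integral {\<alpha>..2 * pi - \<alpha>} (\<lambda>\<theta>. poly (r k) (cos (\<theta> / 2)) * cos (\<theta> / 2) ^ l * (sin (\<theta> / 2))\<^sup>2 ^ \<epsilon> * h \<theta>)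
          = (\<Sum>a\<le>k. coeff (r k) a * (2 * pi * half_angle_gram \<alpha> h n a l))"
        by (simp add: integral_unique)
      also have "\<dots> = 2 * pi * (\<Sum>a\<le>k. coeff (r k) a * half_angle_gram \<alpha> h n a l)"
        by (simp add: sum_distrib_left mult_ac)
      finally show "(\<Sum>a\<le>k. coeff (r k) a * half_angle_gram \<alpha> h n a l) = (if l = k then N k else 0)"
        using orth[OF kl] unfolding \<epsilon>_def[symmetric] by simp
    qed
    thus "toeplitz_det (n - 1) f = of_real (C * (\<Prod>k<n. N k))"
      using C[OF \<alpha>(1) h f] by simp
  qed
qed

section \<open>Chebyshev polynomials and the constant weight\<close>

text \<open>For the weight 1 on the whole circle the two families of orthogonal polynomials in cos
  (\<theta> / 2) are the Chebyshev polynomials: of the first kind without the factor sin^2, of the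
  second kind with it.\<close>

fun chebyshev_T :: "nat \<Rightarrow> real poly" where
  "chebyshev_T 0 = 1"
| "chebyshev_T (Suc 0) = [:0, 1:]"
| "chebyshev_T (Suc (Suc n)) = [:0, 2:] * chebyshev_T (Suc n) - chebyshev_T n"

fun chebyshev_U :: "nat \<Rightarrow> real poly" where
  "chebyshev_U 0 = 1"
| "chebyshev_U (Suc 0) = [:0, 2:]"
| "chebyshev_U (Suc (Suc n)) = [:0, 2:] * chebyshev_U (Suc n) - chebyshev_U n"

lemma degree_2x_mult: "degree (p :: real poly) \<le> k \<Longrightarrow> degree ([:0, 2:] * p) \<le> Suc k"
  by (rule order_trans[OF degree_mult_le]) simp

lemma degree_chebyshev_T: "degree (chebyshev_T k) \<le> k"
proof (induction k rule: chebyshev_T.induct)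
  case (3 n)
  thus ?case unfolding chebyshev_T.simps by (intro degree_diff_le degree_2x_mult) auto
qed auto

lemma degree_chebyshev_U: "degree (chebyshev_U k) \<le> k"
proof (induction k rule: chebyshev_U.induct)
  case (3 n)
  thus ?case unfolding chebyshev_U.simps by (intro degree_diff_le degree_2x_mult) auto
qed auto

lemma coeff_chebyshev_T: "coeff (chebyshev_T k) k = 2 ^ (k - 1)"
proof (induction k rule: chebyshev_T.induct)
  case (3 n)
  have "coeff (chebyshev_T n) (Suc (Suc n)) = 0"
    using degree_chebyshev_T[of n] by (intro coeff_eq_0) auto
  thus ?case using 3 by simp
qed auto

lemma coeff_chebyshev_U: "coeff (chebyshev_U k) k = 2 ^ k"
proof (induction k rule: chebyshev_U.induct)
  case (3 n)
  have "coeff (chebyshev_U n) (Suc (Suc n)) = 0"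
    using degree_chebyshev_U[of n] by (intro coeff_eq_0) auto
  thus ?case using 3 by simp
qed auto

lemma parity_chebyshev_T: "poly (chebyshev_T k) (- x) = (- 1) ^ k * poly (chebyshev_T k) x"
  by (induction k rule: chebyshev_T.induct) (auto simp: algebra_simps)

lemma parity_chebyshev_U: "poly (chebyshev_U k) (- x) = (- 1) ^ k * poly (chebyshev_U k) x"
  by (induction k rule: chebyshev_U.induct) (auto simp: algebra_simps)

lemma poly_chebyshev_T: "poly (chebyshev_T k) (cos t) = cos (real k * t)"
proof (induction k rule: chebyshev_T.induct)
  case (3 n)
  have e: "real (Suc (Suc n)) * t = real (Suc n) * t + t" "real n * t = real (Suc n) * t - t"
    by (simp_all add: algebra_simps)
  have "cos (real (Suc (Suc n)) * t) + cos (real n * t) = 2 * cos t * cos (real (Suc n) * t)"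
    unfolding e cos_add cos_diff by simp
  thus ?case using 3 by (simp del: of_nat_Suc)
qed auto

lemma poly_chebyshev_U: "sin t * poly (chebyshev_U k) (cos t) = sin (real (Suc k) * t)"
proof (induction k rule: chebyshev_U.induct)
  case 2
  have e: "sin (real (Suc (Suc 0)) * t) = 2 * sin t * cos t" using sin_double[of t] by simp
  show ?case unfolding e by simp
next
  case (3 n)
  have e: "real (Suc (Suc (Suc n))) * t = real (Suc (Suc n)) * t + t" "real (Suc n) * t = real (Suc (Suc n)) * t - t"
    by (simp_all add: algebra_simps)
  have "sin (real (Suc (Suc (Suc n))) * t) + sin (real (Suc n) * t) = 2 * cos t * sin (real (Suc (Suc n)) * t)"
    unfolding e sin_add sin_diff by simp
  moreover have "sin t * poly (chebyshev_U (Suc (Suc n))) (cos t) =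
     2 * cos t * (sin t * poly (chebyshev_U (Suc n)) (cos t)) - sin t * poly (chebyshev_U n) (cos t)"
    by (simp add: algebra_simps)
  ultimately show ?case using 3 by (simp del: of_nat_Suc chebyshev_U.simps)
qed auto

definition cos_moment :: "nat \<Rightarrow> nat \<Rightarrow> real" where
  "cos_moment m l = 1 / (2 * pi) * integral {0..2 * pi} (\<lambda>\<theta>. cos (real m * (\<theta> / 2)) * cos (\<theta> / 2) ^ l)"

text \<open>Since cos (m t) cos t is the mean of cos ((m + 1) t) and cos ((m - 1) t), a moment with
  exponent l + 1 is the mean of two with exponent l, and only m - 1 = l contributes.\<close>

lemma cos_moment: "l \<le> m \<Longrightarrow> cos_moment m l = (if l = m then 1 / 2 ^ m else 0)"
proof (induction l arbitrary: m)
  case 0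
  show ?case
  proof (cases "m = 0")
    case False
    have "((\<lambda>\<theta>. cos (real m * (\<theta> / 2))) has_integral
        (2 / real m * sin (real m * (2 * pi / 2)) - 2 / real m * sin (real m * (0 / 2)))) {0..2 * pi}"
    proof (rule fundamental_theorem_of_calculus)
      fix x :: real
      have "((\<lambda>\<theta>. 2 / real m * sin (real m * (\<theta> / 2))) has_real_derivative cos (real m * (x / 2))) (at x within {0..2 * pi})"
        using False by (auto intro!: derivative_eq_intros)
      thus "((\<lambda>\<theta>. 2 / real m * sin (real m * (\<theta> / 2))) has_vector_derivative cos (real m * (x / 2))) (at x within {0..2 * pi})"
        by (simp add: has_real_derivative_iff_has_vector_derivative)
    qed simp
    thus ?thesis using False by (simp add: cos_moment_def integral_unique)
  qed (simp add: cos_moment_def)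
next
  case (Suc l)
  then obtain m' where m: "m = Suc m'" by (cases m) auto
  have int: "(\<lambda>\<theta>. cos (real m * (\<theta> / 2)) * cos (\<theta> / 2) ^ l) integrable_on {0..2 * pi}" for m
    by (intro integrable_continuous_interval continuous_intros) auto
  have eq: "cos (real m * (\<theta> / 2)) * cos (\<theta> / 2) ^ Suc l =
     1 / 2 * (cos (real (Suc m) * (\<theta> / 2)) * cos (\<theta> / 2) ^ l) + 1 / 2 * (cos (real m' * (\<theta> / 2)) * cos (\<theta> / 2) ^ l)" for \<theta>
  proof -
    have "cos (real (Suc m) * (\<theta> / 2)) + cos (real m' * (\<theta> / 2)) = 2 * cos (real m * (\<theta> / 2)) * cos (\<theta> / 2)"
    proof -
      have e: "real (Suc m) * (\<theta> / 2) = real m * (\<theta> / 2) + \<theta> / 2" "real m' * (\<theta> / 2) = real m * (\<theta> / 2) - \<theta> / 2"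
        by (simp_all add: m algebra_simps add_divide_distrib)
      show ?thesis unfolding e cos_add cos_diff by simp
    qed
    hence "(cos (real (Suc m) * (\<theta> / 2)) + cos (real m' * (\<theta> / 2))) * cos (\<theta> / 2) ^ l = 2 * cos (real m * (\<theta> / 2)) * cos (\<theta> / 2) * cos (\<theta> / 2) ^ l"
      by (simp only:)
    thus ?thesis by (simp add: distrib_right)
  qed
  have "cos_moment m (Suc l) = 1 / 2 * cos_moment (Suc m) l + 1 / 2 * cos_moment m' l"
    unfolding cos_moment_def eq
    by (simp only: integral_add[OF integrable_on_mult_right[OF int] integrable_on_mult_right[OF int]] integral_mult_right distrib_left mult.left_commute)
  thus ?case using Suc.IH[of "Suc m"] Suc.IH[of m'] Suc.prems by (auto simp: m field_simps)
qed

lemma nat_induct_step2 [case_names 0 1 step]: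
  "P 0 \<Longrightarrow> P 1 \<Longrightarrow> (\<And>n. P n \<Longrightarrow> P (n + 2)) \<Longrightarrow> P (n :: nat)"
  by (induction n rule: induct_nat_012) auto

text \<open>Induction in steps of two keeps the parity of k + n for the old factors.\<close>

lemma prod_chebyshev_norms:
  "(\<Prod>k<n. if even (k + n) then 1 / 2 ^ (2 * k + 1) else if k = 0 then 1 else 2 / 4 ^ k) = (1 / 2 ^ (n * (n - 1)) :: real)"
proof (induction n rule: nat_induct_step2)
  case (step n)
  have "(\<Prod>k<n + 2. if even (k + (n + 2)) then 1 / 2 ^ (2 * k + 1) else if k = 0 then 1 else 2 / 4 ^ k :: real) =
     (\<Prod>k<n. if even (k + n) then 1 / 2 ^ (2 * k + 1) else if k = 0 then 1 else 2 / 4 ^ k) * (1 / 2 ^ (2 * n + 1)) * (2 / 4 ^ (n + 1))"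
    by (simp add: add_2_eq_Suc')
  also have "\<dots> = 1 / 2 ^ (n * (n - 1)) * (1 / 2 ^ (2 * n + 1)) * (2 / 4 ^ (n + 1))"
    by (simp only: step.IH)
  also have "(4 :: real) ^ (n + 1) = 2 ^ (2 * n + 2)"
    by (simp add: power_mult)
  also have "(2 :: real) / 2 ^ (2 * n + 2) = 1 / 2 ^ (2 * n + 1)" by simp
  also have "1 / 2 ^ (n * (n - 1)) * (1 / 2 ^ (2 * n + 1)) * (1 / 2 ^ (2 * n + 1)) = 1 / (2 ^ (n * (n - 1) + (2 * n + 1) + (2 * n + 1)) :: real)"
    by (simp only: power_add times_divide_times_eq mult_1_left)
  also have "n * (n - 1) + (2 * n + 1) + (2 * n + 1) = (n + 2) * (n + 2 - 1)"
    by (cases n) (auto simp: algebra_simps)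
  finally show ?case .
qed simp_all

lemma toeplitz_det_1:
  "toeplitz_det m (\<lambda>\<theta>. if 0 \<le> \<theta> \<and> \<theta> \<le> 2 * pi - 0 then of_real 1 else 0) = 1"
proof -
  have "toeplitz m (\<lambda>\<theta>. if 0 \<le> \<theta> \<and> \<theta> \<le> 2 * pi - 0 then of_real 1 else 0) = 1\<^sub>m (m + 1)"
  proof (rule eq_matI)
    fix j k assume "j < dim_row (1\<^sub>m (m + 1) :: complex Matrix.mat)" "k < dim_col (1\<^sub>m (m + 1) :: complex Matrix.mat)"
    hence jk: "j < m + 1" "k < m + 1" by simp_all
    define d where "d = - \<i> * (of_nat j - of_nat k :: complex)"
    have "(LBINT \<theta>:{0..2 * pi}. exp (d * of_real \<theta>) * (if 0 \<le> \<theta> \<and> \<theta> \<le> 2 * pi - 0 then of_real 1 else 0)) =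
       integral {0..2 * pi - 0} (\<lambda>\<theta>. exp (d * of_real \<theta>) * of_real 1)"
      by (rule set_integral_truncated) (auto intro!: continuous_intros)
    also have "\<dots> = (if j = k then 2 * of_real pi else 0)"
    proof (cases "j = k")
      case False
      hence d: "d \<noteq> 0" by (simp add: d_def)
      have "((\<lambda>\<theta>. exp (d * of_real \<theta>)) has_integral (exp (d * of_real (2 * pi)) / d - exp (d * of_real 0) / d)) {0..2 * pi}"
      proof (rule fundamental_theorem_of_calculus)
        fix x :: real
        have "((\<lambda>\<theta>. exp (d * \<theta>) / d) has_field_derivative exp (d * of_real x)) (at (of_real x))"
          using d by (auto intro!: derivative_eq_intros)
        thus "((\<lambda>\<theta>. exp (d * of_real \<theta>) / d) has_vector_derivative exp (d * of_real x)) (at x within {0..2 * pi})"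
          by (rule has_vector_derivative_real_field[THEN has_vector_derivative_at_within, rotated -1] | rule has_vector_derivative_real_field)
      qed simp
      moreover have "exp (d * of_real (2 * pi)) = 1"
      proof -
        have e: "d * of_real (2 * pi) = (2 * of_int (int k - int j) * of_real pi) * \<i>"
          by (simp add: d_def algebra_simps)
        show ?thesis unfolding e using exp_integer_2pi[of "real_of_int (int k - int j)"] by simp
      qed
      ultimately show ?thesis using False by (simp add: integral_unique)
    qed (simp add: d_def scaleR_conv_of_real)
    finally show "toeplitz m (\<lambda>\<theta>. if 0 \<le> \<theta> \<and> \<theta> \<le> 2 * pi - 0 then of_real 1 else 0) $$ (j, k) = 1\<^sub>m (m + 1) $$ (j, k)"
      using jk by (simp add: toeplitz_def d_def)
  qed (auto simp: toeplitz_def)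
  thus ?thesis by (simp add: toeplitz_det_def)
qed

text \<open>For f = 1 the Toeplitz matrix is the identity and the norms multiply to 2 ^ (- n (n -
  1)); this gives the constant for all weights.\<close>

lemma toeplitz_det_eq_prod_norms:
  assumes n: "n \<ge> 1" and \<alpha>: "0 \<le> \<alpha>" "\<alpha> \<le> pi" and h: "continuous_on {\<alpha>..2 * pi - \<alpha>} h" "\<And>\<theta>. h (2 * pi - \<theta>) = h \<theta>"
    and f: "\<And>\<theta>. f \<theta> = (if \<alpha> \<le> \<theta> \<and> \<theta> \<le> 2 * pi - \<alpha> then of_real (h \<theta>) else 0)"
    and r: "\<And>k. k < n \<Longrightarrow> monic_parity k (r k)"
    and orth: "\<And>k l. k < n \<Longrightarrow> l \<le> k \<Longrightarrow> even (k + l) \<Longrightarrow>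
         1 / (2 * pi) * integral {\<alpha>..2 * pi - \<alpha>} (\<lambda>\<theta>. poly (r k) (cos (\<theta> / 2)) * cos (\<theta> / 2) ^ l *
            (sin (\<theta> / 2))\<^sup>2 ^ (if even (k + n) then 1 else 0) * h \<theta>) = (if l = k then N k else 0)"
  shows "toeplitz_det (n - 1) f = of_real (2 ^ (n * (n - 1)) * (\<Prod>k<n. N k))"
proof -
  obtain C :: real where C:
    "\<And>\<alpha> h f r N. 0 \<le> \<alpha> \<Longrightarrow> \<alpha> \<le> pi \<Longrightarrow> continuous_on {\<alpha>..2 * pi - \<alpha>} h \<Longrightarrow>
      (\<And>\<theta>. h (2 * pi - \<theta>) = h \<theta>) \<Longrightarrow>
      (\<And>\<theta>. f \<theta> = (if \<alpha> \<le> \<theta> \<and> \<theta> \<le> 2 * pi - \<alpha> then of_real (h \<theta>) else 0)) \<Longrightarrow>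
      (\<And>k. k < n \<Longrightarrow> monic_parity k (r k)) \<Longrightarrow>
      (\<And>k l. k < n \<Longrightarrow> l \<le> k \<Longrightarrow> even (k + l) \<Longrightarrow>
         1 / (2 * pi) * integral {\<alpha>..2 * pi - \<alpha>} (\<lambda>\<theta>. poly (r k) (cos (\<theta> / 2)) * cos (\<theta> / 2) ^ l *
            (sin (\<theta> / 2))\<^sup>2 ^ (if even (k + n) then 1 else 0) * h \<theta>) = (if l = k then N k else 0)) \<Longrightarrow>
      toeplitz_det (n - 1) f = of_real (C * (\<Prod>k<n. N k))"
    by (rule toeplitz_det_orthogonal[OF n]) blast
  define T where "T = (\<lambda>k. smult (1 / 2 ^ (k - 1)) (chebyshev_T k))"
  define U where "U = (\<lambda>k. smult (1 / 2 ^ k) (chebyshev_U k))"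
  have "toeplitz_det (n - 1) (\<lambda>\<theta>. if 0 \<le> \<theta> \<and> \<theta> \<le> 2 * pi - 0 then of_real 1 else 0) =
    of_real (C * (\<Prod>k<n. if even (k + n) then 1 / 2 ^ (2 * k + 1) else if k = 0 then 1 else 2 / 4 ^ k))"
  proof (rule C[where h = "\<lambda>_. 1" and r = "\<lambda>k. if even (k + n) then U k else T k"])
    show "monic_parity k (if even (k + n) then U k else T k)" for k
      using degree_chebyshev_T[of k] degree_chebyshev_U[of k]
      by (auto simp: monic_parity_def T_def U_def parity_chebyshev_T parity_chebyshev_U coeff_chebyshev_T coeff_chebyshev_U)
  next
    fix k l assume kl: "k < n" "l \<le> k" "even (k + l)"
    have int: "(\<lambda>\<theta>. cos (real m * (\<theta> / 2)) * cos (\<theta> / 2) ^ l) integrable_on {0..2 * pi}" for m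
      by (intro integrable_continuous_interval continuous_intros) auto
    show "1 / (2 * pi) * integral {0..2 * pi - 0} (\<lambda>\<theta>. poly (if even (k + n) then U k else T k) (cos (\<theta> / 2)) * cos (\<theta> / 2) ^ l *
            (sin (\<theta> / 2))\<^sup>2 ^ (if even (k + n) then 1 else 0) * 1) =
       (if l = k then if even (k + n) then 1 / 2 ^ (2 * k + 1) else if k = 0 then 1 else 2 / 4 ^ k else 0)"
    proof (cases "even (k + n)")
      case False
      have "1 / (2 * pi) * integral {0..2 * pi} (\<lambda>\<theta>. poly (T k) (cos (\<theta> / 2)) * cos (\<theta> / 2) ^ l) =
         1 / 2 ^ (k - 1) * cos_moment k l"
        unfolding cos_moment_def T_def poly_smult poly_chebyshev_T mult.assoc integral_mult_right
        by (simp only: mult.left_commute)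
      also have "\<dots> = (if l = k then if k = 0 then 1 else 2 / 4 ^ k else 0)"
      proof -
        have h: "2 ^ (k - 1) * 2 ^ k = (4 ^ k / 2 :: real)" if "k \<noteq> 0"
          using that by (cases k) (auto simp: power_mult_distrib[symmetric])
        have "1 / 2 ^ (k - 1) * (1 / 2 ^ k) = (1 / (4 ^ k / 2) :: real)" if "k \<noteq> 0"
          by (simp only: times_divide_times_eq mult_1_left h[OF that])
        thus ?thesis using kl(2) by (auto simp: cos_moment mult.commute)
      qed
      finally show ?thesis using False by simp
    next
      case True
      \<comment> \<open>The identity 2 sin t sin ((k + 1) t) = cos (k t) - cos ((k + 2) t) reduces
        the second kind to two cosine moments, of which the one with k + 2 > l vanishes.\<close>
      have eq: "poly (U k) (cos t) * cos t ^ l * (sin t)\<^sup>2 =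
          1 / 2 ^ (k + 1) * (cos (real k * t) * cos t ^ l) - 1 / 2 ^ (k + 1) * (cos (real (k + 2) * t) * cos t ^ l)" for t
      proof -
        have "cos (real k * t) - cos (real (k + 2) * t) = 2 * sin t * sin (real (Suc k) * t)"
          using cos_add[of "real (Suc k) * t" t] cos_diff[of "real (Suc k) * t" t] by (simp add: algebra_simps)
        also have "\<dots> = 2 * sin t * (sin t * poly (chebyshev_U k) (cos t))"
          by (simp only: poly_chebyshev_U)
        finally have "poly (chebyshev_U k) (cos t) * (sin t)\<^sup>2 = (cos (real k * t) - cos (real (k + 2) * t)) / 2"
          by (simp add: power2_eq_square mult_ac)
        hence "1 / 2 ^ k * cos t ^ l * (poly (chebyshev_U k) (cos t) * (sin t)\<^sup>2) = 1 / 2 ^ k * cos t ^ l * ((cos (real k * t) - cos (real (k + 2) * t)) / 2)"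
          by (simp only:)
        thus ?thesis unfolding U_def by (simp add: field_simps)
      qed
      have "1 / (2 * pi) * integral {0..2 * pi} (\<lambda>\<theta>. poly (U k) (cos (\<theta> / 2)) * cos (\<theta> / 2) ^ l * (sin (\<theta> / 2))\<^sup>2) =
         1 / 2 ^ (k + 1) * cos_moment k l - 1 / 2 ^ (k + 1) * cos_moment (k + 2) l"
        unfolding cos_moment_def eq
        by (simp only: integral_diff[OF integrable_on_mult_right[OF int] integrable_on_mult_right[OF int]] integral_mult_right right_diff_distrib mult.left_commute)
      also have "\<dots> = (if l = k then 1 / 2 ^ (2 * k + 1) else 0)"
      proof -
        have "cos_moment (k + 2) l = 0" using cos_moment[of l "k + 2"] kl(2) by simp
        moreover have "2 * k + 1 = (k + 1) + k" by simp
        hence "(2 :: real) ^ (2 * k + 1) = 2 ^ (k + 1) * 2 ^ k" by (simp only: power_add)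
        ultimately show ?thesis unfolding cos_moment[OF kl(2)] by auto
      qed
      finally show ?thesis using True by simp
    qed
  qed simp_all
  hence "1 = complex_of_real (C * (1 / 2 ^ (n * (n - 1))))"
    unfolding toeplitz_det_1 prod_chebyshev_norms .
  hence "C * (1 / 2 ^ (n * (n - 1))) = 1" using of_real_eq_1_iff by metis
  hence "C = 2 ^ (n * (n - 1))" by (simp add: field_simps)
  thus ?thesis using C[OF \<alpha> h f r orth] by simp
qed

section \<open>Exact formulas for the two determinants\<close>

lemma integral_half_angle_substitution:
  fixes P :: "real \<Rightarrow> real"
  assumes \<alpha>: "0 \<le> \<alpha>" "\<alpha> \<le> pi" and g: "g = cos (\<alpha> / 2)" and P: "continuous_on {- g..g} P"
  shows "integral {\<alpha>..2 * pi - \<alpha>} (\<lambda>\<theta>. P (cos (\<theta> / 2)) * sin (\<theta> / 2)) = 2 * integral {- g..g} P"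
proof -
  have e: "(2 * pi - \<alpha>) / 2 = pi - \<alpha> / 2" by simp
  have g0: "g \<ge> 0" unfolding g using \<alpha> by (intro cos_ge_zero) auto
  have range: "- cos (\<theta> / 2) \<in> {- g..g}" if "\<theta> \<in> {\<alpha>..2 * pi - \<alpha>}" for \<theta>
  proof -
    have "cos (\<theta> / 2) \<le> cos (\<alpha> / 2)" using that \<alpha> by (intro cos_monotone_0_pi_le) auto
    moreover have "cos (pi - \<alpha> / 2) \<le> cos (\<theta> / 2)" using that \<alpha> by (intro cos_monotone_0_pi_le) auto
    ultimately show ?thesis by (simp add: g)
  qed
  \<comment> \<open>The increasing function - cos (\<theta> / 2) is substituted; a reflection of the
    interval then removes the sign.\<close>
  have "((\<lambda>\<theta>. (sin (\<theta> / 2) / 2) *\<^sub>R (\<lambda>y. P (- y)) (- cos (\<theta> / 2))) has_integral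
     integral {- cos (\<alpha> / 2)..- cos ((2 * pi - \<alpha>) / 2)} (\<lambda>y. P (- y))) {\<alpha>..2 * pi - \<alpha>}"
  proof (rule has_integral_substitution[where c = "- g" and d = g])
    show "- cos (\<alpha> / 2) \<le> - cos ((2 * pi - \<alpha>) / 2)" unfolding e using g0 by (simp add: g)
    show "(\<lambda>\<theta>. - cos (\<theta> / 2)) ` {\<alpha>..2 * pi - \<alpha>} \<subseteq> {- g..g}" using range by blast
    show "continuous_on {- g..g} (\<lambda>y. P (- y))"
      by (rule continuous_on_compose2[OF P]) (auto intro!: continuous_intros)
  qed (use \<alpha> in \<open>auto intro!: derivative_eq_intros\<close>)
  hence "((\<lambda>\<theta>. 2 * (P (cos (\<theta> / 2)) * sin (\<theta> / 2) / 2)) has_integral 2 * integral {- g..g} (\<lambda>y. P (- y))) {\<alpha>..2 * pi - \<alpha>}"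
    unfolding e by (intro has_integral_mult_right) (simp add: g mult.commute)
  moreover have "integral {- g..g} (\<lambda>y. P (- y)) = integral {- g..g} P"
    using Henstock_Kurzweil_Integration.integral_reflect_real[of g "- g" P] by simp
  ultimately show ?thesis by (simp add: integral_unique)
qed

lemma prod_telescope_step2:
  fixes u :: "nat \<Rightarrow> real"
  assumes "\<And>k. u k \<noteq> 0" "u 0 = 1" "u 1 = 1"
  shows "(\<Prod>k<n. if even (k + n) then u (k + 2) / u k else 1) = u n"
proof (induction n rule: nat_induct_step2)
  case (step n)
  have "(\<Prod>k<n + 2. if even (k + (n + 2)) then u (k + 2) / u k else 1) =
    (\<Prod>k<n. if even (k + n) then u (k + 2) / u k else 1) * (u (n + 2) / u n)"
    by (simp add: add_2_eq_Suc')
  thus ?case unfolding step using assms(1)[of n] by simp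
qed (use assms in simp_all)

text \<open>From k = 2 on, each Uvarov norm is the Legendre norm two indices lower times a quotient
  of functions of the second kind. The quotients telescope in steps of two, and the lowered indices
  fill exactly the gaps between the unchanged norms.\<close>

lemma prod_uvarov_norm:
  assumes "\<And>k. legendre_Q g k \<noteq> 0"
  shows "(\<Prod>k<Suc n. if even (k + Suc n) then legendre_norm g k else uvarov_norm g k) = (\<Prod>k<n. legendre_norm g k) * legendre_Q g n"
proof (induction n rule: nat_induct_step2)
  case (step n)
  have "(\<Prod>k<Suc (n + 2). if even (k + Suc (n + 2)) then legendre_norm g k else uvarov_norm g k) =
     (\<Prod>k<Suc n. if even (k + Suc n) then legendre_norm g k else uvarov_norm g k) * legendre_norm g (Suc n) * uvarov_norm g (n + 2)"
    by (simp add: add_2_eq_Suc')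
  also have "\<dots> = (\<Prod>k<n. legendre_norm g k) * legendre_Q g n * legendre_norm g (Suc n) * (legendre_norm g n * (legendre_Q g (n + 2) / legendre_Q g n))"
    unfolding step by (simp add: uvarov_norm_def)
  also have "\<dots> = (\<Prod>k<n + 2. legendre_norm g k) * legendre_Q g (n + 2)"
    using assms[of n] by (simp add: add_2_eq_Suc' mult_ac)
  finally show ?case .
qed (simp_all add: uvarov_norm_def)

lemma half_angle_range:
  assumes \<alpha>: "0 < \<alpha>" "\<alpha> < pi"
  shows "0 < cos (\<alpha> / 2)" "cos (\<alpha> / 2) < 1"
    "\<And>\<theta>. \<theta> \<in> {\<alpha>..2 * pi - \<alpha>} \<Longrightarrow> sin (\<theta> / 2) > 0"
proof -
  show "0 < cos (\<alpha> / 2)" using \<alpha> by (intro cos_gt_zero) auto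
  have "cos (\<alpha> / 2) < cos 0" using \<alpha> by (intro cos_monotone_0_pi) auto
  thus "cos (\<alpha> / 2) < 1" by simp
  show "sin (\<theta> / 2) > 0" if "\<theta> \<in> {\<alpha>..2 * pi - \<alpha>}" for \<theta>
    using that \<alpha> by (intro sin_gt_zero) auto
qed

text \<open>The weight \<open>w\<close> is what remains of \<open>h\<close> after one factor sin
  (\<theta> / 2) has gone into the differential of cos (\<theta> / 2), with \<epsilon> = 1 for the
  indices carrying the extra sin^2. The factor 1 / pi per norm is the 2 of the substitution over 2
  pi.\<close>

lemma toeplitz_det_weights:
  assumes n: "n \<ge> 1" and \<alpha>: "0 < \<alpha>" "\<alpha> < pi" and g: "g = cos (\<alpha> / 2)"
    and h: "continuous_on {\<alpha>..2 * pi - \<alpha>} h" "\<And>\<theta>. h (2 * pi - \<theta>) = h \<theta>"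
    and f: "\<And>\<theta>. f \<theta> = (if \<alpha> \<le> \<theta> \<and> \<theta> \<le> 2 * pi - \<alpha> then of_real (h \<theta>) else 0)"
    and w: "\<And>\<epsilon> \<theta>. \<theta> \<in> {\<alpha>..2 * pi - \<alpha>} \<Longrightarrow> (sin (\<theta> / 2))\<^sup>2 ^ \<epsilon> * h \<theta> = w \<epsilon> (cos (\<theta> / 2)) * sin (\<theta> / 2)"
    and wc: "\<And>\<epsilon>. continuous_on {- g..g} (w \<epsilon>)"
    and N: "\<And>k. orthogonal_norm g (w (if even (k + n) then 1 else 0)) k (N k)"
  shows "toeplitz_det (n - 1) f = of_real (2 ^ (n * (n - 1)) / pi ^ n * (\<Prod>k<n. N k))"
proof -
  obtain r where r: "\<And>k. monic_parity k (r k)"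
    "\<And>k l. l \<le> k \<Longrightarrow> even (k + l) \<Longrightarrow>
      integral {- g..g} (\<lambda>x. poly (r k) x * x ^ l * w (if even (k + n) then 1 else 0) x) = (if l = k then N k else 0)"
    using N unfolding orthogonal_norm_def by metis
  have "toeplitz_det (n - 1) f = of_real (2 ^ (n * (n - 1)) * (\<Prod>k<n. N k / pi))"
  proof (rule toeplitz_det_eq_prod_norms[OF n _ _ h f, where r = r])
    fix k l assume kl: "k < n" "l \<le> k" "even (k + l)"
    define \<epsilon> :: nat where "\<epsilon> = (if even (k + n) then 1 else 0)"
    have "integral {\<alpha>..2 * pi - \<alpha>} (\<lambda>\<theta>. poly (r k) (cos (\<theta> / 2)) * cos (\<theta> / 2) ^ l * (sin (\<theta> / 2))\<^sup>2 ^ \<epsilon> * h \<theta>) =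
      integral {\<alpha>..2 * pi - \<alpha>} (\<lambda>\<theta>. (\<lambda>x. poly (r k) x * x ^ l * w \<epsilon> x) (cos (\<theta> / 2)) * sin (\<theta> / 2))"
    proof (rule integral_cong)
      fix \<theta> assume "\<theta> \<in> {\<alpha>..2 * pi - \<alpha>}"
      from w[OF this, of \<epsilon>]
      show "poly (r k) (cos (\<theta> / 2)) * cos (\<theta> / 2) ^ l * (sin (\<theta> / 2))\<^sup>2 ^ \<epsilon> * h \<theta> =
        (\<lambda>x. poly (r k) x * x ^ l * w \<epsilon> x) (cos (\<theta> / 2)) * sin (\<theta> / 2)"
        by (simp only: mult.assoc)
    qed
    also have "\<dots> = 2 * integral {- g..g} (\<lambda>x. poly (r k) x * x ^ l * w \<epsilon> x)"
      using \<alpha> by (intro integral_half_angle_substitution[OF _ _ g] continuous_intros wc) auto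
    also have "\<dots> = 2 * (if l = k then N k else 0)"
      using r(2)[OF kl(2,3)] by (simp only: \<epsilon>_def)
    finally show "1 / (2 * pi) * integral {\<alpha>..2 * pi - \<alpha>} (\<lambda>\<theta>. poly (r k) (cos (\<theta> / 2)) * cos (\<theta> / 2) ^ l *
        (sin (\<theta> / 2))\<^sup>2 ^ (if even (k + n) then 1 else 0) * h \<theta>) = (if l = k then N k / pi else 0)"
      unfolding \<epsilon>_def[symmetric] by simp
  qed (use \<alpha> r(1) in auto)
  also have "(\<Prod>k<n. N k / pi) = (\<Prod>k<n. N k) / pi ^ n"
    by (simp add: prod_dividef)
  finally show ?thesis by simp
qed

lemma sin_half_reflect: "sin ((2 * pi - \<theta>) / 2) = sin (\<theta> / 2)"
proof -
  have "(2 * pi - \<theta>) / 2 = pi - \<theta> / 2" by simp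
  thus ?thesis by (simp only: sin_pi_minus)
qed

text \<open>Here the weights are 1 and 1 - x^2, so every second norm is Christoffel's, and the
  quotients of the values at 1 telescope to the value of degree n.\<close>

lemma toeplitz_det_f1:
  assumes n: "n \<ge> 1" and \<alpha>: "0 < \<alpha>" "\<alpha> < pi" and g: "g = cos (\<alpha> / 2)"
  shows "toeplitz_det (n - 1) (f1 \<alpha>) =
    of_real (2 ^ (n * (n - 1)) / pi ^ n * ((\<Prod>k<n. legendre_norm g k) * poly (legendre g n) 1))"
proof -
  note g01 = half_angle_range(1,2)[OF \<alpha>, folded g]
  define u where "u = (\<lambda>k. poly (legendre g k) 1)"
  have u0: "u k \<noteq> 0" for k using poly_legendre_1_pos[OF g01, of k] by (simp add: u_def)
  have "toeplitz_det (n - 1) (f1 \<alpha>) = of_real (2 ^ (n * (n - 1)) / pi ^ n *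
     (\<Prod>k<n. if even (k + n) then legendre_norm g k * (u (k + 2) / u k) else legendre_norm g k))"
  proof (rule toeplitz_det_weights[OF n \<alpha> g, where h = "\<lambda>\<theta>. sin (\<theta> / 2)" and w = "\<lambda>\<epsilon> x. (1 - x\<^sup>2) ^ \<epsilon>"])
    show "orthogonal_norm g ((\<lambda>x. (1 - x\<^sup>2) ^ (if even (k + n) then 1 else 0))) k
        (if even (k + n) then legendre_norm g k * (u (k + 2) / u k) else legendre_norm g k)" for k
      using orthogonal_norm_christoffel[OF g01, of k] orthogonal_norm_legendre[of g k] g01 by (simp add: u_def)
  qed (auto simp: sin_half_reflect[simplified] f1_def sin_squared_eq intro!: continuous_intros)
  also have "(\<Prod>k<n. if even (k + n) then legendre_norm g k * (u (k + 2) / u k) else legendre_norm g k) =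
     (\<Prod>k<n. legendre_norm g k * (if even (k + n) then u (k + 2) / u k else 1))"
    by (intro prod.cong) auto
  also have "\<dots> = (\<Prod>k<n. legendre_norm g k) * u n"
    unfolding prod.distrib
    by (subst prod_telescope_step2[of u]) (use u0 in \<open>auto simp: u_def poly_legendre_1\<close>)
  finally show ?thesis by (simp add: u_def)
qed

text \<open>Here the weights are 1 / (1 - x^2) and 1. The matrix has size m + 1, but the function of
  the second kind has degree m.\<close>

lemma toeplitz_det_f2:
  assumes \<alpha>: "0 < \<alpha>" "\<alpha> < pi" and g: "g = cos (\<alpha> / 2)"
  shows "toeplitz_det m (f2 \<alpha>) =
    of_real (2 ^ (Suc m * m) / pi ^ Suc m * ((\<Prod>k<m. legendre_norm g k) * legendre_Q g m))"
proof -
  note g01 = half_angle_range(1,2)[OF \<alpha>, folded g]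
  have nz: "1 - x\<^sup>2 \<noteq> 0" if "x \<in> {- g..g}" for x
    using that g01 by (auto simp: power2_eq_1_iff)
  have "toeplitz_det (Suc m - 1) (f2 \<alpha>) = of_real (2 ^ (Suc m * (Suc m - 1)) / pi ^ Suc m *
     (\<Prod>k<Suc m. if even (k + Suc m) then legendre_norm g k else uvarov_norm g k))"
  proof (rule toeplitz_det_weights[OF _ \<alpha> g, where h = "\<lambda>\<theta>. 1 / sin (\<theta> / 2)" and w = "\<lambda>\<epsilon> x. (1 - x\<^sup>2) ^ \<epsilon> / (1 - x\<^sup>2)"])
    show "orthogonal_norm g ((\<lambda>x. (1 - x\<^sup>2) ^ (if even (k + Suc m) then 1 else 0) / (1 - x\<^sup>2))) k
        (if even (k + Suc m) then legendre_norm g k else uvarov_norm g k)" for k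
    proof (cases "even (k + Suc m)")
      case True
      have "integral {- g..g} (\<lambda>x. poly r x * x ^ l * ((1 - x\<^sup>2) / (1 - x\<^sup>2))) = integral {- g..g} (\<lambda>x. poly r x * x ^ l * 1)" for r l
        by (rule integral_cong) (use nz in simp)
      thus ?thesis using orthogonal_norm_legendre[of g k] g01 True unfolding orthogonal_norm_def by simp
    next
      case False
      thus ?thesis using orthogonal_norm_uvarov[OF g01, of k] by simp
    qed
    show "continuous_on {\<alpha>..2 * pi - \<alpha>} (\<lambda>\<theta>. 1 / sin (\<theta> / 2))"
      using half_angle_range(3)[OF \<alpha>] by (intro continuous_intros) fastforce+
    show "continuous_on {- g..g} (\<lambda>x. (1 - x\<^sup>2) ^ \<epsilon> / (1 - x\<^sup>2))" for \<epsilon>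
      using nz by (intro continuous_intros) auto
    show "(sin (\<theta> / 2))\<^sup>2 ^ \<epsilon> * (1 / sin (\<theta> / 2)) = (1 - (cos (\<theta> / 2))\<^sup>2) ^ \<epsilon> / (1 - (cos (\<theta> / 2))\<^sup>2) * sin (\<theta> / 2)"
      if "\<theta> \<in> {\<alpha>..2 * pi - \<alpha>}" for \<epsilon> \<theta>
      using half_angle_range(3)[OF \<alpha> that] unfolding sin_squared_eq[symmetric]
      by (simp add: power2_eq_square)
  qed (auto simp: sin_half_reflect[simplified] f2_def)
  moreover have "legendre_Q g k \<noteq> 0" for k using legendre_Q_pos[OF g01, of k] by simp
  note prod_uvarov_norm[of g m, OF this]
  ultimately show ?thesis by (simp only: diff_Suc_1)
qed

section \<open>The limit for f1\<close>

definition central_quotient :: "nat \<Rightarrow> real" where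
  "central_quotient n = 4 ^ n * fact n ^ 2 / fact (2 * n)"

lemma central_quotient_limit: "(\<lambda>n. central_quotient n / sqrt (real n)) \<longlonglongrightarrow> sqrt pi"
  using central_binomial_asymptotics by (simp add: central_quotient_def)

lemma prod_legendre_norm:
  "(\<Prod>k<n. legendre_norm g k) = (\<Prod>k<n. legendre_factor k) * pi ^ n / 2 ^ (n * (n - 1)) * g ^ (n\<^sup>2)"
proof (induction n)
  case (Suc n)
  have "legendre_norm g n = legendre_factor n * pi / 4 ^ n * g ^ (2 * n + 1)"
  proof -
    have "(16 :: real) ^ n = 4 ^ n * 4 ^ n" by (simp add: power_mult_distrib[symmetric])
    moreover have "(2 :: real) ^ (2 * n + 1) = 2 * 4 ^ n" by (simp add: power_mult)
    ultimately show ?thesis by (simp add: legendre_norm_def legendre_factor_def)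
  qed
  moreover have "(2 :: real) ^ (Suc n * (Suc n - 1)) = 2 ^ (n * (n - 1)) * 4 ^ n"
  proof -
    have "Suc n * (Suc n - 1) = n * (n - 1) + 2 * n" by (cases n) auto
    thus ?thesis by (simp only: power_add power_mult) simp
  qed
  moreover have "g ^ ((Suc n)\<^sup>2) = g ^ (n\<^sup>2) * g ^ (2 * n + 1)"
  proof -
    have "(Suc n)\<^sup>2 = n\<^sup>2 + (2 * n + 1)" by (simp add: power2_eq_square)
    thus ?thesis by (simp only: power_add)
  qed
  ultimately show ?case using Suc.IH by (simp add: field_simps)
qed simp

text \<open>In terms of the classical Legendre polynomial this is g ^ n * P_n(1 / g), by the
  expansion of P_n about 1.\<close>

definition legendre_sum :: "real \<Rightarrow> nat \<Rightarrow> real" where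
  "legendre_sum g n = (\<Sum>k\<le>n. real (n choose k) * real ((n + k) choose k) * g ^ (n - k) * ((1 - g) / 2) ^ k)"

lemma poly_legendre_1_sum: "poly (legendre g n) 1 = central_quotient n / 2 ^ n * legendre_sum g n"
proof -
  have "poly (legendre g n) 1 = (\<Sum>k\<le>n. fact n / fact (2 * n) * (real (n choose k) * (2 * g) ^ (n - k) * (fact (n + k) / fact k) * (1 - g) ^ k))"
    unfolding poly_legendre_1 sum_distrib_left ..
  also have "\<dots> = (\<Sum>k\<le>n. central_quotient n / 2 ^ n * (real (n choose k) * real ((n + k) choose k) * g ^ (n - k) * ((1 - g) / 2) ^ k))"
  proof (intro sum.cong refl)
    fix k assume "k \<in> {..n}"
    hence k: "k \<le> n" by simp
    have b: "real ((n + k) choose k) = fact (n + k) / (fact k * fact n)"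
      by (subst binomial_fact) auto
    have p: "(4 :: real) ^ n = 2 ^ n * (2 ^ (n - k) * 2 ^ k)"
      using k by (simp add: power_mult_distrib[symmetric] flip: power_add)
    show "fact n / fact (2 * n) * (real (n choose k) * (2 * g) ^ (n - k) * (fact (n + k) / fact k) * (1 - g) ^ k) =
      central_quotient n / 2 ^ n * (real (n choose k) * real ((n + k) choose k) * g ^ (n - k) * ((1 - g) / 2) ^ k)"
      unfolding central_quotient_def b p by (simp add: power_mult_distrib power_divide power2_eq_square)
  qed
  finally show ?thesis by (simp add: legendre_sum_def sum_distrib_left)
qed

lemma binomial_times_fact: "real (n choose k) * fact k = (\<Prod>i<k. real n - real i)"
  by (simp add: binomial_gbinomial gbinomial_prod_rev atLeast0LessThan)

lemma binomial_scaled_limit: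
  "(\<lambda>n. real ((n + m) choose k) / real n ^ k) \<longlonglongrightarrow> 1 / fact k"
proof -
  have "(\<lambda>n. (\<Prod>i<k. (real (n + m) - real i) / real n) / fact k) \<longlonglongrightarrow> (\<Prod>i<k. 1) / fact k"
  proof (intro tendsto_intros)
    show "(\<lambda>n. (real (n + m) - real i) / real n) \<longlonglongrightarrow> 1" for i by real_asymp
  qed simp
  moreover have "(\<Prod>i<k. (real (n + m) - real i) / real n) / fact k = real ((n + m) choose k) / real n ^ k" for n
    unfolding prod_dividef binomial_times_fact[symmetric] by simp
  ultimately show ?thesis by simp
qed

lemma binomial_le_power: "real (n choose k) \<le> real n ^ k / fact k"
proof (cases "k \<le> n")
  case True
  have "(\<Prod>i<k. real n - real i) \<le> (\<Prod>i<k. real n)"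
    using True by (intro prod_mono) auto
  thus ?thesis by (simp add: binomial_times_fact[symmetric] field_simps)
qed (simp add: binomial_eq_0)

lemma one_minus_cos_le: "1 - cos x \<le> x\<^sup>2 / (2::real)"
proof -
  have "1 - cos x = 2 * (sin (x / 2))\<^sup>2" using cos_double_sin[of "x / 2"] by simp
  also have "(sin (x / 2))\<^sup>2 \<le> (x / 2)\<^sup>2"
    using abs_sin_x_le_abs_x[of "x / 2"] by (simp only: abs_le_square_iff)
  finally show ?thesis by (simp add: power2_eq_square)
qed

text \<open>Mehler-Heine asymptotics by Tannery's theorem: for fixed k the two binomials together
  grow like n ^ (2 k) / (k!)^2, and (1 - cos (s / n)) / 2 decays like s^2 / (4 n^2). The limit is
  the power series of \<open>I\<^sub>0(s)\<close>.\<close>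

lemma legendre_sum_limit:
  fixes s :: real
  assumes s: "s > 0"
  shows "(\<lambda>n. legendre_sum (cos (s / real n)) n) \<longlonglongrightarrow> (\<Sum>k. (s / 2) ^ (2 * k) / (fact k)\<^sup>2)"
proof -
  define a where "a = (\<lambda>k n. if k \<le> n then real (n choose k) * real ((n + k) choose k) * cos (s / real n) ^ (n - k) * ((1 - cos (s / real n)) / 2) ^ k else 0)"
  \<comment> \<open>The binomials are at most n ^ k / k! and (2 n) ^ k / k!, and (1 - cos (s / n)) /
    2 is at most s^2 / (4 n^2); one of the two factorials is then given away to arrive at an
    exponential series.\<close>
  define M where "M = (\<lambda>k. (s\<^sup>2 / 2) ^ k / fact k)"
  have bd: "norm (a k n) \<le> M k" if n: "n \<ge> 1" for k n
  proof (cases "k \<le> n")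
    case True
    define c where "c = cos (s / real n)"
    have b1: "real (n choose k) \<le> real n ^ k / fact k" by (rule binomial_le_power)
    have "real ((n + k) choose k) \<le> real (n + k) ^ k / fact k" by (rule binomial_le_power)
    also have "\<dots> \<le> (2 * real n) ^ k / fact k"
      using True by (intro divide_right_mono power_mono) auto
    finally have b2: "real ((n + k) choose k) \<le> (2 * real n) ^ k / fact k" .
    have c0: "0 \<le> (1 - c) / 2" by (simp add: c_def)
    have "(1 - c) / 2 \<le> s\<^sup>2 / (4 * real n ^ 2)"
      using one_minus_cos_le[of "s / real n"] by (simp add: c_def power_divide)
    hence b3: "((1 - c) / 2) ^ k \<le> (s\<^sup>2 / (4 * real n ^ 2)) ^ k" by (rule power_mono[OF _ c0])
    have b4: "\<bar>c\<bar> ^ (n - k) \<le> 1" by (intro power_le_one) (auto simp: c_def)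
    have "norm (a k n) = real (n choose k) * real ((n + k) choose k) * \<bar>c\<bar> ^ (n - k) * ((1 - c) / 2) ^ k"
      using True c0 unfolding a_def c_def[symmetric] by (simp add: abs_mult power_abs)
    also have "\<dots> \<le> (real n ^ k / fact k) * ((2 * real n) ^ k / fact k) * 1 * (s\<^sup>2 / (4 * real n ^ 2)) ^ k"
      using c0 by (intro mult_mono b1 b2 b3 b4) auto
    also have "\<dots> = (s\<^sup>2 / 2) ^ k / fact k / fact k"
    proof -
      have "real n ^ k * (2 * real n) ^ k * (s\<^sup>2 / (4 * real n ^ 2)) ^ k = (real n * (2 * real n) * (s\<^sup>2 / (4 * real n ^ 2))) ^ k"
        by (simp only: power_mult_distrib)
      also have "real n * (2 * real n) * (s\<^sup>2 / (4 * real n ^ 2)) = s\<^sup>2 / 2"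
        using n by (simp add: power2_eq_square)
      finally show ?thesis by simp
    qed
    also have "\<dots> \<le> (s\<^sup>2 / 2) ^ k / fact k / 1"
      by (intro divide_left_mono) auto
    finally show ?thesis by (simp add: M_def)
  qed (simp add: a_def M_def)
  have lim: "(a k \<longlongrightarrow> (s / 2) ^ (2 * k) / (fact k)\<^sup>2) sequentially" for k
  proof -
    have "(\<lambda>n. cos (s / real n) ^ n) \<longlonglongrightarrow> 1"
    proof -
      have "(\<lambda>n. exp (real n * ln (cos (s / real n)))) \<longlonglongrightarrow> 1" by real_asymp
      moreover have "eventually (\<lambda>n. cos (s / real n) > 0) sequentially" by real_asymp
      hence "eventually (\<lambda>n. exp (real n * ln (cos (s / real n))) = cos (s / real n) ^ n) sequentially"
        by eventually_elim (simp add: exp_of_nat_mult)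
      ultimately show ?thesis by (rule Lim_transform_eventually)
    qed
    moreover have "(\<lambda>n. cos (s / real n)) \<longlonglongrightarrow> 1" by real_asymp
    moreover have "(\<lambda>n. real n ^ 2 * ((1 - cos (s / real n)) / 2)) \<longlonglongrightarrow> s * s / 4" by real_asymp
    ultimately have "(\<lambda>n. real ((n + 0) choose k) / real n ^ k * (real ((n + k) choose k) / real n ^ k) *
        (cos (s / real n) ^ n / cos (s / real n) ^ k) * (real n ^ 2 * ((1 - cos (s / real n)) / 2)) ^ k)
       \<longlonglongrightarrow> 1 / fact k * (1 / fact k) * (1 / 1 ^ k) * (s * s / 4) ^ k"
      by (intro tendsto_mult tendsto_divide tendsto_power binomial_scaled_limit) auto
    moreover have "eventually (\<lambda>n. real ((n + 0) choose k) / real n ^ k * (real ((n + k) choose k) / real n ^ k) *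
        (cos (s / real n) ^ n / cos (s / real n) ^ k) * (real n ^ 2 * ((1 - cos (s / real n)) / 2)) ^ k = a k n) sequentially"
    proof -
      have "eventually (\<lambda>n. cos (s / real n) > 0) sequentially" by real_asymp
      thus ?thesis using eventually_ge_at_top[of k] eventually_gt_at_top[of 0]
      proof eventually_elim
        case (elim n)
        have "cos (s / real n) ^ n / cos (s / real n) ^ k = cos (s / real n) ^ (n - k)"
          using elim by (simp add: power_diff)
        moreover have "(real n ^ 2 * ((1 - cos (s / real n)) / 2)) ^ k = real n ^ k * real n ^ k * ((1 - cos (s / real n)) / 2) ^ k"
          by (simp only: power_mult_distrib power2_eq_square)
        ultimately show ?case using elim by (simp add: a_def)
      qed
    qed
    ultimately have "(a k \<longlongrightarrow> 1 / fact k * (1 / fact k) * (1 / 1 ^ k) * (s * s / 4) ^ k) sequentially"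
      by (rule Lim_transform_eventually)
    also have "1 / fact k * (1 / fact k) * (1 / 1 ^ k) * (s * s / 4) ^ k = (s / 2) ^ (2 * k) / (fact k)\<^sup>2"
      by (simp add: power_mult power_divide power2_eq_square)
    finally show ?thesis .
  qed
  have "eventually (\<lambda>n. suminf (\<lambda>k. a k n) = legendre_sum (cos (s / real n)) n) sequentially"
  proof (intro always_eventually allI)
    fix n
    have "suminf (\<lambda>k. a k n) = (\<Sum>k\<le>n. a k n)"
      by (rule suminf_finite) (auto simp: a_def)
    thus "suminf (\<lambda>k. a k n) = legendre_sum (cos (s / real n)) n"
      by (simp add: legendre_sum_def a_def)
  qed
  moreover have "(\<lambda>n. suminf (\<lambda>k. a k n)) \<longlonglongrightarrow> (\<Sum>k. (s / 2) ^ (2 * k) / (fact k)\<^sup>2)"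
  proof -
    have ev: "eventually (\<lambda>(k, n). norm (a k n) \<le> M k) (sequentially \<times>\<^sub>F sequentially)"
      unfolding eventually_prod_filter
      by (rule exI[of _ "\<lambda>_. True"], rule exI[of _ "\<lambda>n. n \<ge> 1"]) (use bd in \<open>auto intro: eventually_ge_at_top\<close>)
    have sm: "summable M"
      unfolding M_def using summable_exp[of "s\<^sup>2 / 2"] by (simp only: divide_inverse mult.commute)
    show ?thesis
      using tannerys_theorem[OF lim ev sm sequentially_bot] by (elim conjE)
  qed
  ultimately show ?thesis by (rule Lim_transform_eventually[rotated])
qed

lemma bessel_J_imaginary:
  "bessel_J 0 (\<i> * complex_of_real s) = of_real (\<Sum>k. (s / 2) ^ (2 * k) / (fact k)\<^sup>2)"
proof -
  have sm: "summable (\<lambda>k. (s / 2) ^ (2 * k) / (fact k)\<^sup>2)"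
  proof (rule summable_comparison_test')
    show "summable (\<lambda>k. ((s / 2)\<^sup>2) ^ k / fact k)"
      using summable_exp[of "(s / 2)\<^sup>2"] by (simp only: divide_inverse mult.commute)
    show "norm ((s / 2) ^ (2 * k) / (fact k)\<^sup>2) \<le> ((s / 2)\<^sup>2) ^ k / fact k" if "k \<ge> 0" for k
    proof -
      have "(fact k :: real) \<le> fact k * fact k" by simp
      hence "((s / 2)\<^sup>2) ^ k / (fact k * fact k) \<le> ((s / 2)\<^sup>2) ^ k / fact k"
        by (intro divide_left_mono) auto
      thus ?thesis by (simp add: power_mult power2_eq_square)
    qed
  qed
  have "(- 1) ^ k / (fact k * fact (k + 0)) * (\<i> * complex_of_real s / 2) ^ (2 * k + 0) = of_real ((s / 2) ^ (2 * k) / (fact k)\<^sup>2)" for k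
  proof -
    have "(\<i> * complex_of_real s / 2) ^ (2 * k) = (- 1) ^ k * of_real (s / 2) ^ (2 * k)"
    proof -
      have e: "\<i> * complex_of_real s / 2 = \<i> * of_real (s / 2)" by simp
      show ?thesis unfolding e power_mult_distrib by (simp only: power_mult power2_i)
    qed
    moreover have "(- 1) ^ k * (- 1) ^ k = (1 :: complex)" by (simp flip: power_mult_distrib)
    ultimately show ?thesis by (simp add: power2_eq_square)
  qed
  thus ?thesis unfolding bessel_J_def using suminf_of_real[OF sm, where ?'a = complex] by simp
qed

text \<open>The square in the exponent matches 1 - cos (s / n) ~ s^2 / (2 n^2). The shift
  \<open>m\<close> is 0 for \<open>f1\<close>; for \<open>f2\<close> it is 1, since the angle is set
  by the size of the matrix and the exponent by the degree.\<close>

lemma cos_power_square_limit: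
  assumes "s > 0"
  shows "(\<lambda>n. cos (s / real (n + m)) ^ (n\<^sup>2)) \<longlonglongrightarrow> exp (- s\<^sup>2 / 2)"
proof -
  have "(\<lambda>n. exp (real n ^ 2 * ln (cos (s / real (n + m))))) \<longlonglongrightarrow> exp (- (s * s / 2))"
    by real_asymp
  moreover have "eventually (\<lambda>n. cos (s / real (n + m)) > 0) sequentially" by real_asymp
  hence "eventually (\<lambda>n. exp (real n ^ 2 * ln (cos (s / real (n + m)))) = cos (s / real (n + m)) ^ (n\<^sup>2)) sequentially"
  proof eventually_elim
    case (elim n)
    thus ?case using exp_of_nat_mult[of "n\<^sup>2" "ln (cos (s / real (n + m)))"] by simp
  qed
  ultimately have "(\<lambda>n. cos (s / real (n + m)) ^ (n\<^sup>2)) \<longlonglongrightarrow> exp (- (s * s / 2))"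
    by (rule Lim_transform_eventually)
  thus ?thesis by (simp add: power2_eq_square)
qed

text \<open>The exact formula is regrouped into convergent factors. The product of norms brings n
  powr (- 1 / 4), \<open>central_quotient\<close> brings sqrt (pi * n), and the monic normalisation
  leaves 2 ^ (- n).\<close>

lemma toeplitz_det_f1_limit:
  assumes s: "s > 0" and c: "(\<lambda>n. (\<Prod>k<n. legendre_factor k) * real n powr (1 / 4)) \<longlonglongrightarrow> c"
  shows "(\<lambda>n. toeplitz_det (n - 1) (f1 (2 * s / real n)) / (1 / 2 ^ n * of_real (real n powr (1 / 4))))
    \<longlonglongrightarrow> of_real (c * sqrt pi * exp (- s\<^sup>2 / 2)) * bessel_J 0 (\<i> * of_real s)"
proof -
  define L where "L = (\<lambda>n. \<Prod>k<n. legendre_factor k)"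
  have "(\<lambda>n. complex_of_real ((L n * real n powr (1 / 4)) * (central_quotient n / sqrt (real n)) * cos (s / real (n + 0)) ^ (n\<^sup>2) * legendre_sum (cos (s / real n)) n))
    \<longlonglongrightarrow> of_real (c * sqrt pi * exp (- s\<^sup>2 / 2) * (\<Sum>k. (s / 2) ^ (2 * k) / (fact k)\<^sup>2))"
    unfolding L_def by (intro tendsto_intros c central_quotient_limit cos_power_square_limit legendre_sum_limit s)
  moreover have "eventually (\<lambda>n. complex_of_real ((L n * real n powr (1 / 4)) * (central_quotient n / sqrt (real n)) * cos (s / real (n + 0)) ^ (n\<^sup>2) * legendre_sum (cos (s / real n)) n)
     = toeplitz_det (n - 1) (f1 (2 * s / real n)) / (1 / 2 ^ n * of_real (real n powr (1 / 4)))) sequentially"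
  proof -
    have "eventually (\<lambda>n. 2 * s / real n < pi) sequentially" using s by real_asymp
    thus ?thesis using eventually_gt_at_top[of 0]
    proof eventually_elim
      case (elim n)
      define g where "g = cos (2 * s / real n / 2)"
      have g: "g = cos (s / real n)" by (simp add: g_def)
      have "toeplitz_det (n - 1) (f1 (2 * s / real n)) =
        of_real (2 ^ (n * (n - 1)) / pi ^ n * ((\<Prod>k<n. legendre_norm g k) * poly (legendre g n) 1))"
        using elim s by (intro toeplitz_det_f1 g_def) auto
      also have "2 ^ (n * (n - 1)) / pi ^ n * ((\<Prod>k<n. legendre_norm g k) * poly (legendre g n) 1) =
         L n * g ^ (n\<^sup>2) * (central_quotient n / 2 ^ n * legendre_sum g n)"
        unfolding prod_legendre_norm poly_legendre_1_sum L_def by simp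
      finally have D: "toeplitz_det (n - 1) (f1 (2 * s / real n)) = of_real \<dots>" .
      have "real n powr (1 / 4) * real n powr (1 / 4) = sqrt (real n)"
        using elim by (simp flip: powr_add) (simp add: powr_half_sqrt)
      hence "real n powr (1 / 4) / sqrt (real n) = 1 / real n powr (1 / 4)"
        using elim by (simp add: field_simps)
      have "(L n * real n powr (1 / 4)) * (central_quotient n / sqrt (real n)) * cos (s / real (n + 0)) ^ (n\<^sup>2) * legendre_sum (cos (s / real n)) n
        = L n * central_quotient n * g ^ (n\<^sup>2) * legendre_sum g n * (real n powr (1 / 4) / sqrt (real n))"
        by (simp add: g)
      also have "\<dots> = L n * central_quotient n * g ^ (n\<^sup>2) * legendre_sum g n * (1 / real n powr (1 / 4))"
        by (simp only: \<open>real n powr (1 / 4) / sqrt (real n) = 1 / real n powr (1 / 4)\<close>)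
      also have "\<dots> = L n * g ^ (n\<^sup>2) * (central_quotient n / 2 ^ n * legendre_sum g n) / (1 / 2 ^ n * real n powr (1 / 4))"
        by simp
      finally show ?case unfolding D by simp
    qed
  qed
  ultimately have "(\<lambda>n. toeplitz_det (n - 1) (f1 (2 * s / real n)) / (1 / 2 ^ n * of_real (real n powr (1 / 4))))
    \<longlonglongrightarrow> of_real (c * sqrt pi * exp (- s\<^sup>2 / 2) * (\<Sum>k. (s / 2) ^ (2 * k) / (fact k)\<^sup>2))"
    by (rule Lim_transform_eventually)
  thus ?thesis by (simp only: bessel_J_imaginary of_real_mult)
qed

section \<open>The limit for f2\<close>

text \<open>In terms of the modified Bessel function, \<open>macdonald s = 2 K\<^sub>0(s)\<close>.\<close>

definition macdonald :: "real \<Rightarrow> real" where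
  "macdonald s = (LBINT u:{0<..}. exp (- u - s\<^sup>2 / (4 * u)) / u)"

definition legendre_Q_kernel :: "real \<Rightarrow> nat \<Rightarrow> real \<Rightarrow> real" where
  "legendre_Q_kernel g m u = indicator {0..real m * g} u *
     (((g - u / real m) * (u / (u + real m * (1 - g) / 2))) ^ m / (u + real m * (1 - g) / 2))"

text \<open>The substitution \<open>x = g - 2 u / m\<close>, which magnifies the neighbourhood of the endpoint.\<close>

lemma legendre_Q_kernel_integral:
  assumes g: "0 < g" "g < 1" and m: "m \<ge> 1"
  shows "integral {- g..g} (\<lambda>x. (g\<^sup>2 - x\<^sup>2) ^ m / (1 - x) ^ Suc m) = 2 ^ m * (LBINT u. legendre_Q_kernel g m u)"
proof -
  define G where "G = (\<lambda>x. (g\<^sup>2 - x\<^sup>2) ^ m / (1 - x) ^ Suc m)"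
  have nz: "(1 - x) ^ Suc m \<noteq> 0" if "x \<in> {- g..g}" for x using that g by auto
  have "continuous_on {- g..g} G"
    unfolding G_def using nz by (intro continuous_intros) blast
  hence "set_integrable lborel {- g..g} G" by (rule borel_integrable_atLeastAtMost')
  hence "integral {- g..g} G = (LBINT x. indicator {- g..g} x *\<^sub>R G x)"
    by (subst set_borel_integral_eq_integral(2)[symmetric]) (simp_all add: set_lebesgue_integral_def)
  also have "\<dots> = \<bar>- 2 / real m\<bar> *\<^sub>R (LBINT u. indicator {- g..g} (g + (- 2 / real m) * u) *\<^sub>R G (g + (- 2 / real m) * u))"
    using m by (intro lborel_integral_real_affine) auto
  also have "\<dots> = (LBINT u. 2 ^ m * legendre_Q_kernel g m u)"
    unfolding integral_scaleR_right[symmetric]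
  proof (intro Bochner_Integration.integral_cong refl)
    fix u :: real
    have m0: "real m > 0" using m by simp
    have "(g + (- 2 / real m) * u \<in> {- g..g}) = (u \<in> {0..real m * g})"
    proof -
      have "g + (- 2 / real m) * u \<le> g \<longleftrightarrow> 0 \<le> u" using m0 by (simp add: zero_le_divide_iff zero_le_mult_iff)
      moreover have "- g \<le> g + (- 2 / real m) * u \<longleftrightarrow> u \<le> real m * g" using m0 by (simp add: field_simps)
      ultimately show ?thesis by auto
    qed
    hence ind: "indicator {- g..g} (g + (- 2 / real m) * u) = (indicator {0..real m * g} u :: real)"
      by (simp add: indicator_def)
    show "\<bar>- 2 / real m\<bar> *\<^sub>R (indicator {- g..g} (g + (- 2 / real m) * u) *\<^sub>R G (g + (- 2 / real m) * u)) = 2 ^ m * legendre_Q_kernel g m u"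
    proof (cases "u \<in> {0..real m * g}")
      case True
      define D where "D = u + real m * (1 - g) / 2"
      have D: "D > 0" using True g m0 unfolding D_def by (intro add_nonneg_pos) auto
      have x1: "1 - (g + (- 2 / real m) * u) = 2 / real m * D"
        using m0 by (simp add: D_def field_simps)
      have x2: "g\<^sup>2 - (g + (- 2 / real m) * u)\<^sup>2 = (2 / real m) * (2 * ((g - u / real m) * u))"
        using m0 by (simp add: power2_eq_square field_simps)
      have "G (g + (- 2 / real m) * u) = (2 / real m) ^ m * (2 ^ m * ((g - u / real m) * u) ^ m) / ((2 / real m) ^ m * (2 / real m) * (D ^ m * D))"
        unfolding G_def x1 x2 by (simp only: power_Suc2 power_mult_distrib mult_ac)
      also have "\<dots> = 2 ^ m * ((g - u / real m) * u) ^ m / ((2 / real m) * (D ^ m * D))"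
        using m0 by (simp add: field_simps)
      finally have "(2 / real m) * G (g + (- 2 / real m) * u) = 2 ^ m * ((g - u / real m) * u) ^ m / (D ^ m * D)"
        using m0 D by (simp add: field_simps)
      also have "\<dots> = 2 ^ m * (((g - u / real m) * (u / D)) ^ m / D)"
        by (simp add: power_mult_distrib power_divide)
      finally show ?thesis
        unfolding ind legendre_Q_kernel_def D_def[symmetric] using True m0 by simp
    qed (simp only: ind legendre_Q_kernel_def, simp)
  qed
  finally show ?thesis by (simp add: G_def del: power_Suc)
qed

text \<open>With d = m (1 - g) / 2 and u > 0 the kernel is (g - u / m) ^ m * (1 + d / u) ^ (- m) /
  (u + d) on its support. As m d tends to s^2 / 4, the three factors tend to exp (- u), exp (- s^2 /
  (4 u)) and 1 / u, and dominated convergence applies.\<close>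

lemma legendre_Q_kernel_limit:
  assumes s: "s > 0"
  shows "(\<lambda>m. LBINT u. legendre_Q_kernel (cos (s / real (m + 1))) m u) \<longlonglongrightarrow> macdonald s"
proof -
  define g where "g = (\<lambda>m. cos (s / real (m + 1)))"
  define f where "f = (\<lambda>u. indicator {0<..} u *\<^sub>R (exp (- u - s\<^sup>2 / (4 * u)) / u))"
  have "eventually (\<lambda>m. s / real (m + 1) < pi / 2) sequentially" by real_asymp
  \<comment> \<open>The limit of the left-hand side is s^2 / 4; half of it serves as lower bound and
    becomes the constant 8 / s^2 of the majorant.\<close>
  moreover have "eventually (\<lambda>m. real m ^ 2 * (1 - cos (s / real (m + 1))) / 2 > s * s / 8) sequentially"
    using s by real_asymp
  ultimately have "eventually (\<lambda>m. s / real (m + 1) < pi / 2 \<and> real m ^ 2 * (1 - g m) / 2 > s * s / 8 \<and> m \<ge> 1) sequentially"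
    unfolding g_def using eventually_ge_at_top[of 1] by eventually_elim auto
  then obtain M where M: "\<And>m. m \<ge> M \<Longrightarrow> s / real (m + 1) < pi / 2 \<and> real m ^ 2 * (1 - g m) / 2 > s * s / 8 \<and> m \<ge> 1"
    by (auto simp: eventually_at_top_linorder)
  have g: "0 < g m" "g m < 1" if "m \<ge> M" for m
  proof -
    have a: "0 < s / real (m + 1)" "s / real (m + 1) < pi / 2" using s M[OF that] by auto
    show "0 < g m" unfolding g_def using a by (intro cos_gt_zero) auto
    have "cos (s / real (m + 1)) < cos 0" using a pi_gt_zero by (intro cos_monotone_0_pi) linarith+
    thus "g m < 1" by (simp add: g_def)
  qed
  have [measurable]: "legendre_Q_kernel a m \<in> borel_measurable lborel" for a m
    unfolding legendre_Q_kernel_def by measurable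
  have "(\<lambda>i. integral\<^sup>L lborel (legendre_Q_kernel (g (i + M)) (i + M))) \<longlonglongrightarrow> integral\<^sup>L lborel f"
  proof (rule integral_dominated_convergence)
    show "f \<in> borel_measurable lborel" unfolding f_def by measurable
    show "integrable lborel (\<lambda>u. 8 / (s * s) * (indicator {0..} u *\<^sub>R exp (- u)))"
      using integrable.intros[OF has_bochner_integral_I0i_power_exp_m'[of 0]]
      by (intro integrable_mult_right) (simp add: mult.commute)
    show "AE u in lborel. norm (legendre_Q_kernel (g (i + M)) (i + M) u) \<le> 8 / (s * s) * (indicator {0..} u *\<^sub>R exp (- u))" for i
    proof (intro always_eventually allI)
      fix u :: real
      define m where "m = i + M"
      have mM: "m \<ge> M" by (simp add: m_def)
      note gm = g[OF mM]
      have m: "m \<ge> 1" "s * s / 8 < real m ^ 2 * (1 - g m) / 2" using M[OF mM] by auto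
      have "norm (legendre_Q_kernel (g m) m u) \<le> 8 / (s * s) * (indicator {0..} u *\<^sub>R exp (- u))"
      proof (cases "u \<in> {0..real m * g m}")
        case True
        define d where "d = real m * (1 - g m) / 2"
        have d: "d > 0" using gm m by (simp add: d_def)
        have u: "0 \<le> u" "u / real m \<le> g m" "u \<le> real m" using True gm m
          by (auto simp: field_simps intro: order_trans[OF _ mult_left_le])
        have e1: "(g m - u / real m) ^ m \<le> exp (- u)"
        proof -
          have "(g m - u / real m) ^ m \<le> (1 - u / real m) ^ m"
            using gm u by (intro power_mono) auto
          also have "\<dots> \<le> exp (- u / real m) ^ m"
            using exp_ge_add_one_self[of "- u / real m"] u m by (intro power_mono) (auto simp: field_simps)
          also have "\<dots> = exp (- u)" using m by (simp flip: exp_of_nat_mult)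
          finally show ?thesis .
        qed
        have e2: "(u / (u + d)) ^ m / (u + d) \<le> 8 / (s * s)"
        proof (cases "u = 0")
          case False
          hence u0: "u > 0" using u by simp
          \<comment> \<open>Bernoulli's inequality gives (u / (u + d)) ^ m \<le> u / (u + m d). The
            numerator compensates the factor 1 / (u + d), so the bound stays finite when u and d are
            small.\<close>
          have "1 + real m * (d / u) \<le> (1 + d / u) ^ m"
            using d u0 by (intro Bernoulli_inequality order_trans[of "- 1" 0 "d / u"]) auto
          moreover have "u / (u + d) = 1 / (1 + d / u)" using u0 d by (simp add: field_simps)
          moreover have "0 < (1 + d / u) ^ m" using d u0 by (intro zero_less_power add_pos_pos) auto
          ultimately have "(u / (u + d)) ^ m \<le> 1 / (1 + real m * (d / u))"
            using d u0 by (simp add: power_one_over) (intro divide_left_mono mult_pos_pos add_pos_nonneg, auto)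
          also have "\<dots> = u / (u + real m * d)" using u0 by (simp add: field_simps)
          finally have "(u / (u + d)) ^ m / (u + d) \<le> u / (u + real m * d) / (u + d)"
            using u0 d by (intro divide_right_mono) auto
          also have "\<dots> \<le> u / (u + real m * d) / u"
            using u0 d by (intro divide_left_mono) (auto intro!: mult_pos_pos divide_nonneg_nonneg)
          also have "\<dots> = 1 / (u + real m * d)" using u0 by simp
          also have "\<dots> \<le> 1 / (s * s / 8)"
          proof (rule divide_left_mono)
            have "real m * d = real m ^ 2 * (1 - g m) / 2" by (simp add: d_def power2_eq_square)
            thus "s * s / 8 \<le> u + real m * d" using m u0 by simp
            show "0 < (u + real m * d) * (s * s / 8)" using u0 d s by (intro mult_pos_pos add_pos_nonneg) auto
          qed simp
          finally show ?thesis by simp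
        qed (use m s in \<open>simp add: power_0_left\<close>)
        have "norm (legendre_Q_kernel (g m) m u) = (g m - u / real m) ^ m * ((u / (u + d)) ^ m / (u + d))"
          using True u d unfolding legendre_Q_kernel_def d_def[symmetric]
          by (simp add: abs_mult power_abs flip: power_mult_distrib)
        also have "\<dots> \<le> exp (- u) * (8 / (s * s))"
          using u d s by (intro mult_mono e1 e2) auto
        finally show ?thesis using u by (simp add: mult.commute)
      next
        case False
        thus ?thesis using s by (simp add: legendre_Q_kernel_def indicator_def)
      qed
      thus "norm (legendre_Q_kernel (g (i + M)) (i + M) u) \<le> 8 / (s * s) * (indicator {0..} u *\<^sub>R exp (- u))"
        by (simp add: m_def)
    qed
    show "AE u in lborel. (\<lambda>i. legendre_Q_kernel (g (i + M)) (i + M) u) \<longlonglongrightarrow> f u"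
    proof (intro always_eventually allI)
      fix u :: real
      have "(\<lambda>m. legendre_Q_kernel (g m) m u) \<longlonglongrightarrow> f u"
      proof (cases "u > 0")
        case False
        have "eventually (\<lambda>m. legendre_Q_kernel (g m) m u = 0) sequentially"
          using eventually_gt_at_top[of 0]
          by eventually_elim (use False in \<open>auto simp: legendre_Q_kernel_def indicator_def power_0_left\<close>)
        thus ?thesis using False by (simp add: f_def tendsto_eventually)
      next
        case True
        have e: "s * s * inverse u / 4 = s * s / (4 * u)" using True by (simp add: field_simps)
        have "(\<lambda>m. exp (real m * ln (g m - u / real m)) * exp (- (real m * ln (1 + real m * (1 - g m) / 2 / u))) / (u + real m * (1 - g m) / 2))
          \<longlonglongrightarrow> exp (- u) * exp (- (s * s / (4 * u))) / (u + 0)"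
        proof (intro tendsto_mult tendsto_divide tendsto_add tendsto_const)
          show "(\<lambda>m. exp (real m * ln (g m - u / real m))) \<longlonglongrightarrow> exp (- u)"
            unfolding g_def by real_asymp
          have "(\<lambda>m. exp (- (real m * ln (1 + real m * (1 - g m) / 2 / u)))) \<longlonglongrightarrow> exp (- (s * s * inverse u / 4))"
            unfolding g_def using True by real_asymp
          thus "(\<lambda>m. exp (- (real m * ln (1 + real m * (1 - g m) / 2 / u)))) \<longlonglongrightarrow> exp (- (s * s / (4 * u)))"
            by (simp only: e)
          show "(\<lambda>m. real m * (1 - g m) / 2) \<longlonglongrightarrow> 0"
            unfolding g_def by real_asymp
        qed (use True in auto)
        moreover have "eventually (\<lambda>m. exp (real m * ln (g m - u / real m)) * exp (- (real m * ln (1 + real m * (1 - g m) / 2 / u))) / (u + real m * (1 - g m) / 2)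
           = legendre_Q_kernel (g m) m u) sequentially"
        proof -
          have "eventually (\<lambda>m. g m - u / real m > 0) sequentially" unfolding g_def by real_asymp
          thus ?thesis using eventually_ge_at_top[of M] eventually_gt_at_top[of 0]
          proof eventually_elim
            case (elim m)
            define d where "d = real m * (1 - g m) / 2"
            have d: "d > 0" using g[of m] elim by (simp add: d_def)
            have "exp (real m * ln (g m - u / real m)) = (g m - u / real m) ^ m"
              using elim by (simp add: exp_of_nat_mult)
            moreover have "exp (- (real m * ln (1 + d / u))) = (u / (u + d)) ^ m"
            proof -
              have "1 + d / u > 0" using d True by (intro add_pos_pos) auto
              hence "exp (real m * ln (1 + d / u)) = (1 + d / u) ^ m" by (simp add: exp_of_nat_mult)
              moreover have "u / (u + d) = inverse (1 + d / u)" using d True by (simp add: field_simps)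
              ultimately show ?thesis by (simp add: exp_minus power_inverse)
            qed
            moreover have "u \<in> {0..real m * g m}" using elim True by (auto simp: field_simps)
            ultimately show ?case
              unfolding legendre_Q_kernel_def d_def[symmetric] by (simp flip: power_mult_distrib)
          qed
        qed
        ultimately have "(\<lambda>m. legendre_Q_kernel (g m) m u) \<longlonglongrightarrow> exp (- u) * exp (- (s * s / (4 * u))) / (u + 0)"
          by (rule Lim_transform_eventually)
        also have "exp (- u) * exp (- (s * s / (4 * u))) / (u + 0) = f u"
          using True by (simp add: f_def power2_eq_square flip: exp_add)
        finally show ?thesis .
      qed
      thus "(\<lambda>i. legendre_Q_kernel (g (i + M)) (i + M) u) \<longlonglongrightarrow> f u"
        by (rule LIMSEQ_ignore_initial_segment)
    qed
  qed measurable
  hence "(\<lambda>m. integral\<^sup>L lborel (legendre_Q_kernel (g m) m)) \<longlonglongrightarrow> integral\<^sup>L lborel f"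
    by (rule LIMSEQ_offset)
  thus ?thesis unfolding g_def f_def macdonald_def set_lebesgue_integral_def .
qed

text \<open>The sequence is reindexed by n = m + 1. Factors indexed by m then stand against a power
  of m + 1, whence the extra quotient tending to 1, and the remaining 2 ^ m is 2 ^ (n - 1).\<close>

lemma toeplitz_det_f2_limit:
  assumes s: "s > 0" and c: "(\<lambda>n. (\<Prod>k<n. legendre_factor k) * real n powr (1 / 4)) \<longlonglongrightarrow> c"
  shows "(\<lambda>n. toeplitz_det (n - 1) (f2 (2 * s / real n)) / (2 ^ (n - 1) * of_real (real n powr (1 / 4))))
    \<longlonglongrightarrow> of_real (c * sqrt pi * exp (- s\<^sup>2 / 2) * (macdonald s / pi))"
proof -
  define L where "L = (\<lambda>n. \<Prod>k<n. legendre_factor k)"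
  define K where "K = (\<lambda>m. LBINT u. legendre_Q_kernel (cos (s / real (m + 1))) m u)"
  have "(\<lambda>m. complex_of_real ((L m * real m powr (1 / 4)) * (central_quotient m / sqrt (real m)) * cos (s / real (m + 1)) ^ (m\<^sup>2) * (K m / pi) * (real m powr (1 / 4) / real (Suc m) powr (1 / 4))))
    \<longlonglongrightarrow> of_real (c * sqrt pi * exp (- s\<^sup>2 / 2) * (macdonald s / pi) * 1)"
    unfolding L_def K_def
    by (intro tendsto_intros c central_quotient_limit cos_power_square_limit legendre_Q_kernel_limit s) (simp, real_asymp)
  moreover have "eventually (\<lambda>m. complex_of_real ((L m * real m powr (1 / 4)) * (central_quotient m / sqrt (real m)) * cos (s / real (m + 1)) ^ (m\<^sup>2) * (K m / pi) * (real m powr (1 / 4) / real (Suc m) powr (1 / 4)))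
     = toeplitz_det (Suc m - 1) (f2 (2 * s / real (Suc m))) / (2 ^ (Suc m - 1) * of_real (real (Suc m) powr (1 / 4)))) sequentially"
  proof -
    have "eventually (\<lambda>m. 2 * s / real (Suc m) < pi) sequentially" using s by real_asymp
    thus ?thesis using eventually_gt_at_top[of 0]
    proof eventually_elim
      case (elim m)
      define g where "g = cos (2 * s / real (Suc m) / 2)"
      have "2 * s / real (Suc m) / 2 = s / real (m + 1)" by (simp del: of_nat_Suc)
      hence g: "g = cos (s / real (m + 1))" by (simp only: g_def)
      have \<alpha>: "0 < 2 * s / real (Suc m)" using s by simp
      have g01: "0 < g" "g < 1" using half_angle_range(1,2)[OF \<alpha> elim(1)] by (simp_all add: g_def)
      have "toeplitz_det m (f2 (2 * s / real (Suc m))) =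
        of_real (2 ^ (Suc m * m) / pi ^ Suc m * ((\<Prod>k<m. legendre_norm g k) * legendre_Q g m))"
        by (rule toeplitz_det_f2[OF \<alpha> elim(1) g_def])
      also have "2 ^ (Suc m * m) / pi ^ Suc m * ((\<Prod>k<m. legendre_norm g k) * legendre_Q g m) =
         L m * g ^ (m\<^sup>2) * (central_quotient m * K m * 2 ^ m / pi)"
      proof -
        have "legendre_Q g m = central_quotient m / 4 ^ m * (2 ^ m * K m)"
          using g01 elim(2) legendre_Q_kernel_integral[OF g01, of m]
          unfolding legendre_Q_eq[OF less_imp_le[OF g01(1)] g01(2)] K_def g[symmetric] central_quotient_def by simp
        moreover have "(2 :: real) ^ (Suc m * m) = 2 ^ (m * (m - 1)) * 4 ^ m"
        proof -
          have "Suc m * m = m * (m - 1) + 2 * m" by (cases m) auto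
          thus ?thesis by (simp only: power_add power_mult) simp
        qed
        ultimately show ?thesis unfolding prod_legendre_norm L_def by simp
      qed
      finally have D: "toeplitz_det m (f2 (2 * s / real (Suc m))) = of_real \<dots>" .
      have "real m powr (1 / 4) * real m powr (1 / 4) = sqrt (real m)"
        using elim by (simp flip: powr_add) (simp add: powr_half_sqrt)
      hence r: "real m powr (1 / 4) * real m powr (1 / 4) / sqrt (real m) = 1"
        using elim by simp
      have "(L m * real m powr (1 / 4)) * (central_quotient m / sqrt (real m)) * cos (s / real (m + 1)) ^ (m\<^sup>2) * (K m / pi) * (real m powr (1 / 4) / real (Suc m) powr (1 / 4))
        = L m * g ^ (m\<^sup>2) * (central_quotient m * K m / pi) / real (Suc m) powr (1 / 4) * (real m powr (1 / 4) * real m powr (1 / 4) / sqrt (real m))"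
        by (simp add: g mult_ac)
      also have "\<dots> = L m * g ^ (m\<^sup>2) * (central_quotient m * K m * 2 ^ m / pi) / (2 ^ m * real (Suc m) powr (1 / 4))"
        unfolding r by simp
      finally show ?case unfolding diff_Suc_1 D by (simp del: of_nat_Suc)
    qed
  qed
  ultimately have "(\<lambda>m. toeplitz_det (Suc m - 1) (f2 (2 * s / real (Suc m))) / (2 ^ (Suc m - 1) * of_real (real (Suc m) powr (1 / 4))))
    \<longlonglongrightarrow> of_real (c * sqrt pi * exp (- s\<^sup>2 / 2) * (macdonald s / pi) * 1)"
    by (rule Lim_transform_eventually)
  hence "(\<lambda>n. toeplitz_det (n - 1) (f2 (2 * s / real n)) / (2 ^ (n - 1) * of_real (real n powr (1 / 4))))
    \<longlonglongrightarrow> of_real (c * sqrt pi * exp (- s\<^sup>2 / 2) * (macdonald s / pi) * 1)"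
    by (rule LIMSEQ_imp_Suc)
  thus ?thesis by simp
qed

section \<open>The integral of the Bessel function\<close>

text \<open>The functions J_0(sqrt x), cos (sqrt y) and (cos (sqrt y) - 1) / y are entire although
  the square root is not smooth at 0. Power series on the whole line provide their derivatives at 0
  and at negative arguments.\<close>

definition everywhere_summable :: "(nat \<Rightarrow> real) \<Rightarrow> bool" where
  "everywhere_summable c \<longleftrightarrow> (\<forall>x. summable (\<lambda>n. c n * x ^ n))"

definition power_series :: "(nat \<Rightarrow> real) \<Rightarrow> real \<Rightarrow> real" where
  "power_series c x = (\<Sum>n. c n * x ^ n)"

lemma everywhere_summable_diffs: "everywhere_summable c \<Longrightarrow> everywhere_summable (diffs c)"
  unfolding everywhere_summable_def using termdiff_converges_all by blast

lemma power_series_has_derivative: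
  assumes "everywhere_summable c"
  shows "(power_series c has_real_derivative power_series (diffs c) x) (at x)"
  using termdiffs_strong_converges_everywhere[of c x] assms
  unfolding everywhere_summable_def power_series_def by blast

lemma everywhere_summable_if_bounded_by_exp:
  assumes "\<And>n. \<bar>c n\<bar> \<le> 1 / fact n"
  shows "everywhere_summable c"
  unfolding everywhere_summable_def
proof
  fix x :: real
  show "summable (\<lambda>n. c n * x ^ n)"
  proof (rule summable_comparison_test')
    show "summable (\<lambda>n. inverse (fact n) * \<bar>x\<bar> ^ n)" by (rule summable_exp)
    show "norm (c n * x ^ n) \<le> inverse (fact n) * \<bar>x\<bar> ^ n" if "n \<ge> 0" for n
      using assms[of n] by (auto simp: abs_mult power_abs divide_inverse intro: mult_right_mono)
  qed
qed

lemma everywhere_summable_shift: "everywhere_summable c \<Longrightarrow> everywhere_summable (\<lambda>n. c (Suc n))"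
proof -
  assume c: "everywhere_summable c"
  have "summable (\<lambda>n. c (Suc n) * x ^ n)" for x
  proof (cases "x = 0")
    case False
    have "summable (\<lambda>n. c (Suc n) * x ^ Suc n)"
      using c summable_Suc_iff[of "\<lambda>n. c n * x ^ n"] by (simp add: everywhere_summable_def)
    from summable_mult[OF this, of "1 / x"] show ?thesis using False by simp
  qed (use powser_zero in \<open>auto intro: summable_finite[of "{0}"]\<close>)
  thus ?thesis by (simp add: everywhere_summable_def)
qed

lemma power_series_shift:
  assumes "everywhere_summable c"
  shows "x * power_series (\<lambda>n. c (Suc n)) x = power_series c x - c 0"
proof -
  have sm: "summable (\<lambda>n. c n * x ^ n)" "summable (\<lambda>n. c (Suc n) * x ^ n)"
    using assms everywhere_summable_shift[OF assms] by (auto simp: everywhere_summable_def)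
  have "x * power_series (\<lambda>n. c (Suc n)) x = (\<Sum>n. x * (c (Suc n) * x ^ n))"
    unfolding power_series_def by (rule suminf_mult[OF sm(2), symmetric])
  also have "\<dots> = (\<Sum>n. c (Suc n) * x ^ Suc n)" by (simp add: mult_ac)
  also have "\<dots> = power_series c x - c 0"
    using suminf_split_head[OF sm(1)] by (simp add: power_series_def)
  finally show ?thesis .
qed

text \<open>The operator x d/dx multiplies the n-th coefficient by n; differential equations can
  thus be read off from recursions of coefficients.\<close>

lemma power_series_euler:
  assumes "everywhere_summable c"
  shows "x * power_series (diffs c) x = power_series (\<lambda>n. real n * c n) x"
    and "everywhere_summable (\<lambda>n. real n * c n)"
proof -
  have *: "(\<lambda>n. c n * real n * x ^ n) sums (x * power_series (diffs c) x)" for x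
  proof -
    have "summable (\<lambda>n. diffs c n * x ^ n)"
      using everywhere_summable_diffs[OF assms] by (simp add: everywhere_summable_def)
    hence "(\<lambda>n. x * (diffs c n * x ^ n)) sums (x * power_series (diffs c) x)"
      unfolding power_series_def by (intro sums_mult summable_sums)
    hence "(\<lambda>n. c (Suc n) * real (Suc n) * x ^ Suc n) sums (x * power_series (diffs c) x)"
      by (simp add: diffs_def mult_ac)
    thus ?thesis by (subst (asm) sums_Suc_iff) simp
  qed
  show "x * power_series (diffs c) x = power_series (\<lambda>n. real n * c n) x"
    using *[of x] by (simp add: power_series_def sums_iff mult_ac)
  show "everywhere_summable (\<lambda>n. real n * c n)"
    using * unfolding everywhere_summable_def by (simp add: sums_iff mult_ac)
qed

lemma power_series_linear:
  assumes "everywhere_summable c" "everywhere_summable d"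
  shows "power_series (\<lambda>n. a * c n + b * d n) x = a * power_series c x + b * power_series d x"
proof -
  have "summable (\<lambda>n. c n * x ^ n)" "summable (\<lambda>n. d n * x ^ n)"
    using assms by (auto simp: everywhere_summable_def)
  hence "(\<lambda>n. a * (c n * x ^ n) + b * (d n * x ^ n)) sums (a * power_series c x + b * power_series d x)"
    unfolding power_series_def by (intro sums_add sums_mult summable_sums)
  thus ?thesis by (simp add: power_series_def sums_iff algebra_simps)
qed

section \<open>The functions J_0(sqrt x) and cos (sqrt y)\<close>

definition bessel_coeff :: "nat \<Rightarrow> real" where
  "bessel_coeff n = (- 1) ^ n / (4 ^ n * (fact n)\<^sup>2)"

definition cos_sqrt_coeff :: "nat \<Rightarrow> real" where
  "cos_sqrt_coeff n = (- 1) ^ n / fact (2 * n)"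

lemma bessel_coeff_le: "\<bar>bessel_coeff n\<bar> \<le> 1 / fact n"
proof -
  have "(1 :: real) * (1 * fact n) \<le> 4 ^ n * (fact n * fact n)"
    by (intro mult_mono) auto
  hence "1 / (4 ^ n * (fact n)\<^sup>2) \<le> 1 / (fact n :: real)"
    by (intro divide_left_mono) (auto simp: power2_eq_square)
  thus ?thesis by (simp add: bessel_coeff_def abs_mult)
qed

lemma bessel_coeff_summable: "everywhere_summable bessel_coeff"
  by (rule everywhere_summable_if_bounded_by_exp[OF bessel_coeff_le])

lemma cos_sqrt_coeff_summable: "everywhere_summable cos_sqrt_coeff"
proof (rule everywhere_summable_if_bounded_by_exp)
  fix n
  have "(fact n :: real) \<le> fact (2 * n)" by (rule fact_mono) simp
  hence "1 / fact (2 * n) \<le> 1 / (fact n :: real)" by (intro divide_left_mono) auto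
  thus "\<bar>cos_sqrt_coeff n\<bar> \<le> 1 / fact n" by (simp add: cos_sqrt_coeff_def)
qed

definition \<Phi> :: "real \<Rightarrow> real" where "\<Phi> = power_series bessel_coeff"
definition \<Phi>' :: "real \<Rightarrow> real" where "\<Phi>' = power_series (diffs bessel_coeff)"
definition \<Phi>'' :: "real \<Rightarrow> real" where "\<Phi>'' = power_series (diffs (diffs bessel_coeff))"

lemma bessel_J_sqrt: "x \<ge> 0 \<Longrightarrow> bessel_J 0 (sqrt x) = \<Phi> x"
  unfolding bessel_J_def \<Phi>_def power_series_def bessel_coeff_def
  by (intro suminf_cong) (simp add: power_mult power_divide power2_eq_square)

lemma DERIV_\<Phi>: "(\<Phi> has_real_derivative \<Phi>' x) (at x)"
  unfolding \<Phi>_def \<Phi>'_def by (intro power_series_has_derivative bessel_coeff_summable)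

lemma DERIV_\<Phi>': "(\<Phi>' has_real_derivative \<Phi>'' x) (at x)"
  unfolding \<Phi>'_def \<Phi>''_def by (intro power_series_has_derivative everywhere_summable_diffs bessel_coeff_summable)

text \<open>Bessel's equation in the variable x is (x \<Phi>')' = - \<Phi> / 4; on coefficients it
  says (n + 1)^2 c(n + 1) = - c(n) / 4.\<close>

lemma \<Phi>_ode: "x * \<Phi>'' x = - \<Phi>' x - \<Phi> x / 4"
proof -
  have "((\<lambda>x. x * \<Phi>' x) has_real_derivative 1 * \<Phi>' x + \<Phi>'' x * x) (at x)"
    by (intro DERIV_mult DERIV_ident DERIV_\<Phi>')
  moreover have "((\<lambda>x. x * \<Phi>' x) has_real_derivative power_series (diffs (\<lambda>n. real n * bessel_coeff n)) x) (at x)"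
    unfolding \<Phi>'_def power_series_euler(1)[OF bessel_coeff_summable]
    by (rule power_series_has_derivative[OF power_series_euler(2)[OF bessel_coeff_summable]])
  ultimately have "1 * \<Phi>' x + \<Phi>'' x * x = power_series (diffs (\<lambda>n. real n * bessel_coeff n)) x"
    by (rule DERIV_unique)
  also have "diffs (\<lambda>n. real n * bessel_coeff n) = (\<lambda>n. (- 1 / 4) * bessel_coeff n + 0 * bessel_coeff n)"
  proof
    fix n
    define N A where "N = real n + 1" and "A = (fact n :: real)"
    have "N \<noteq> 0" by (simp add: N_def)
    hence "N * (N * ((- 1) ^ Suc n / (4 ^ Suc n * (N * A)\<^sup>2))) = (- 1 / 4) * ((- 1) ^ n / (4 ^ n * A\<^sup>2))"
      by (simp add: power2_eq_square)
    thus "diffs (\<lambda>n. real n * bessel_coeff n) n = (- 1 / 4) * bessel_coeff n + 0 * bessel_coeff n"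
      by (simp add: diffs_def bessel_coeff_def N_def A_def add.commute)
  qed
  also have "power_series \<dots> x = (- 1 / 4) * \<Phi> x + 0 * \<Phi> x"
    unfolding \<Phi>_def by (intro power_series_linear bessel_coeff_summable)
  finally show ?thesis by (simp add: mult.commute)
qed

definition cos_sqrt :: "nat \<Rightarrow> real \<Rightarrow> real" where
  "cos_sqrt k = power_series ((diffs ^^ k) cos_sqrt_coeff)"

text \<open>These are the derivatives of (cos (sqrt y) - 1) / y: dropping the zeroth coefficient and
  shifting the others amounts to division by y.\<close>

definition cos_sqrt_rem :: "nat \<Rightarrow> real \<Rightarrow> real" where
  "cos_sqrt_rem k = power_series ((diffs ^^ k) (\<lambda>n. cos_sqrt_coeff (Suc n)))"

lemma everywhere_summable_higher_diffs: "everywhere_summable c \<Longrightarrow> everywhere_summable ((diffs ^^ k) c)"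
  by (induction k) (simp_all add: everywhere_summable_diffs)

lemma DERIV_cos_sqrt: "(cos_sqrt k has_real_derivative cos_sqrt (Suc k) y) (at y)"
  unfolding cos_sqrt_def
  using power_series_has_derivative[OF everywhere_summable_higher_diffs[OF cos_sqrt_coeff_summable]] by simp

lemma DERIV_cos_sqrt_rem: "(cos_sqrt_rem k has_real_derivative cos_sqrt_rem (Suc k) y) (at y)"
  unfolding cos_sqrt_rem_def
  using power_series_has_derivative[OF everywhere_summable_higher_diffs[OF everywhere_summable_shift[OF cos_sqrt_coeff_summable]]]
  by simp

lemma cos_sqrt_0: "y \<ge> 0 \<Longrightarrow> cos_sqrt 0 y = cos (sqrt y)"
  using cos_paired[of "sqrt y"] by (simp add: cos_sqrt_def power_series_def cos_sqrt_coeff_def sums_iff power_mult)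

lemma DERIV_eq_0_const: "(\<And>y. f y = (c :: real)) \<Longrightarrow> (f has_real_derivative d) (at y) \<Longrightarrow> d = 0"
proof -
  assume "\<And>y. f y = c" and d: "(f has_real_derivative d) (at y)"
  hence "f = (\<lambda>_. c)" by auto
  hence "(f has_real_derivative 0) (at y)" by (simp only: DERIV_const)
  from DERIV_unique[OF d this] show "d = 0" .
qed

text \<open>The case k = 0 is a recursion of coefficients, and each further case is the derivative
  of the previous one. A derivative is thereby bounded by the two preceding ones over y.\<close>

lemma cos_sqrt_ode: "4 * y * cos_sqrt (k + 2) y + (4 * real k + 2) * cos_sqrt (k + 1) y + cos_sqrt k y = 0"
proof (induction k arbitrary: y)
  case 0
  define c where "c = cos_sqrt_coeff"
  have c: "everywhere_summable c" by (simp add: c_def cos_sqrt_coeff_summable)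
  have "((\<lambda>x. x * cos_sqrt 1 x) has_real_derivative 1 * cos_sqrt 1 y + cos_sqrt (Suc 1) y * y) (at y)"
    by (intro DERIV_mult DERIV_ident DERIV_cos_sqrt)
  moreover have "((\<lambda>x. x * cos_sqrt 1 x) has_real_derivative power_series (diffs (\<lambda>n. real n * c n)) y) (at y)"
    using power_series_has_derivative[OF power_series_euler(2)[OF c]]
    by (simp add: cos_sqrt_def c_def[symmetric] power_series_euler(1)[OF c])
  ultimately have "1 * cos_sqrt 1 y + cos_sqrt (Suc 1) y * y = power_series (diffs (\<lambda>n. real n * c n)) y"
    by (rule DERIV_unique)
  also have "diffs (\<lambda>n. real n * c n) = (\<lambda>n. (1 / 2) * diffs c n + (- 1 / 4) * c n)"
  proof
    fix n
    have f: "fact (2 * Suc n) = (2 * real n + 2) * (2 * real n + 1) * fact (2 * n)"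
      by (simp add: algebra_simps)
    have p: "2 * real n + 2 > 0" "2 * real n + 1 > 0" "real n + 1 > 0" by linarith+
    have "(real n + 1) * c (Suc n) * (4 * real n + 2) = - c n"
      unfolding c_def cos_sqrt_coeff_def f using p by (simp add: divide_simps) (simp add: algebra_simps)
    thus "diffs (\<lambda>n. real n * c n) n = (1 / 2) * diffs c n + (- 1 / 4) * c n"
      by (simp add: diffs_def algebra_simps)
  qed
  also have "power_series \<dots> y = (1 / 2) * cos_sqrt 1 y + (- 1 / 4) * cos_sqrt 0 y"
    unfolding power_series_linear[OF everywhere_summable_diffs[OF c] c] by (simp add: cos_sqrt_def c_def)
  finally show ?case by (simp add: algebra_simps numeral_2_eq_2)
next
  case (Suc k)
  have "((\<lambda>y. 4 * y * cos_sqrt (k + 2) y + (4 * real k + 2) * cos_sqrt (k + 1) y + cos_sqrt k y) has_real_derivative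
     4 * cos_sqrt (k + 2) y + 4 * y * cos_sqrt (Suc (k + 2)) y + (4 * real k + 2) * cos_sqrt (Suc (k + 1)) y + cos_sqrt (Suc k) y) (at y)"
    by (auto intro!: derivative_eq_intros DERIV_cos_sqrt)
  from DERIV_eq_0_const[OF Suc.IH this] show ?case by (simp add: algebra_simps)
qed

lemma cos_sqrt_rem_eq:
  "y * cos_sqrt_rem 0 y = cos_sqrt 0 y - 1"
  "y * cos_sqrt_rem 1 y + cos_sqrt_rem 0 y = cos_sqrt 1 y"
  "y * cos_sqrt_rem 2 y + 2 * cos_sqrt_rem 1 y = cos_sqrt 2 y"
proof -
  have 0: "y * cos_sqrt_rem 0 y = cos_sqrt 0 y - 1" for y
    unfolding cos_sqrt_rem_def cos_sqrt_def
    by (simp add: power_series_shift[OF cos_sqrt_coeff_summable]) (simp add: cos_sqrt_coeff_def)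
  have 1: "y * cos_sqrt_rem 1 y + cos_sqrt_rem 0 y = cos_sqrt 1 y" for y
  proof -
    have "((\<lambda>y. y * cos_sqrt_rem 0 y - cos_sqrt 0 y) has_real_derivative
       1 * cos_sqrt_rem 0 y + cos_sqrt_rem (Suc 0) y * y - cos_sqrt (Suc 0) y) (at y)"
      by (intro DERIV_mult DERIV_diff DERIV_ident DERIV_cos_sqrt DERIV_cos_sqrt_rem)
    from DERIV_eq_0_const[OF _ this, of "- 1"] 0 show ?thesis by (simp add: mult.commute)
  qed
  have "((\<lambda>y. y * cos_sqrt_rem 1 y + cos_sqrt_rem 0 y - cos_sqrt 1 y) has_real_derivative
       1 * cos_sqrt_rem 1 y + cos_sqrt_rem (Suc 1) y * y + cos_sqrt_rem (Suc 0) y - cos_sqrt (Suc 1) y) (at y)"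
    by (intro DERIV_mult DERIV_diff DERIV_add DERIV_ident DERIV_cos_sqrt DERIV_cos_sqrt_rem)
  from DERIV_eq_0_const[OF _ this, of 0] 1 show "y * cos_sqrt_rem 2 y + 2 * cos_sqrt_rem 1 y = cos_sqrt 2 y"
    by (simp add: mult.commute numeral_2_eq_2)
  show "y * cos_sqrt_rem 0 y = cos_sqrt 0 y - 1" "y * cos_sqrt_rem 1 y + cos_sqrt_rem 0 y = cos_sqrt 1 y"
    by (fact 0 1)+
qed

section \<open>Decay estimates\<close>

text \<open>The half-line starts at - 1 rather than 0 to leave room for two-sided derivatives in
  \<sigma> at \<sigma> = 0. Decay like 1 / y is what makes the product with \<Phi> = O(x powr (- 1 /
  4)) integrable.\<close>

definition decaying :: "(real \<Rightarrow> real) \<Rightarrow> bool" where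
  "decaying f \<longleftrightarrow> continuous_on UNIV f \<and> (\<exists>B\<ge>0. \<forall>y\<ge>-1. \<bar>f y\<bar> \<le> B / (2 + y))"

lemma decayingI:
  assumes c: "continuous_on UNIV f" and K: "\<And>y. y \<ge> 1 \<Longrightarrow> \<bar>f y\<bar> \<le> K / y"
  shows "decaying f"
proof -
  have "compact (f ` {-1..1})"
    by (intro compact_continuous_image continuous_on_subset[OF c]) auto
  then obtain b where b: "\<And>y. y \<in> {-1..1} \<Longrightarrow> \<bar>f y\<bar> \<le> b"
    using compact_imp_bounded[THEN bounded_iff[THEN iffD1]] by (metis (no_types) image_eqI real_norm_def)
  have b0: "b \<ge> 0" using b[of 0] by simp
  have K0: "K \<ge> 0" using K[of 1] by simp
  have "\<bar>f y\<bar> \<le> (3 * b + 3 * K) / (2 + y)" if "y \<ge> -1" for y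
  proof (cases "y \<le> 1")
    case True
    have "\<bar>f y\<bar> \<le> b" using b that True by simp
    also have "b * (2 + y) \<le> b * 3" using True b0 by (intro mult_left_mono) auto
    hence "b \<le> (3 * b) / (2 + y)" using that by (simp add: field_simps)
    also have "\<dots> \<le> (3 * b + 3 * K) / (2 + y)" using K0 that by (intro divide_right_mono) auto
    finally show ?thesis .
  next
    case False
    have "\<bar>f y\<bar> \<le> K / y" using K[of y] False by simp
    also have "\<dots> \<le> (3 * K) / (2 + y)"
    proof -
      have "K * (2 + y) \<le> K * (3 * y)" using False K0 by (intro mult_left_mono) auto
      thus ?thesis using False by (simp add: field_simps)
    qed
    also have "\<dots> \<le> (3 * b + 3 * K) / (2 + y)" using b0 that by (intro divide_right_mono) auto
    finally show ?thesis .
  qed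
  thus ?thesis unfolding decaying_def using c b0 K0 by (intro conjI exI[of _ "3 * b + 3 * K"]) auto
qed

lemma decaying_linear:
  assumes "decaying f" "decaying g"
  shows "decaying (\<lambda>y. a * f y + b * g y)"
proof -
  obtain A B where AB: "A \<ge> 0" "B \<ge> 0" "\<And>y. y \<ge> -1 \<Longrightarrow> \<bar>f y\<bar> \<le> A / (2 + y)" "\<And>y. y \<ge> -1 \<Longrightarrow> \<bar>g y\<bar> \<le> B / (2 + y)"
    using assms unfolding decaying_def by blast
  show ?thesis unfolding decaying_def
  proof (intro conjI exI[of _ "\<bar>a\<bar> * A + \<bar>b\<bar> * B"] allI impI)
    show "continuous_on UNIV (\<lambda>y. a * f y + b * g y)"
      using assms unfolding decaying_def by (intro continuous_intros) auto
    fix y :: real assume y: "y \<ge> -1"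
    have "\<bar>a * f y + b * g y\<bar> \<le> \<bar>a\<bar> * \<bar>f y\<bar> + \<bar>b\<bar> * \<bar>g y\<bar>"
      by (metis abs_mult abs_triangle_ineq)
    also have "\<dots> \<le> \<bar>a\<bar> * (A / (2 + y)) + \<bar>b\<bar> * (B / (2 + y))"
      using AB(3,4)[OF y] by (intro add_mono mult_left_mono) auto
    finally show "\<bar>a * f y + b * g y\<bar> \<le> (\<bar>a\<bar> * A + \<bar>b\<bar> * B) / (2 + y)"
      by (simp add: add_divide_distrib)
  qed (use AB in auto)
qed

lemma cos_sqrt_continuous: "continuous_on A (cos_sqrt k)"
  using DERIV_continuous[OF DERIV_cos_sqrt] continuous_at_imp_continuous_on by blast

lemma cos_sqrt_rem_continuous: "continuous_on A (cos_sqrt_rem k)"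
  using DERIV_continuous[OF DERIV_cos_sqrt_rem] continuous_at_imp_continuous_on by blast

text \<open>The function and its first derivative are explicit; from order 2 on the differential
  equation gains a factor 1 / y. As order 1 decays only like y powr (- 1 / 2),
  \<open>cos_sqrt 2\<close> is the first with the required decay.\<close>

lemma cos_sqrt_bounds:
  assumes y: "y \<ge> 1"
  shows "\<bar>cos_sqrt 0 y\<bar> \<le> 1" "\<bar>cos_sqrt 1 y\<bar> \<le> 1" "\<bar>cos_sqrt 2 y\<bar> \<le> 1 / y" "\<bar>cos_sqrt 3 y\<bar> \<le> 2 / y" "\<bar>cos_sqrt 4 y\<bar> \<le> 6 / y"
proof -
  show 0: "\<bar>cos_sqrt 0 y\<bar> \<le> 1" using y by (simp add: cos_sqrt_0)
  have "((\<lambda>y. cos (sqrt y)) has_real_derivative - sin (sqrt y) * (inverse (sqrt y) / 2)) (at y)"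
    using y by (auto intro!: derivative_eq_intros)
  moreover have "((\<lambda>y. cos (sqrt y)) has_real_derivative cos_sqrt 1 y) (at y)"
  proof (rule has_field_derivative_transform_within_open[OF DERIV_cos_sqrt[of 0 y, unfolded One_nat_def[symmetric]]])
    show "open {0<..<y + 1}" "y \<in> {0<..<y + 1}" using y by auto
  qed (simp add: cos_sqrt_0)
  ultimately have 1: "cos_sqrt 1 y = - sin (sqrt y) * (inverse (sqrt y) / 2)" by (rule DERIV_unique[symmetric])
  have "inverse (sqrt y) \<le> 1" using y by (simp add: inverse_le_1_iff)
  hence "\<bar>sin (sqrt y)\<bar> * (inverse (sqrt y) / 2) \<le> 1 * (1 / 2)"
    using y by (intro mult_mono) auto
  hence 1: "\<bar>cos_sqrt 1 y\<bar> \<le> 1 / 2" unfolding 1 using y by (simp add: abs_mult)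
  thus "\<bar>cos_sqrt 1 y\<bar> \<le> 1" by simp
  have *: "\<bar>cos_sqrt i y\<bar> \<le> ((4 * real k + 2) * a + b) / 4 / y"
    if *: "\<bar>cos_sqrt j y\<bar> \<le> a" "\<bar>cos_sqrt k y\<bar> \<le> b" "j = k + 1" "i = k + 2" for i j k a b
  proof -
    have that: "\<bar>cos_sqrt (k + 1) y\<bar> \<le> a" "\<bar>cos_sqrt k y\<bar> \<le> b"
      using * by simp_all
    have "4 * y * cos_sqrt (k + 2) y = - ((4 * real k + 2) * cos_sqrt (k + 1) y + cos_sqrt k y)"
      using cos_sqrt_ode[of y k] by linarith
    hence "\<bar>4 * y * cos_sqrt (k + 2) y\<bar> \<le> \<bar>(4 * real k + 2) * cos_sqrt (k + 1) y\<bar> + \<bar>cos_sqrt k y\<bar>"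
      by (metis abs_minus_cancel abs_triangle_ineq)
    also have "\<dots> \<le> (4 * real k + 2) * a + b"
      unfolding abs_mult using that by (intro add_mono mult_mono) auto
    finally have "\<bar>cos_sqrt (k + 2) y\<bar> \<le> ((4 * real k + 2) * a + b) / 4 / y"
      using y by (simp add: abs_mult field_simps)
    thus ?thesis by (simp only: *(4))
  qed
  have "\<bar>cos_sqrt 2 y\<bar> \<le> ((4 * real 0 + 2) * (1 / 2) + 1) / 4 / y" by (rule *[OF 1 0]) simp_all
  hence 2: "\<bar>cos_sqrt 2 y\<bar> \<le> (1 / 2) / y" by simp
  also have "(1 / 2) / y \<le> 1 / y" using y by (simp add: field_simps)
  finally show "\<bar>cos_sqrt 2 y\<bar> \<le> 1 / y" .
  have y1: "1 / y \<le> 1" using y by simp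
  have 2: "\<bar>cos_sqrt 2 y\<bar> \<le> 1 / 2" using 2 y1 by simp
  have "\<bar>cos_sqrt 3 y\<bar> \<le> ((4 * real 1 + 2) * (1 / 2) + 1 / 2) / 4 / y" by (rule *[OF 2 1]) simp_all
  also have "\<dots> \<le> 2 / y" using y by (intro divide_right_mono) auto
  finally show 3: "\<bar>cos_sqrt 3 y\<bar> \<le> 2 / y" .
  have 3: "\<bar>cos_sqrt 3 y\<bar> \<le> 2" using 3 y1 by simp
  have "\<bar>cos_sqrt 4 y\<bar> \<le> ((4 * real 2 + 2) * 2 + 1 / 2) / 4 / y" by (rule *[OF 3 2]) simp_all
  also have "\<dots> \<le> 6 / y" using y by (intro divide_right_mono) auto
  finally show "\<bar>cos_sqrt 4 y\<bar> \<le> 6 / y" .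
qed

lemma decaying_cos_sqrt: "decaying (cos_sqrt 2)" "decaying (cos_sqrt 3)" "decaying (cos_sqrt 4)"
  using cos_sqrt_bounds by (auto intro!: decayingI cos_sqrt_continuous)

lemma decaying_cos_sqrt_rem: "decaying (cos_sqrt_rem 0)" "decaying (cos_sqrt_rem 1)" "decaying (cos_sqrt_rem 2)"
proof -
  have div: "\<bar>a\<bar> \<le> K / y" if "y * a = b" "\<bar>b\<bar> \<le> K" "y \<ge> 1" for a b K y :: real
  proof -
    have "\<bar>y * a\<bar> \<le> K" using that by simp
    thus ?thesis using that(3) by (simp add: abs_mult field_simps)
  qed
  have 0: "\<bar>cos_sqrt_rem 0 y\<bar> \<le> 2 / y" if y: "y \<ge> 1" for y
    by (rule div[OF cos_sqrt_rem_eq(1) _ y]) (use cos_sqrt_bounds(1)[OF y] in linarith)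
  have b0: "\<bar>cos_sqrt_rem 0 y\<bar> \<le> 2" if y: "y \<ge> 1" for y
  proof -
    have "2 / y \<le> 2" using y by (simp add: divide_le_eq)
    thus ?thesis using 0[OF y] by linarith
  qed
  have 1: "\<bar>cos_sqrt_rem 1 y\<bar> \<le> 3 / y" if y: "y \<ge> 1" for y
  proof (rule div[OF _ _ y])
    show "y * cos_sqrt_rem 1 y = cos_sqrt 1 y - cos_sqrt_rem 0 y" using cos_sqrt_rem_eq(2)[of y] by linarith
    show "\<bar>cos_sqrt 1 y - cos_sqrt_rem 0 y\<bar> \<le> 3" using cos_sqrt_bounds(2)[OF y] b0[OF y] by linarith
  qed
  have b1: "\<bar>cos_sqrt_rem 1 y\<bar> \<le> 3" if y: "y \<ge> 1" for y
  proof -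
    have "3 / y \<le> 3" using y by (simp add: divide_le_eq)
    thus ?thesis using 1[OF y] by linarith
  qed
  have 2: "\<bar>cos_sqrt_rem 2 y\<bar> \<le> 7 / y" if y: "y \<ge> 1" for y
  proof (rule div[OF _ _ y])
    show "y * cos_sqrt_rem 2 y = cos_sqrt 2 y - 2 * cos_sqrt_rem 1 y" using cos_sqrt_rem_eq(3)[of y] by linarith
    have "\<bar>cos_sqrt 2 y\<bar> \<le> 1" using order_trans[OF cos_sqrt_bounds(3)[OF y], of 1] y by simp
    thus "\<bar>cos_sqrt 2 y - 2 * cos_sqrt_rem 1 y\<bar> \<le> 7" using b1[OF y] by linarith
  qed
  show "decaying (cos_sqrt_rem 0)" "decaying (cos_sqrt_rem 1)" "decaying (cos_sqrt_rem 2)"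
    using 0 1 2 by (auto intro!: decayingI cos_sqrt_rem_continuous)
qed

lemma \<Phi>_continuous: "continuous_on A \<Phi>" "continuous_on A \<Phi>'"
  using DERIV_continuous[OF DERIV_\<Phi>] DERIV_continuous[OF DERIV_\<Phi>'] continuous_at_imp_continuous_on by blast+

lemma \<Phi>_measurable [measurable]: "\<Phi> \<in> borel_measurable borel"
  using \<Phi>_continuous(1)[of UNIV] by (rule borel_measurable_continuous_onI)

text \<open>In the variable \<open>t = sqrt x\<close> this is the energy \<open>(u')\<^sup>2 + (1 + 1 / (4 t\<^sup>2)) u\<^sup>2\<close> of \<open>u = sqrt t * J\<^sub>0(t)\<close>, which satisfies
  \<open>u'' + (1 + 1 / (4 t\<^sup>2)) u = 0\<close>; hence it is decreasing.\<close>

definition bessel_energy :: "real \<Rightarrow> real" where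
  "bessel_energy x = sqrt x * (\<Phi> x)\<^sup>2 + 4 * sqrt x ^ 3 * (\<Phi>' x)\<^sup>2 + 2 * sqrt x * \<Phi> x * \<Phi>' x + (\<Phi> x)\<^sup>2 / (2 * sqrt x)"

lemma bessel_energy_le:
  assumes "x \<ge> 1"
  shows "bessel_energy x \<le> bessel_energy 1"
proof (rule DERIV_nonpos_imp_nonincreasing[OF assms])
  fix x :: real assume x: "1 \<le> x"
  define r where "r = sqrt x"
  have r: "r > 0" "x = r\<^sup>2" using x by (auto simp: r_def)
  define a b c where "a = \<Phi> x" and "b = \<Phi>' x" and "c = \<Phi>'' x"
  have ode: "r\<^sup>2 * c = - b - a / 4" using \<Phi>_ode[of x] by (simp add: a_def b_def c_def r(2))
  define d where "d = (inverse r / 2) * a\<^sup>2 + r * (2 * a * b) + (4 * (3 * r\<^sup>2 * (inverse r / 2)) * b\<^sup>2 + 4 * r ^ 3 * (2 * b * c))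
     + ((2 * (inverse r / 2) * a + 2 * r * b) * b + 2 * r * a * c) + (2 * a * b * (2 * r) - a\<^sup>2 * (2 * (inverse r / 2))) / (2 * r * (2 * r))"
  have "(bessel_energy has_real_derivative d) (at x)"
    unfolding bessel_energy_def[abs_def] d_def a_def b_def c_def r_def
    using x by (auto intro!: derivative_eq_intros DERIV_\<Phi> DERIV_\<Phi>' simp: power2_eq_square)
  \<comment> \<open>Along a solution only the explicit dependence of the coefficient 1 + 1 / (4 t^2)
    on t changes the energy, and this coefficient decreases.\<close>
  moreover have "d = - a\<^sup>2 / (4 * r ^ 3)"
  proof -
    have "r ^ 3 * (b * c) = r * b * (r\<^sup>2 * c)" "r * (a * c) = a * (r\<^sup>2 * c) / r"
      using r by (simp_all add: power2_eq_square power3_eq_cube)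
    hence e: "4 * r ^ 3 * (2 * b * c) = 8 * r * b * (- b - a / 4)" "2 * r * a * c = 2 * a * (- b - a / 4) / r"
      unfolding ode by simp_all
    show ?thesis unfolding d_def e using r by (simp add: field_simps power2_eq_square power3_eq_cube)
  qed
  moreover have "- a\<^sup>2 / (4 * r ^ 3) \<le> 0" using r by (simp add: divide_nonpos_pos)
  ultimately show "\<exists>y. (bessel_energy has_real_derivative y) (at x) \<and> y \<le> 0" by metis
qed

text \<open>For x \<ge> 1 the energy is at least sqrt x / 2 times \<Phi>^2 + 4 x \<Phi>'^2: with a =
  \<Phi> and b = 2 sqrt x \<Phi>' the mixed term is absorbed by 2 a b \<ge> - (a^2 + b^2).\<close>

lemma bessel_decay:
  obtains A where "A \<ge> 0" "\<And>x. x \<ge> 1 \<Longrightarrow> (\<Phi> x)\<^sup>2 + 4 * x * (\<Phi>' x)\<^sup>2 \<le> A / sqrt x"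
proof -
  have *: "(\<Phi> x)\<^sup>2 + 4 * x * (\<Phi>' x)\<^sup>2 \<le> 2 * bessel_energy 1 / sqrt x" if x: "x \<ge> 1" for x
  proof -
    define r where "r = sqrt x"
    have r: "r \<ge> 1" "x = r\<^sup>2" using x by (auto simp: r_def)
    define a b where "a = \<Phi> x" and "b = 2 * r * \<Phi>' x"
    have "bessel_energy x = r * (a\<^sup>2 + b\<^sup>2) + a * b + a\<^sup>2 / (2 * r)"
      unfolding bessel_energy_def a_def b_def r_def by (simp add: power2_eq_square power3_eq_cube algebra_simps)
    moreover have "a * b \<ge> - (a\<^sup>2 + b\<^sup>2) / 2"
      using zero_le_power2[of "a + b"] by (simp add: power2_eq_square algebra_simps)
    moreover have "a\<^sup>2 / (2 * r) \<ge> 0" using r by simp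
    moreover have "(a\<^sup>2 + b\<^sup>2) / 2 \<le> r * (a\<^sup>2 + b\<^sup>2) / 2"
      using mult_right_mono[of 1 r "a\<^sup>2 + b\<^sup>2"] r by simp
    ultimately have "r * (a\<^sup>2 + b\<^sup>2) \<le> 2 * bessel_energy 1"
      using bessel_energy_le[OF x] by argo
    hence "a\<^sup>2 + b\<^sup>2 \<le> 2 * bessel_energy 1 / r" using r by (simp add: field_simps)
    thus ?thesis by (simp add: a_def b_def power_mult_distrib r(2)[symmetric] flip: r_def)
  qed
  have "(\<Phi> 1)\<^sup>2 + 4 * (\<Phi>' 1)\<^sup>2 \<le> 2 * bessel_energy 1" using *[of 1] by simp
  hence "0 \<le> 2 * bessel_energy 1" using zero_le_power2[of "\<Phi> 1"] zero_le_power2[of "\<Phi>' 1"] by linarith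
  thus ?thesis using that * by blast
qed

lemma \<Phi>_bound: obtains A where "A \<ge> 0" "\<And>x. x \<ge> 0 \<Longrightarrow> \<bar>\<Phi> x\<bar> \<le> A * (1 + x) powr (- 1 / 4)"
proof -
  obtain A where A: "A \<ge> 0" "\<And>x. x \<ge> 1 \<Longrightarrow> (\<Phi> x)\<^sup>2 + 4 * x * (\<Phi>' x)\<^sup>2 \<le> A / sqrt x"
    by (rule bessel_decay) blast
  have "compact (\<Phi> ` {0..1})"
    by (intro compact_continuous_image \<Phi>_continuous) auto
  then obtain b where b: "\<And>x. x \<in> {0..1} \<Longrightarrow> \<bar>\<Phi> x\<bar> \<le> b"
    using compact_imp_bounded[THEN bounded_iff[THEN iffD1]] by (metis (no_types) image_eqI real_norm_def)
  have b0: "b \<ge> 0" using b[of 0] by simp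
  have "\<bar>\<Phi> x\<bar> \<le> (2 * b + 2 * sqrt A) * (1 + x) powr (- 1 / 4)" if x: "x \<ge> 0" for x
  proof (cases "x \<le> 1")
    case True
    have "(1 / 2 :: real) \<le> 2 powr (- 1 / 4)"
      using powr_mono[of "-1" "-1/4" "2::real"] by (simp add: powr_minus)
    also have "\<dots> \<le> (1 + x) powr (- 1 / 4)" using True x by (intro powr_mono2') auto
    finally have "b * 1 \<le> b * (2 * (1 + x) powr (- 1 / 4))" using b0 by (intro mult_left_mono) auto
    moreover have "\<bar>\<Phi> x\<bar> \<le> b" using b True x by simp
    moreover have "0 \<le> 2 * sqrt A * (1 + x) powr (- 1 / 4)" using A(1) by simp
    ultimately show ?thesis by (simp add: algebra_simps)
  next
    case False
    have "(\<Phi> x)\<^sup>2 \<le> A / sqrt x"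
    proof -
      have "0 \<le> 4 * x * (\<Phi>' x)\<^sup>2" using False by (intro mult_nonneg_nonneg) auto
      moreover have "(\<Phi> x)\<^sup>2 + 4 * x * (\<Phi>' x)\<^sup>2 \<le> A / sqrt x" using False by (intro A(2)) simp
      ultimately show ?thesis by linarith
    qed
    hence "sqrt ((\<Phi> x)\<^sup>2) \<le> sqrt (A / sqrt x)" by (rule real_sqrt_le_mono)
    hence "\<bar>\<Phi> x\<bar> \<le> sqrt A / sqrt (sqrt x)" by (simp add: real_sqrt_divide)
    also have "sqrt (sqrt x) = x powr (1 / 4)" using False by (simp add: powr_half_sqrt[symmetric] powr_powr)
    also have "sqrt A / x powr (1 / 4) = sqrt A * x powr (- 1 / 4)"
      using powr_minus_divide[of x "1 / 4"] by simp
    also have "x powr (- 1 / 4) \<le> 2 * (1 + x) powr (- 1 / 4)"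
    proof -
      have "x powr (- 1 / 4) \<le> ((1 + x) / 2) powr (- 1 / 4)" using False by (intro powr_mono2') auto
      also have "\<dots> = (1 + x) powr (- 1 / 4) * 2 powr (1 / 4)"
        using x powr_divide[of "1 + x" 2 "- 1 / 4"] powr_minus_divide[of "2 :: real" "1 / 4"] by simp
      also have "(1 + x) powr (- 1 / 4) * 2 powr (1 / 4) \<le> (1 + x) powr (- 1 / 4) * 2"
        using powr_mono[of "1 / 4" 1 "2 :: real"] by (intro mult_left_mono) auto
      finally show ?thesis by simp
    qed
    hence "sqrt A * x powr (- 1 / 4) \<le> sqrt A * (2 * (1 + x) powr (- 1 / 4))"
      using A(1) by (intro mult_left_mono) auto
    also have "\<dots> \<le> (2 * b + 2 * sqrt A) * (1 + x) powr (- 1 / 4)" using b0 by (simp add: algebra_simps)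
    finally show ?thesis by simp
  qed
  thus ?thesis using that[of "2 * b + 2 * sqrt A"] b0 A(1) by auto
qed

lemma \<Phi>_tendsto_0: "(\<Phi> \<longlongrightarrow> 0) at_top"
proof -
  obtain A where A: "A \<ge> 0" "\<And>x. x \<ge> 0 \<Longrightarrow> \<bar>\<Phi> x\<bar> \<le> A * (1 + x) powr (- 1 / 4)"
    by (rule \<Phi>_bound) blast
  have "((\<lambda>x. A * (1 + x) powr (- 1 / 4)) \<longlongrightarrow> 0) at_top" by real_asymp
  thus ?thesis
    by (rule Lim_null_comparison[rotated]) (use A(2) in \<open>auto intro: eventually_mono[OF eventually_ge_at_top[of 0]]\<close>)
qed

lemma \<Phi>'_tendsto_0: "(\<Phi>' \<longlongrightarrow> 0) at_top"
proof -
  obtain A where A: "A \<ge> 0" "\<And>x. x \<ge> 1 \<Longrightarrow> (\<Phi> x)\<^sup>2 + 4 * x * (\<Phi>' x)\<^sup>2 \<le> A / sqrt x"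
    by (rule bessel_decay) blast
  have b: "\<bar>\<Phi>' x\<bar> \<le> sqrt (A / sqrt x)" if "x \<ge> 1" for x
  proof -
    have "(\<Phi>' x)\<^sup>2 \<le> 4 * x * (\<Phi>' x)\<^sup>2" using mult_right_mono[of 1 "4 * x" "(\<Phi>' x)\<^sup>2"] that by simp
    hence "(\<Phi>' x)\<^sup>2 \<le> A / sqrt x" using A(2)[OF that] zero_le_power2[of "\<Phi> x"] by linarith
    from real_sqrt_le_mono[OF this] show ?thesis by simp
  qed
  have "((\<lambda>x. sqrt (A / sqrt x)) \<longlongrightarrow> sqrt 0) at_top"
    by (intro tendsto_real_sqrt) real_asymp
  hence "((\<lambda>x. sqrt (A / sqrt x)) \<longlongrightarrow> 0) at_top" by simp
  thus ?thesis
    by (rule Lim_null_comparison[rotated]) (use b in \<open>auto intro: eventually_mono[OF eventually_ge_at_top[of 1]]\<close>)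
qed

lemma integrable_powr_minus_5_4: "integrable lborel (\<lambda>x. indicator {0..} x * (1 + x) powr (- 5 / 4) :: real)"
proof (rule integrableI_nonneg)
  have "(\<integral>\<^sup>+ x. ennreal ((1 + x) powr (- 5 / 4)) * indicator {0..} x \<partial>lborel) = ennreal (0 - (- 4 * (1 + 0) powr (- 1 / 4)))"
  proof (rule nn_integral_FTC_atLeast)
    fix x :: real assume "0 \<le> x"
    thus "((\<lambda>x. - 4 * (1 + x) powr (- 1 / 4)) has_real_derivative (1 + x) powr (- 5 / 4)) (at x)"
      by (auto intro!: derivative_eq_intros simp: powr_diff[symmetric])
    show "0 \<le> (1 + x) powr (- 5 / 4)" by simp
  next
    show "((\<lambda>x::real. - 4 * (1 + x) powr (- 1 / 4)) \<longlongrightarrow> 0) at_top" by real_asymp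
  qed measurable
  also have "(\<integral>\<^sup>+ x. ennreal ((1 + x) powr (- 5 / 4)) * indicator {0..} x \<partial>lborel) =
     (\<integral>\<^sup>+ x. ennreal (indicator {0..} x * (1 + x) powr (- 5 / 4)) \<partial>lborel)"
    by (intro nn_integral_cong) (simp split: split_indicator)
  finally show "(\<integral>\<^sup>+ x. ennreal (indicator {0..} x * (1 + x) powr (- 5 / 4)) \<partial>lborel) < \<infinity>"
    by simp
qed auto

section \<open>Integrals of J_0(sqrt x) against shifted kernels\<close>

text \<open>The parameter \<sigma>, later s^2, enters as a shift of the kernel, so derivatives in
  \<sigma> fall on \<open>k\<close> and not on \<Phi>.\<close>

definition bessel_conv :: "(real \<Rightarrow> real) \<Rightarrow> real \<Rightarrow> real" where
  "bessel_conv k \<sigma> = (LINT x|lborel. indicator {0..} x * (\<Phi> x * k (x + \<sigma>)))"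

text \<open>One majorant for all y \<ge> x - 1. It serves for integrability, for the limit as
  \<sigma> tends to infinity and, through mean value points, for difference quotients.\<close>

lemma decaying_dominated:
  assumes "decaying k"
  obtains C where "C \<ge> 0" "\<And>x y. x \<ge> 0 \<Longrightarrow> y \<ge> x - 1 \<Longrightarrow> \<bar>\<Phi> x * k y\<bar> \<le> C * (1 + x) powr (- 5 / 4)"
    "integrable lborel (\<lambda>x. indicator {0..} x * (C * (1 + x) powr (- 5 / 4)))"
proof -
  obtain A where A: "A \<ge> 0" "\<And>x. x \<ge> 0 \<Longrightarrow> \<bar>\<Phi> x\<bar> \<le> A * (1 + x) powr (- 1 / 4)"
    by (rule \<Phi>_bound) blast
  obtain B where B: "B \<ge> 0" "\<And>y. y \<ge> -1 \<Longrightarrow> \<bar>k y\<bar> \<le> B / (2 + y)"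
    using assms unfolding decaying_def by blast
  show ?thesis
  proof (rule that[of "A * B"])
    show "A * B \<ge> 0" using A B by simp
    show "integrable lborel (\<lambda>x. indicator {0..} x * (A * B * (1 + x) powr (- 5 / 4)))"
      using integrable_mult_right[OF integrable_powr_minus_5_4, of "A * B"] by (simp add: mult_ac)
    fix x y :: real assume xy: "x \<ge> 0" "y \<ge> x - 1"
    have "\<bar>k y\<bar> \<le> B / (2 + y)" using B(2) xy by simp
    also have "\<dots> \<le> B / (1 + x)" using xy B(1) by (intro divide_left_mono) auto
    finally have "\<bar>\<Phi> x * k y\<bar> \<le> (A * (1 + x) powr (- 1 / 4)) * (B / (1 + x))"
      unfolding abs_mult using A xy by (intro mult_mono A(2)) auto
    also have "\<dots> = A * B * ((1 + x) powr (- 1 / 4) * (1 + x) powr (- 1))"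
      using xy powr_minus_divide[of "1 + x" 1] by simp
    also have "(1 + x) powr (- 1 / 4) * (1 + x) powr (- 1) = (1 + x) powr (- 1 / 4 + - 1)"
      by (rule powr_add[symmetric])
    also have "- 1 / 4 + - 1 = (- 5 / 4 :: real)" by simp
    finally show "\<bar>\<Phi> x * k y\<bar> \<le> A * B * (1 + x) powr (- 5 / 4)" .
  qed
qed

lemma decaying_measurable: "decaying k \<Longrightarrow> k \<in> borel_measurable borel"
  unfolding decaying_def using borel_measurable_continuous_onI by blast

lemma bessel_conv_integrable:
  assumes "decaying k" "\<sigma> \<ge> -1"
  shows "integrable lborel (\<lambda>x. indicator {0..} x * (\<Phi> x * k (x + \<sigma>)))"
proof -
  have [measurable]: "k \<in> borel_measurable borel" by (rule decaying_measurable[OF assms(1)])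
  obtain C where C: "C \<ge> 0" "\<And>x y. x \<ge> 0 \<Longrightarrow> y \<ge> x - 1 \<Longrightarrow> \<bar>\<Phi> x * k y\<bar> \<le> C * (1 + x) powr (- 5 / 4)"
    "integrable lborel (\<lambda>x. indicator {0..} x * (C * (1 + x) powr (- 5 / 4)))"
    using decaying_dominated[OF assms(1)] by blast
  show ?thesis
  proof (rule Bochner_Integration.integrable_bound[OF C(3)])
    show "AE x in lborel. norm (indicator {0..} x * (\<Phi> x * k (x + \<sigma>))) \<le> norm (indicator {0..} x * (C * (1 + x) powr (- 5 / 4)))"
      using C(1,2) assms(2) by (intro always_eventually allI) (auto simp: indicator_def abs_mult)
  qed measurable
qed

lemma bessel_conv_linear:
  assumes "decaying f" "decaying g" "\<sigma> \<ge> -1"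
  shows "bessel_conv (\<lambda>y. a * f y + b * g y) \<sigma> = a * bessel_conv f \<sigma> + b * bessel_conv g \<sigma>"
proof -
  have "bessel_conv (\<lambda>y. a * f y + b * g y) \<sigma> =
     (LINT x|lborel. a * (indicator {0..} x * (\<Phi> x * f (x + \<sigma>))) + b * (indicator {0..} x * (\<Phi> x * g (x + \<sigma>))))"
    unfolding bessel_conv_def by (intro Bochner_Integration.integral_cong refl) (simp add: algebra_simps)
  also have "\<dots> = a * bessel_conv f \<sigma> + b * bessel_conv g \<sigma>"
    unfolding bessel_conv_def using assms by (simp add: bessel_conv_integrable)
  finally show ?thesis .
qed

lemma bessel_conv_tendsto_0:
  assumes k: "decaying k"
  shows "(bessel_conv k \<longlongrightarrow> 0) at_top"
proof -
  have [measurable]: "k \<in> borel_measurable borel" by (rule decaying_measurable[OF k])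
  obtain C where C: "C \<ge> 0" "\<And>x y. x \<ge> 0 \<Longrightarrow> y \<ge> x - 1 \<Longrightarrow> \<bar>\<Phi> x * k y\<bar> \<le> C * (1 + x) powr (- 5 / 4)"
    "integrable lborel (\<lambda>x. indicator {0..} x * (C * (1 + x) powr (- 5 / 4)))"
    using decaying_dominated[OF k] by blast
  obtain B where B: "B \<ge> 0" "\<And>y. y \<ge> -1 \<Longrightarrow> \<bar>k y\<bar> \<le> B / (2 + y)"
    using k unfolding decaying_def by blast
  have "((\<lambda>\<sigma>. LINT x|lborel. indicator {0..} x * (\<Phi> x * k (x + \<sigma>))) \<longlongrightarrow> (LINT x|(lborel :: real measure). (0 :: real))) at_top"
  proof (rule integral_dominated_convergence_at_top[where w = "\<lambda>x. indicator {0..} x * (C * (1 + x) powr (- 5 / 4))"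
        and f = "\<lambda>_. 0 :: real" and s = "\<lambda>\<sigma> x. indicator {0..} x * (\<Phi> x * k (x + \<sigma>))" and M = lborel])
    show "AE x in lborel. ((\<lambda>\<sigma>. indicator {0..} x * (\<Phi> x * k (x + \<sigma>))) \<longlongrightarrow> 0) at_top"
    proof (intro always_eventually allI)
      fix x :: real
      have "((\<lambda>\<sigma>. B / (2 + (x + \<sigma>))) \<longlongrightarrow> 0) at_top" by real_asymp
      moreover have "eventually (\<lambda>\<sigma>. norm (k (x + \<sigma>)) \<le> B / (2 + (x + \<sigma>))) at_top"
        using eventually_ge_at_top[of "- 1 - x"] by eventually_elim (use B(2) in auto)
      ultimately have "((\<lambda>\<sigma>. k (x + \<sigma>)) \<longlongrightarrow> 0) at_top" by (rule Lim_null_comparison[rotated])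
      from tendsto_mult_right_zero[OF this, of "indicator {0..} x * \<Phi> x"]
      show "((\<lambda>\<sigma>. indicator {0..} x * (\<Phi> x * k (x + \<sigma>))) \<longlongrightarrow> 0) at_top" by (simp add: mult.assoc)
    qed
    show "eventually (\<lambda>\<sigma>. AE x in lborel. norm (indicator {0..} x * (\<Phi> x * k (x + \<sigma>))) \<le> indicator {0..} x * (C * (1 + x) powr (- 5 / 4))) at_top"
      using eventually_ge_at_top[of 0]
      by eventually_elim (use C(2) in \<open>auto simp: indicator_def\<close>)
  qed (use C(3) in measurable)
  thus ?thesis by (simp add: bessel_conv_def[abs_def])
qed

text \<open>Dominated convergence along sequences: by the mean value theorem a difference quotient
  is the value of \<open>k'\<close> at a point above x - 1, where the majorant of \<open>k'\<close>
  applies.\<close>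

lemma bessel_conv_has_derivative:
  assumes k: "decaying k" and k': "decaying k'" and d: "\<And>y. (k has_real_derivative k' y) (at y)" and \<sigma>: "\<sigma> \<ge> 0"
  shows "(bessel_conv k has_real_derivative bessel_conv k' \<sigma>) (at \<sigma>)"
  unfolding has_field_derivative_iff tendsto_at_iff_sequentially comp_def
proof (intro allI impI)
  fix X :: "nat \<Rightarrow> real" assume X: "\<forall>i. X i \<in> UNIV - {\<sigma>}" "X \<longlonglongrightarrow> \<sigma>"
  have [measurable]: "k \<in> borel_measurable borel" "k' \<in> borel_measurable borel"
    by (rule decaying_measurable[OF k] decaying_measurable[OF k'])+
  obtain C where C: "C \<ge> 0" "\<And>x y. x \<ge> 0 \<Longrightarrow> y \<ge> x - 1 \<Longrightarrow> \<bar>\<Phi> x * k' y\<bar> \<le> C * (1 + x) powr (- 5 / 4)"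
    "integrable lborel (\<lambda>x. indicator {0..} x * (C * (1 + x) powr (- 5 / 4)))"
    using decaying_dominated[OF k'] by blast
  have "eventually (\<lambda>i. X i > \<sigma> - 1) sequentially" using order_tendstoD(1)[OF X(2), of "\<sigma> - 1"] by simp
  then obtain M where M: "\<And>i. i \<ge> M \<Longrightarrow> X i > \<sigma> - 1" by (auto simp: eventually_at_top_linorder)
  define q where "q = (\<lambda>i x. indicator {0..} x * (\<Phi> x * ((k (x + X i) - k (x + \<sigma>)) / (X i - \<sigma>))))"
  have "(\<lambda>i. LINT x|lborel. q (i + M) x) \<longlonglongrightarrow> (LINT x|lborel. indicator {0..} x * (\<Phi> x * k' (x + \<sigma>)))"
  proof (rule integral_dominated_convergence[OF _ _ C(3)])
    show "AE x in lborel. (\<lambda>i. q (i + M) x) \<longlonglongrightarrow> indicator {0..} x * (\<Phi> x * k' (x + \<sigma>))"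
    proof (intro always_eventually allI)
      fix x :: real
      have "((\<lambda>z. (k z - k (x + \<sigma>)) / (z - (x + \<sigma>))) \<longlongrightarrow> k' (x + \<sigma>)) (at (x + \<sigma>))"
        using d[of "x + \<sigma>"] by (simp add: has_field_derivative_iff)
      moreover have "(\<lambda>i. x + X i) \<longlonglongrightarrow> x + \<sigma>" by (intro tendsto_intros X)
      ultimately have "(\<lambda>i. (k (x + X i) - k (x + \<sigma>)) / ((x + X i) - (x + \<sigma>))) \<longlonglongrightarrow> k' (x + \<sigma>)"
      proof -
        assume L: "((\<lambda>z. (k z - k (x + \<sigma>)) / (z - (x + \<sigma>))) \<longlongrightarrow> k' (x + \<sigma>)) (at (x + \<sigma>))"
          and X': "(\<lambda>i. x + X i) \<longlonglongrightarrow> x + \<sigma>"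
        show ?thesis
          by (rule L[unfolded tendsto_at_iff_sequentially comp_def, rule_format, OF _ X']) (use X(1) in auto)
      qed
      hence "(\<lambda>i. q i x) \<longlonglongrightarrow> indicator {0..} x * (\<Phi> x * k' (x + \<sigma>))"
        unfolding q_def by (intro tendsto_mult tendsto_const) simp
      thus "(\<lambda>i. q (i + M) x) \<longlonglongrightarrow> indicator {0..} x * (\<Phi> x * k' (x + \<sigma>))" by (rule LIMSEQ_ignore_initial_segment)
    qed
    show "AE x in lborel. norm (q (i + M) x) \<le> indicator {0..} x * (C * (1 + x) powr (- 5 / 4))" for i
    proof (intro always_eventually allI)
      fix x :: real
      define h where "h = X (i + M)"
      have h: "h > \<sigma> - 1" "h \<noteq> \<sigma>" using M[of "i + M"] X(1) by (auto simp: h_def)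
      obtain z where z: "z \<ge> x + min h \<sigma>" "(k (x + h) - k (x + \<sigma>)) / (h - \<sigma>) = k' z"
      proof (cases "h < \<sigma>")
        case True
        then obtain z where "x + h < z" "z < x + \<sigma>" "k (x + \<sigma>) - k (x + h) = (x + \<sigma> - (x + h)) * k' z"
          using MVT2[of "x + h" "x + \<sigma>" k k'] d by auto
        thus ?thesis using True by (intro that[of z]) (auto simp: field_simps)
      next
        case False
        then obtain z where "x + \<sigma> < z" "z < x + h" "k (x + h) - k (x + \<sigma>) = (x + h - (x + \<sigma>)) * k' z"
          using MVT2[of "x + \<sigma>" "x + h" k k'] d h by auto
        thus ?thesis using False h by (intro that[of z]) (auto simp: field_simps)
      qed
      have "\<bar>\<Phi> x * k' z\<bar> \<le> C * (1 + x) powr (- 5 / 4)" if "x \<ge> 0"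
        using that z(1) h \<sigma> by (intro C(2)) auto
      thus "norm (q (i + M) x) \<le> indicator {0..} x * (C * (1 + x) powr (- 5 / 4))"
        unfolding q_def h_def[symmetric] z(2) by (auto simp: indicator_def)
    qed
    show "q (i + M) \<in> borel_measurable lborel" for i unfolding q_def by measurable
  qed measurable
  hence "(\<lambda>i. LINT x|lborel. q i x) \<longlonglongrightarrow> bessel_conv k' \<sigma>"
    unfolding bessel_conv_def by (rule LIMSEQ_offset)
  moreover have "eventually (\<lambda>i. (LINT x|lborel. q i x) = (bessel_conv k (X i) - bessel_conv k \<sigma>) / (X i - \<sigma>)) sequentially"
    using eventually_ge_at_top[of M]
  proof eventually_elim
    case (elim i)
    hence i: "X i \<ge> -1" "\<sigma> \<ge> -1" using M[of i] \<sigma> by auto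
    have "(bessel_conv k (X i) - bessel_conv k \<sigma>) / (X i - \<sigma>) =
      (LINT x|lborel. (indicator {0..} x * (\<Phi> x * k (x + X i)) - indicator {0..} x * (\<Phi> x * k (x + \<sigma>))) / (X i - \<sigma>))"
      unfolding bessel_conv_def using bessel_conv_integrable[OF k i(1)] bessel_conv_integrable[OF k i(2)] by simp
    also have "\<dots> = (LINT x|lborel. q i x)"
      unfolding q_def by (intro Bochner_Integration.integral_cong refl) (simp add: algebra_simps)
    finally show ?case by simp
  qed
  ultimately show "(\<lambda>i. (bessel_conv k (X i) - bessel_conv k \<sigma>) / (X i - \<sigma>)) \<longlonglongrightarrow> bessel_conv k' \<sigma>"
    by (rule Lim_transform_eventually)
qed

lemma boundary_term_tendsto_0:
  assumes k: "decaying k" and f: "(f \<longlongrightarrow> 0) at_top" and \<sigma>: "\<sigma> \<ge> 0"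
  shows "((\<lambda>x. x * (f x * k (x + \<sigma>))) \<longlongrightarrow> 0) at_top"
proof -
  obtain B where B: "B \<ge> 0" "\<And>y. y \<ge> -1 \<Longrightarrow> \<bar>k y\<bar> \<le> B / (2 + y)"
    using k unfolding decaying_def by blast
  have b: "norm (x * (f x * k (x + \<sigma>))) \<le> B * \<bar>f x\<bar>" if x: "x \<ge> 0" for x
  proof -
    have "x * \<bar>k (x + \<sigma>)\<bar> \<le> x * (B / (2 + (x + \<sigma>)))" using B(2)[of "x + \<sigma>"] x \<sigma> by (intro mult_left_mono) auto
    also have "\<dots> \<le> B" using x \<sigma> B(1) mult_left_mono[of x "2 + (x + \<sigma>)" B] by (simp add: field_simps)
    finally have "\<bar>f x\<bar> * (x * \<bar>k (x + \<sigma>)\<bar>) \<le> \<bar>f x\<bar> * B" by (intro mult_left_mono) auto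
    thus ?thesis using x by (simp add: abs_mult mult_ac)
  qed
  have "((\<lambda>x. B * \<bar>f x\<bar>) \<longlongrightarrow> 0) at_top"
    using tendsto_mult_right_zero[OF tendsto_rabs_zero[OF f], of B] .
  thus ?thesis
    by (rule Lim_null_comparison[rotated]) (use b in \<open>auto intro: eventually_mono[OF eventually_ge_at_top[of 0]]\<close>)
qed

text \<open>Green's identity for the Bessel operator; its boundary terms vanish at 0 and at infinity.\<close>

lemma bessel_conv_ode:
  assumes dec: "decaying k" "decaying k1" "decaying k2" "decaying R"
    and d: "\<And>y. (k has_real_derivative k1 y) (at y)" "\<And>y. (k1 has_real_derivative k2 y) (at y)"
    and R: "\<And>y. y * k2 y + 2 * k1 y = R y" and \<sigma>: "\<sigma> \<ge> 0"
  shows "\<sigma> * bessel_conv k2 \<sigma> + bessel_conv k1 \<sigma> - bessel_conv k \<sigma> / 4 = bessel_conv R \<sigma>"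
proof -
  \<comment> \<open>This is \<sigma> k2 + k1 - k / 4 - R, spelled with explicit coefficients so that
    the linearity lemmas apply.\<close>
  define K where "K = (\<lambda>y. 1 * (\<sigma> * k2 y + 1 * k1 y) + (- 1) * (1 / 4 * k y + 1 * R y))"
  have K: "decaying K" unfolding K_def by (intro decaying_linear dec)
  define B where "B = (\<lambda>x. x * (\<Phi>' x * k (x + \<sigma>)) - x * (\<Phi> x * k1 (x + \<sigma>)))"
  have dB: "(B has_real_derivative \<Phi> x * K (x + \<sigma>)) (at x)" for x
  proof -
    define D where "D = 1 * (\<Phi>' x * k (x + \<sigma>)) + (\<Phi>'' x * k (x + \<sigma>) + k1 (x + \<sigma>) * \<Phi>' x) * x
        - (1 * (\<Phi> x * k1 (x + \<sigma>)) + (\<Phi>' x * k1 (x + \<sigma>) + k2 (x + \<sigma>) * \<Phi> x) * x)"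
    have sh: "((\<lambda>x. k (x + \<sigma>)) has_real_derivative k1 (x + \<sigma>)) (at x)" "((\<lambda>x. k1 (x + \<sigma>)) has_real_derivative k2 (x + \<sigma>)) (at x)"
      using d[of "x + \<sigma>"] by (simp_all add: DERIV_shift)
    have "(B has_real_derivative D) (at x)"
      unfolding B_def D_def by (intro DERIV_diff DERIV_mult DERIV_ident DERIV_\<Phi> DERIV_\<Phi>' sh)
    also have "D = \<Phi> x * K (x + \<sigma>)"
    proof -
      have "D = k (x + \<sigma>) * (\<Phi>' x + x * \<Phi>'' x) - \<Phi> x * (k1 (x + \<sigma>) + x * k2 (x + \<sigma>))"
        unfolding D_def by (simp add: algebra_simps)
      also have "\<Phi>' x + x * \<Phi>'' x = - \<Phi> x / 4" using \<Phi>_ode[of x] by simp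
      also have "k1 (x + \<sigma>) + x * k2 (x + \<sigma>) = R (x + \<sigma>) - k1 (x + \<sigma>) - \<sigma> * k2 (x + \<sigma>)"
        unfolding R[symmetric] by (simp add: algebra_simps)
      finally show ?thesis unfolding K_def by (simp add: algebra_simps)
    qed
    finally show ?thesis .
  qed
  have Kc: "continuous_on UNIV K" using K by (simp add: decaying_def)
  have "((\<lambda>T. LINT x|lborel. indicator {..T} x *\<^sub>R (indicator {0..} x * (\<Phi> x * K (x + \<sigma>)))) \<longlongrightarrow> bessel_conv K \<sigma>) at_top"
    unfolding bessel_conv_def
    by (rule tendsto_integral_at_top) (use bessel_conv_integrable[OF K] \<sigma> in auto)
  moreover have "eventually (\<lambda>T. (LINT x|lborel. indicator {..T} x *\<^sub>R (indicator {0..} x * (\<Phi> x * K (x + \<sigma>)))) = B T) at_top"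
    using eventually_ge_at_top[of 0]
  proof eventually_elim
    case (elim T)
    have "(LINT x|lborel. indicator {..T} x *\<^sub>R (indicator {0..} x * (\<Phi> x * K (x + \<sigma>)))) =
       (LINT x|lborel. indicator {0..T} x *\<^sub>R (\<Phi> x * K (x + \<sigma>)))"
      by (intro Bochner_Integration.integral_cong refl) (auto simp: indicator_def)
    also have "\<dots> = B T - B 0"
    proof (rule integral_FTC_Icc[OF elim])
      show "(B has_vector_derivative \<Phi> x * K (x + \<sigma>)) (at x within {0..T})" for x
        using dB[of x] has_field_derivative_at_within has_real_derivative_iff_has_vector_derivative by blast
      show "continuous_on {0..T} (\<lambda>x. \<Phi> x * K (x + \<sigma>))"
        by (intro continuous_intros \<Phi>_continuous continuous_on_compose2[OF Kc]) auto
    qed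
    finally show ?case by (simp add: B_def)
  qed
  ultimately have "(B \<longlongrightarrow> bessel_conv K \<sigma>) at_top" by (rule Lim_transform_eventually)
  moreover have "(B \<longlongrightarrow> 0 - 0) at_top"
    unfolding B_def
    by (intro tendsto_diff boundary_term_tendsto_0 dec \<Phi>_tendsto_0 \<Phi>'_tendsto_0 \<sigma>)
  ultimately have "bessel_conv K \<sigma> = 0" using tendsto_unique[OF trivial_limit_at_top_linorder] by fastforce
  moreover have "bessel_conv K \<sigma> = 1 * (\<sigma> * bessel_conv k2 \<sigma> + 1 * bessel_conv k1 \<sigma>) + (- 1) * (1 / 4 * bessel_conv k \<sigma> + 1 * bessel_conv R \<sigma>)"
    unfolding K_def using \<sigma> by (simp only: bessel_conv_linear decaying_linear dec order_trans[of "-1" 0 \<sigma>])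
  ultimately show ?thesis by simp
qed

text \<open>For this kernel the inhomogeneity is - L' / 2 - L / 4, so the undifferentiated terms
  cancel and \<sigma> L'' = - 3 / 2 L' remains. Hence t^3 L'(t)^2 is constant, and it is 0 at t = 0,
  where L' is still finite; so L is constant and, tending to 0, vanishes.\<close>

lemma bessel_conv_cos_sqrt_eq_0:
  assumes "\<sigma> \<ge> 0"
  shows "bessel_conv (cos_sqrt 2) \<sigma> = 0"
proof -
  define L L1 L2 where "L = bessel_conv (cos_sqrt 2)" and "L1 = bessel_conv (cos_sqrt 3)" and "L2 = bessel_conv (cos_sqrt 4)"
  have d2: "(cos_sqrt 2 has_real_derivative cos_sqrt 3 y) (at y)" and d3: "(cos_sqrt 3 has_real_derivative cos_sqrt 4 y) (at y)" for y
    using DERIV_cos_sqrt[of 2 y] DERIV_cos_sqrt[of 3 y] by simp_all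
  have dL: "(L has_real_derivative L1 \<sigma>) (at \<sigma>)" if "\<sigma> \<ge> 0" for \<sigma>
    unfolding L_def L1_def by (rule bessel_conv_has_derivative[OF decaying_cos_sqrt(1,2) d2 that])
  have dL1: "(L1 has_real_derivative L2 \<sigma>) (at \<sigma>)" if "\<sigma> \<ge> 0" for \<sigma>
    unfolding L1_def L2_def by (rule bessel_conv_has_derivative[OF decaying_cos_sqrt(2,3) d3 that])
  have ode: "\<sigma> * L2 \<sigma> = - 3 / 2 * L1 \<sigma>" if \<sigma>: "\<sigma> \<ge> 0" for \<sigma>
  proof -
    define R where "R = (\<lambda>y. (- 1 / 2) * cos_sqrt 3 y + (- 1 / 4) * cos_sqrt 2 y)"
    have "\<sigma> * L2 \<sigma> + L1 \<sigma> - L \<sigma> / 4 = bessel_conv R \<sigma>"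
      unfolding L_def L1_def L2_def
    proof (rule bessel_conv_ode[OF decaying_cos_sqrt _ d2 d3 _ \<sigma>])
      show "decaying R" unfolding R_def by (intro decaying_linear decaying_cos_sqrt)
      show "y * cos_sqrt 4 y + 2 * cos_sqrt 3 y = R y" for y
      proof -
        have "4 * y * cos_sqrt 4 y + 10 * cos_sqrt 3 y + cos_sqrt 2 y = 0"
          using cos_sqrt_ode[of y 2] by (simp add: eval_nat_numeral)
        thus ?thesis unfolding R_def by linarith
      qed
    qed
    also have "bessel_conv R \<sigma> = (- 1 / 2) * L1 \<sigma> + (- 1 / 4) * L \<sigma>"
      unfolding R_def L_def L1_def using \<sigma> by (intro bessel_conv_linear decaying_cos_sqrt) auto
    finally show ?thesis by simp
  qed
  have L1_0: "L1 \<sigma> = 0" if \<sigma>: "\<sigma> > 0" for \<sigma>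
  proof -
    define E where "E = (\<lambda>t. t ^ 3 * (L1 t)\<^sup>2)"
    have dE: "(E has_real_derivative 0) (at t)" if t: "t \<ge> 0" for t
    proof -
      have "(E has_real_derivative 3 * t\<^sup>2 * (L1 t)\<^sup>2 + t ^ 3 * (2 * L1 t * L2 t)) (at t)"
        unfolding E_def using dL1[OF t] by (auto intro!: derivative_eq_intros)
      also have "3 * t\<^sup>2 * (L1 t)\<^sup>2 + t ^ 3 * (2 * L1 t * L2 t) = 3 * t\<^sup>2 * (L1 t)\<^sup>2 + 2 * t\<^sup>2 * L1 t * (t * L2 t)"
        by (simp add: power2_eq_square power3_eq_cube)
      also have "\<dots> = 0" unfolding ode[OF t] by (simp add: power2_eq_square)
      finally show ?thesis .
    qed
    have "E \<sigma> = E 0"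
    proof (rule DERIV_isconst2[of 0 \<sigma>])
      show "continuous_on {0..\<sigma>} E"
        by (rule DERIV_continuous_on[of _ E "\<lambda>_. 0"]) (auto intro!: has_field_derivative_at_within dE)
      show "(E has_real_derivative 0) (at x)" if "0 < x" for x using dE[of x] that by simp
    qed (use \<sigma> in auto)
    thus ?thesis using \<sigma> by (simp add: E_def)
  qed
  have const: "L t = L 0" if t: "t \<ge> 0" for t
  proof (cases "t = 0")
    case False
    show ?thesis
    proof (rule DERIV_isconst2[of 0 t])
      show "continuous_on {0..t} L"
        by (rule DERIV_continuous_on[of _ L L1]) (auto intro!: has_field_derivative_at_within dL)
      show "(L has_real_derivative 0) (at x)" if "0 < x" for x
        using dL[of x] L1_0[OF that] that by simp
    qed (use t False in auto)
  qed simp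
  have "(L \<longlongrightarrow> 0) at_top" unfolding L_def by (intro bessel_conv_tendsto_0 decaying_cos_sqrt)
  moreover have "eventually (\<lambda>t. L t = L 0) at_top" using eventually_ge_at_top[of 0] by eventually_elim (rule const)
  hence "(L \<longlongrightarrow> L 0) at_top" by (rule tendsto_eventually)
  ultimately have "L 0 = 0" using tendsto_unique[OF trivial_limit_at_top_linorder] by blast
  thus ?thesis using const[OF assms] by (simp add: L_def)
qed

text \<open>The inhomogeneity is the integral with kernel \<open>cos_sqrt 2\<close>, which is 0, so
  \<sigma> M'' + M' = M / 4. Then (t M M')' = t M'^2 + M^2 / 4 is nonnegative, so M M' \<ge> 0 and
  M^2 does not decrease; since it tends to 0, it vanishes.\<close>

lemma bessel_conv_cos_sqrt_rem_eq_0: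
  assumes "\<sigma> > 0"
  shows "bessel_conv (cos_sqrt_rem 0) \<sigma> = 0"
proof -
  define M M1 M2 where "M = bessel_conv (cos_sqrt_rem 0)" and "M1 = bessel_conv (cos_sqrt_rem 1)" and "M2 = bessel_conv (cos_sqrt_rem 2)"
  have d0: "(cos_sqrt_rem 0 has_real_derivative cos_sqrt_rem 1 y) (at y)" and d1: "(cos_sqrt_rem 1 has_real_derivative cos_sqrt_rem 2 y) (at y)" for y
    using DERIV_cos_sqrt_rem[of 0 y] DERIV_cos_sqrt_rem[of 1 y] by (simp_all add: numeral_2_eq_2)
  have dM: "(M has_real_derivative M1 \<sigma>) (at \<sigma>)" if "\<sigma> \<ge> 0" for \<sigma>
    unfolding M_def M1_def by (rule bessel_conv_has_derivative[OF decaying_cos_sqrt_rem(1,2) d0 that])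
  have dM1: "(M1 has_real_derivative M2 \<sigma>) (at \<sigma>)" if "\<sigma> \<ge> 0" for \<sigma>
    unfolding M1_def M2_def by (rule bessel_conv_has_derivative[OF decaying_cos_sqrt_rem(2,3) d1 that])
  have ode: "\<sigma> * M2 \<sigma> + M1 \<sigma> = M \<sigma> / 4" if \<sigma>: "\<sigma> \<ge> 0" for \<sigma>
    using bessel_conv_ode[OF decaying_cos_sqrt_rem decaying_cos_sqrt(1) d0 d1 cos_sqrt_rem_eq(3) \<sigma>]
      bessel_conv_cos_sqrt_eq_0[OF \<sigma>] by (simp add: M_def M1_def M2_def)
  have MM1: "M t * M1 t \<ge> 0" if t: "t > 0" for t
  proof -
    define E where "E = (\<lambda>t. t * (M t * M1 t))"
    have "E 0 \<le> E t"
    proof (rule DERIV_nonneg_imp_nondecreasing[of 0 t E])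
      fix x :: real assume x: "0 \<le> x"
      have "(E has_real_derivative 1 * (M x * M1 x) + (M1 x * M1 x + M2 x * M x) * x) (at x)"
        unfolding E_def using dM[OF x] dM1[OF x] by (intro DERIV_mult DERIV_ident)
      also have "1 * (M x * M1 x) + (M1 x * M1 x + M2 x * M x) * x = x * (M1 x)\<^sup>2 + M x * (x * M2 x + M1 x)"
        by (simp add: algebra_simps power2_eq_square)
      also have "\<dots> = x * (M1 x)\<^sup>2 + (M x)\<^sup>2 / 4" unfolding ode[OF x] by (simp add: power2_eq_square)
      finally have "(E has_real_derivative x * (M1 x)\<^sup>2 + (M x)\<^sup>2 / 4) (at x)" .
      moreover have "0 \<le> x * (M1 x)\<^sup>2 + (M x)\<^sup>2 / 4" using x by simp
      ultimately show "\<exists>y. (E has_real_derivative y) (at x) \<and> 0 \<le> y" by blast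
    qed (use t in auto)
    thus ?thesis using t by (simp add: E_def zero_le_mult_iff)
  qed
  have mono: "(M \<sigma>)\<^sup>2 \<le> (M t)\<^sup>2" if t: "t \<ge> \<sigma>" for t
  proof (rule DERIV_nonneg_imp_nondecreasing[OF t, where f = "\<lambda>x. (M x)\<^sup>2"])
    fix x :: real assume "\<sigma> \<le> x"
    hence x: "x > 0" using assms by simp
    have "((\<lambda>x. (M x)\<^sup>2) has_real_derivative 2 * (M x * M1 x)) (at x)"
      using dM[of x] x by (auto intro!: derivative_eq_intros)
    moreover have "0 \<le> 2 * (M x * M1 x)" using MM1[OF x] by simp
    ultimately show "\<exists>y. ((\<lambda>x. (M x)\<^sup>2) has_real_derivative y) (at x) \<and> 0 \<le> y" by blast
  qed
  have "((\<lambda>t. (M t)\<^sup>2) \<longlongrightarrow> 0\<^sup>2) at_top"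
    unfolding M_def by (intro tendsto_power bessel_conv_tendsto_0 decaying_cos_sqrt_rem)
  hence "(M \<sigma>)\<^sup>2 \<le> 0\<^sup>2"
    by (rule tendsto_lowerbound) (use mono in \<open>auto intro: eventually_mono[OF eventually_ge_at_top[of \<sigma>]]\<close>)
  thus ?thesis by (simp add: M_def)
qed

section \<open>The Laplace transform of J_0(sqrt x) and its integral against 1 / (x + s^2)\<close>

lemma has_bochner_integral_power_exp:
  assumes u: "u > 0"
  shows "has_bochner_integral lborel (\<lambda>x. indicator {0..} x * (x ^ n * exp (- (x * u)))) (fact n / u ^ Suc n :: real)"
proof -
  have "has_bochner_integral lborel (\<lambda>x. (0 + u * x) ^ n * exp (- (0 + u * x)) * indicator {0..} (0 + u * x)) (fact n /\<^sub>R \<bar>u\<bar> :: real)"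
    using has_bochner_integral_I0i_power_exp_m'[of n] u
    by (subst lborel_has_bochner_integral_real_affine_iff[symmetric]) auto
  from has_bochner_integral_mult_right[OF this, of "1 / u ^ n"]
  have "has_bochner_integral lborel (\<lambda>x. 1 / u ^ n * ((0 + u * x) ^ n * exp (- (0 + u * x)) * indicator {0..} (0 + u * x))) (1 / u ^ n * (fact n /\<^sub>R \<bar>u\<bar>))" .
  also have "(\<lambda>x. 1 / u ^ n * ((0 + u * x) ^ n * exp (- (0 + u * x)) * indicator {0..} (0 + u * x))) = (\<lambda>x. indicator {0..} x * (x ^ n * exp (- (x * u))))"
    using u by (auto simp: fun_eq_iff indicator_def power_mult_distrib zero_le_mult_iff mult.commute)
  also have "1 / u ^ n * (fact n /\<^sub>R \<bar>u\<bar>) = fact n / u ^ Suc n"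
    using u by (simp add: divide_inverse)
  finally show ?thesis .
qed

text \<open>Termwise Gamma integrals turn 1 / (n!)^2 in the coefficients into 1 / n!, which gives an
  exponential series in - 1 / (4 u). Sum and integral commute because the absolute values give the
  same series at 1 / (4 u).\<close>

lemma bessel_laplace:
  assumes u: "u > 0"
  shows "(LINT x|lborel. indicator {0..} x * (\<Phi> x * exp (- (x * u)))) = exp (- 1 / (4 * u)) / u"
proof -
  define f where "f = (\<lambda>n x. bessel_coeff n * (indicator {0..} x * (x ^ n * exp (- (x * u)))) :: real)"
  have hb: "has_bochner_integral lborel (f n) (bessel_coeff n * (fact n / u ^ Suc n))" for n
    unfolding f_def by (intro has_bochner_integral_mult_right has_bochner_integral_power_exp u)
  have nf: "norm (f n x) = \<bar>bessel_coeff n\<bar> * (indicator {0..} x * (x ^ n * exp (- (x * u))))" for n x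
    unfolding f_def by (simp add: abs_mult indicator_def)
  have hbn: "has_bochner_integral lborel (\<lambda>x. norm (f n x)) (\<bar>bessel_coeff n\<bar> * (fact n / u ^ Suc n))" for n
    unfolding nf by (intro has_bochner_integral_mult_right has_bochner_integral_power_exp u)
  have coeff: "bessel_coeff n * (fact n / u ^ Suc n) = (- 1 / (4 * u)) ^ n / fact n * (1 / u)" for n
  proof -
    have "(- 1 / (4 * u)) ^ n = (- 1) ^ n / (4 ^ n * u ^ n)" by (simp only: power_divide power_mult_distrib)
    thus ?thesis by (simp add: bessel_coeff_def power2_eq_square)
  qed
  have "(\<lambda>n. (- 1 / (4 * u)) ^ n / fact n) sums exp (- 1 / (4 * u))"
    using exp_converges[of "- 1 / (4 * u)"] by (simp only: real_scaleR_def divide_inverse mult.commute)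
  from sums_mult2[OF this, of "1 / u"]
  have sm: "(\<lambda>n. bessel_coeff n * (fact n / u ^ Suc n)) sums (exp (- 1 / (4 * u)) / u)"
    unfolding coeff by simp
  have smn: "summable (\<lambda>n. \<bar>bessel_coeff n\<bar> * (fact n / u ^ Suc n))"
  proof -
    have "summable (\<lambda>n. inverse (fact n) * (1 / (4 * u)) ^ n * (1 / u))"
      by (rule summable_mult2[OF summable_exp])
    also have "(\<lambda>n. inverse (fact n) * (1 / (4 * u)) ^ n * (1 / u)) = (\<lambda>n. \<bar>bessel_coeff n * (fact n / u ^ Suc n)\<bar>)"
    proof
      fix n
      have "\<bar>- 1 / (4 * u)\<bar> = 1 / (4 * u)" using u by simp
      moreover have "\<bar>1 / u\<bar> = 1 / u" using u by simp
      ultimately show "inverse (fact n) * (1 / (4 * u)) ^ n * (1 / u) = \<bar>bessel_coeff n * (fact n / u ^ Suc n)\<bar>"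
        by (simp only: coeff abs_mult abs_divide[of _ "fact n"] power_abs abs_of_pos[OF fact_gt_zero]
            inverse_eq_divide times_divide_eq_left mult_1_left)
    qed
    also have "\<dots> = (\<lambda>n. \<bar>bessel_coeff n\<bar> * (fact n / u ^ Suc n))"
      using u by (simp add: abs_mult fun_eq_iff)
    finally show ?thesis .
  qed
  have abs_summable: "everywhere_summable (\<lambda>n. \<bar>bessel_coeff n\<bar>)"
    by (rule everywhere_summable_if_bounded_by_exp) (simp add: bessel_coeff_le)
  have "(\<Sum>n. integral\<^sup>L lborel (f n)) = (LINT x|lborel. (\<Sum>n. f n x))"
  proof (rule integral_suminf[symmetric])
    show "integrable lborel (f n)" for n using hb[of n] by (rule integrable.intros)
    show "AE x in lborel. summable (\<lambda>n. norm (f n x))"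
    proof (intro always_eventually allI)
      fix x :: real
      have "summable (\<lambda>n. \<bar>bessel_coeff n\<bar> * x ^ n * (indicator {0..} x * exp (- (x * u))))"
        using abs_summable unfolding everywhere_summable_def by (intro summable_mult2) auto
      thus "summable (\<lambda>n. norm (f n x))" unfolding nf by (simp add: mult_ac)
    qed
    show "summable (\<lambda>n. LINT x|lborel. norm (f n x))"
      using smn by (simp only: has_bochner_integral_integral_eq[OF hbn])
  qed
  also have "(\<lambda>x. \<Sum>n. f n x) = (\<lambda>x. indicator {0..} x * (\<Phi> x * exp (- (x * u))))"
  proof
    fix x :: real
    have "(\<lambda>n. bessel_coeff n * x ^ n) sums \<Phi> x"
      using bessel_coeff_summable unfolding \<Phi>_def power_series_def everywhere_summable_def by (intro summable_sums) auto
    from sums_mult2[OF this, of "indicator {0..} x * exp (- (x * u))"]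
    have "(\<lambda>n. f n x) sums (\<Phi> x * (indicator {0..} x * exp (- (x * u))))"
      unfolding f_def by (simp add: mult_ac)
    thus "(\<Sum>n. f n x) = indicator {0..} x * (\<Phi> x * exp (- (x * u)))"
      by (simp add: sums_iff mult_ac)
  qed
  finally show ?thesis
    using sums_unique[OF sm] by (simp add: has_bochner_integral_integral_eq[OF hb])
qed

lemma bessel_stieltjes_integrable:
  assumes \<sigma>: "\<sigma> > 0"
  shows "integrable lborel (\<lambda>x. indicator {0..} x * (\<Phi> x / (x + \<sigma>)))"
proof -
  obtain A where A: "A \<ge> 0" "\<And>x. x \<ge> 0 \<Longrightarrow> \<bar>\<Phi> x\<bar> \<le> A * (1 + x) powr (- 1 / 4)"
    by (rule \<Phi>_bound) blast
  define c where "c = 1 + 1 / \<sigma>"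
  have c: "c > 0" using \<sigma> by (simp add: c_def add_pos_pos)
  show ?thesis
  proof (rule Bochner_Integration.integrable_bound)
    show "integrable lborel (\<lambda>x. A * c * (indicator {0..} x * (1 + x) powr (- 5 / 4)))"
      by (intro integrable_mult_right integrable_powr_minus_5_4)
    show "AE x in lborel. norm (indicator {0..} x * (\<Phi> x / (x + \<sigma>))) \<le> norm (A * c * (indicator {0..} x * (1 + x) powr (- 5 / 4)))"
    proof (intro always_eventually allI)
      fix x :: real
      show "norm (indicator {0..} x * (\<Phi> x / (x + \<sigma>))) \<le> norm (A * c * (indicator {0..} x * (1 + x) powr (- 5 / 4)))"
      proof (cases "x \<ge> 0")
        case True
        have "1 + x \<le> c * (x + \<sigma>)" using True \<sigma> by (simp add: c_def field_simps)
        hence "1 / (x + \<sigma>) \<le> c / (1 + x)" using True \<sigma> by (simp add: field_simps)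
        hence "\<bar>\<Phi> x\<bar> * (1 / (x + \<sigma>)) \<le> (A * (1 + x) powr (- 1 / 4)) * (c / (1 + x))"
          using A True \<sigma> by (intro mult_mono A(2)) auto
        also have "\<dots> = A * c * ((1 + x) powr (- 1 / 4) * (1 + x) powr (- 1))"
          using True powr_minus_divide[of "1 + x" 1] by simp
        also have "(1 + x) powr (- 1 / 4) * (1 + x) powr (- 1) = (1 + x) powr (- 1 / 4 + - 1)"
          by (rule powr_add[symmetric])
        also have "- 1 / 4 + - 1 = (- 5 / 4 :: real)" by simp
        finally show ?thesis using True \<sigma> A(1) c by (simp add: abs_mult)
      qed simp
    qed
  qed measurable
qed

text \<open>With 1 / (x + \<sigma>) written as the integral of exp (- u (x + \<sigma>)) over u > 0,
  Fubini's theorem leaves the Laplace transform of \<Phi>. The exchange is justified by the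
  integrability of \<Phi> x / (x + \<sigma>).\<close>

lemma bessel_stieltjes:
  assumes s: "s > 0"
  shows "(LINT x|lborel. indicator {0..} x * (\<Phi> x / (x + s\<^sup>2))) = macdonald s"
proof -
  define \<sigma> where "\<sigma> = s\<^sup>2"
  have \<sigma>: "\<sigma> > 0" using s by (simp add: \<sigma>_def)
  define g where "g = (\<lambda>x u. indicator {0..} x * \<Phi> x * (indicator {0..} u * exp (- (u * (x + \<sigma>)))) :: real)"
  have hb: "has_bochner_integral lborel (\<lambda>u. indicator {0..} u * exp (- (u * (x + \<sigma>)))) (1 / (x + \<sigma>))" if "x \<ge> 0" for x
    using has_bochner_integral_power_exp[of "x + \<sigma>" 0] that \<sigma> by simp
  have gx: "has_bochner_integral lborel (g x) (indicator {0..} x * (\<Phi> x / (x + \<sigma>)))" for x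
  proof (cases "x \<ge> 0")
    case True
    from has_bochner_integral_mult_right[OF hb[OF True], of "indicator {0..} x * \<Phi> x"]
    show ?thesis by (simp add: g_def)
  qed (simp add: g_def has_bochner_integral_zero)
  have gxn: "has_bochner_integral lborel (\<lambda>u. norm (g x u)) (norm (indicator {0..} x * (\<Phi> x / (x + \<sigma>))))" for x
  proof (cases "x \<ge> 0")
    case True
    from has_bochner_integral_mult_right[OF hb[OF True], of "indicator {0..} x * \<bar>\<Phi> x\<bar>"]
    show ?thesis using True \<sigma> by (simp add: g_def abs_mult)
  qed (simp add: g_def has_bochner_integral_zero)
  have "(LINT x|lborel. indicator {0..} x * (\<Phi> x / (x + \<sigma>))) = (LINT x|lborel. integral\<^sup>L lborel (g x))"
    by (simp add: has_bochner_integral_integral_eq[OF gx])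
  also have "\<dots> = (LINT u|lborel. LINT x|lborel. g x u)"
  proof (rule lborel_pair.Fubini_integral[symmetric], rule lborel_pair.Fubini_integrable)
    show "(\<lambda>(x, u). g x u) \<in> borel_measurable (lborel \<Otimes>\<^sub>M lborel)"
      unfolding g_def by measurable
    show "integrable lborel (\<lambda>x. LINT u|lborel. norm (case (x, u) of (x, u) \<Rightarrow> g x u))"
      using integrable_norm[OF bessel_stieltjes_integrable[OF \<sigma>]]
      by (simp only: prod.case has_bochner_integral_integral_eq[OF gxn])
    show "AE x in lborel. integrable lborel (\<lambda>u. case (x, u) of (x, u) \<Rightarrow> g x u)"
      using gx by (auto intro: integrable.intros)
  qed
  also have "\<dots> = (LINT u|lborel. indicator {0<..} u * (exp (- (u * \<sigma>)) * (exp (- 1 / (4 * u)) / u)))"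
  proof (rule integral_cong_AE)
    show "AE u in lborel. (LINT x|lborel. g x u) = indicator {0<..} u * (exp (- (u * \<sigma>)) * (exp (- 1 / (4 * u)) / u))"
      \<comment> \<open>At u = 0 the Laplace transform does not describe the inner integral; a
        single point is negligible.\<close>
      using AE_lborel_singleton[of 0]
    proof eventually_elim
      case (elim u)
      show ?case
      proof (cases "u > 0")
        case True
        have "(LINT x|lborel. g x u) = (LINT x|lborel. exp (- (u * \<sigma>)) * (indicator {0..} x * (\<Phi> x * exp (- (x * u)))))"
          using True by (intro Bochner_Integration.integral_cong refl) (simp add: g_def algebra_simps flip: exp_add)
        also have "\<dots> = exp (- (u * \<sigma>)) * (exp (- 1 / (4 * u)) / u)"
          by (simp add: bessel_laplace[OF True])
        finally show ?thesis using True by simp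
      qed (use elim in \<open>simp add: g_def\<close>)
    qed
    show "(\<lambda>u. LINT x|lborel. g x u) \<in> borel_measurable lborel"
      unfolding g_def by measurable
  qed measurable
  \<comment> \<open>The scaling u = v / \<sigma> moves \<sigma> into the second exponential and
    leaves du / u unchanged.\<close>
  also have "\<dots> = \<bar>1 / \<sigma>\<bar> *\<^sub>R (LINT v|lborel. indicator {0<..} (0 + 1 / \<sigma> * v) * (exp (- ((0 + 1 / \<sigma> * v) * \<sigma>)) * (exp (- 1 / (4 * (0 + 1 / \<sigma> * v))) / (0 + 1 / \<sigma> * v))))"
    using \<sigma> by (intro lborel_integral_real_affine) auto
  also have "\<dots> = (LINT v|lborel. indicator {0<..} v *\<^sub>R (exp (- v - \<sigma> / (4 * v)) / v))"
    unfolding integral_scaleR_right[symmetric]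
  proof (intro Bochner_Integration.integral_cong refl)
    fix v :: real
    have "indicator {0<..} (0 + 1 / \<sigma> * v) = (indicator {0<..} v :: real)"
      using \<sigma> by (simp add: indicator_def zero_less_divide_iff)
    moreover have "exp (- v - \<sigma> / (4 * v)) = exp (- v) * exp (- (\<sigma> / (4 * v)))" by (simp flip: exp_add)
    ultimately show "\<bar>1 / \<sigma>\<bar> *\<^sub>R (indicator {0<..} (0 + 1 / \<sigma> * v) * (exp (- ((0 + 1 / \<sigma> * v) * \<sigma>)) * (exp (- 1 / (4 * (0 + 1 / \<sigma> * v))) / (0 + 1 / \<sigma> * v)))) =
       indicator {0<..} v *\<^sub>R (exp (- v - \<sigma> / (4 * v)) / v)"
      using \<sigma> by simp
  qed
  finally show ?thesis by (simp add: macdonald_def set_lebesgue_integral_def \<sigma>_def)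
qed

text \<open>With y = x + s^2, split cos (sqrt y) / y = 1 / y + (cos (sqrt y) - 1) / y; the first
  part carries the whole value.\<close>

lemma F_int_eq:
  assumes s: "s > 0"
  shows "F_int s = macdonald s / pi"
proof -
  define \<sigma> where "\<sigma> = s\<^sup>2"
  have \<sigma>: "\<sigma> > 0" using s by (simp add: \<sigma>_def)
  have "(LBINT x:{0..}. cos (sqrt (x + s\<^sup>2)) / (x + s\<^sup>2) * bessel_J 0 (sqrt x)) =
     (LINT x|lborel. indicator {0..} x * (\<Phi> x / (x + \<sigma>)) + indicator {0..} x * (\<Phi> x * cos_sqrt_rem 0 (x + \<sigma>)))"
    unfolding set_lebesgue_integral_def
  proof (intro Bochner_Integration.integral_cong refl)
    fix x :: real
    show "indicator {0..} x *\<^sub>R (cos (sqrt (x + s\<^sup>2)) / (x + s\<^sup>2) * bessel_J 0 (sqrt x)) =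
       indicator {0..} x * (\<Phi> x / (x + \<sigma>)) + indicator {0..} x * (\<Phi> x * cos_sqrt_rem 0 (x + \<sigma>))"
    proof (cases "x \<ge> 0")
      case True
      hence y: "x + \<sigma> > 0" using \<sigma> by simp
      have "cos (sqrt (x + \<sigma>)) = 1 + (x + \<sigma>) * cos_sqrt_rem 0 (x + \<sigma>)"
        using cos_sqrt_rem_eq(1)[of "x + \<sigma>"] cos_sqrt_0[of "x + \<sigma>"] y by simp
      hence "cos (sqrt (x + \<sigma>)) / (x + \<sigma>) = 1 / (x + \<sigma>) + cos_sqrt_rem 0 (x + \<sigma>)"
        using y by (simp add: add_divide_distrib)
      thus ?thesis using True by (simp add: bessel_J_sqrt \<sigma>_def[symmetric] algebra_simps)
    qed simp
  qed
  also have "\<dots> = (LINT x|lborel. indicator {0..} x * (\<Phi> x / (x + \<sigma>))) + bessel_conv (cos_sqrt_rem 0) \<sigma>"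
    unfolding bessel_conv_def using \<sigma>
    by (intro Bochner_Integration.integral_add bessel_stieltjes_integrable bessel_conv_integrable decaying_cos_sqrt_rem) auto
  also have "(LINT x|lborel. indicator {0..} x * (\<Phi> x / (x + \<sigma>))) = macdonald s"
    unfolding \<sigma>_def by (rule bessel_stieltjes[OF s])
  also have "bessel_conv (cos_sqrt_rem 0) \<sigma> = 0" by (rule bessel_conv_cos_sqrt_rem_eq_0[OF \<sigma>])
  finally show ?thesis by (simp add: F_int_def)
qed

text \<open>The error term is the difference of quotient and limit. In the applications
  \<open>p\<close> contains a power of n that is 0 at n = 0, hence the restriction to n \<ge>
  1.\<close>

lemma asymptotics_of_tendsto:
  fixes D :: "nat \<Rightarrow> complex"
  assumes p: "\<And>n. n \<ge> 1 \<Longrightarrow> p n \<noteq> 0" and lim: "(\<lambda>n. D n / p n) \<longlonglongrightarrow> L"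
  shows "\<exists>\<epsilon> :: nat \<Rightarrow> complex. \<epsilon> \<in> o(\<lambda>_. 1) \<and> (\<forall>n\<ge>1. D n = p n * (L + \<epsilon> n))"
proof (intro exI[of _ "\<lambda>n. D n / p n - L"] conjI allI impI)
  have "(\<lambda>n. D n / p n - L) \<longlonglongrightarrow> 0" using lim by (simp add: LIM_zero)
  thus "(\<lambda>n. D n / p n - L) \<in> o(\<lambda>_. 1)" by (intro smalloI_tendsto) auto
  show "D n = p n * (L + (D n / p n - L))" if "n \<ge> 1" for n using p[OF that] by simp
qed

theorem lemma4p1:
  fixes s :: real
  assumes "s > 0"
  shows
    "(\<exists>\<epsilon> :: nat \<Rightarrow> complex. \<epsilon> \<in> o(\<lambda>_. 1) \<and> (\<forall>n\<ge>1.
        toeplitz_det (n - 1) (f1 (2 * s / real n)) =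
          1 / 2 ^ n * of_real (real n powr (1 / 4)) *
          (of_real (sqrt pi * 2 powr (1 / 12)) * exp (3 * deriv zeta (- 1)) *
             of_real (exp (- s\<^sup>2 / 2)) * bessel_J 0 (\<i> * of_real s) + \<epsilon> n)))
     \<and>
     (\<exists>\<epsilon> :: nat \<Rightarrow> complex. \<epsilon> \<in> o(\<lambda>_. 1) \<and> (\<forall>n\<ge>1.
        toeplitz_det (n - 1) (f2 (2 * s / real n)) =
          2 ^ (n - 1) * of_real (real n powr (1 / 4)) *
          (of_real (sqrt pi * 2 powr (1 / 12)) * exp (3 * deriv zeta (- 1)) *
             of_real (exp (- s\<^sup>2 / 2)) * of_real (F_int s) + \<epsilon> n)))"
proof -
  obtain z where z: "deriv zeta (- 1) = complex_of_real z"
    "(\<lambda>n. (\<Prod>k<n. legendre_factor k) * real n powr (1 / 4)) \<longlonglongrightarrow> 2 powr (1 / 12) * exp (3 * z)"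
    by (rule legendre_factor_prod_limit)
  have ez: "exp (3 * deriv zeta (- 1)) = of_real (exp (3 * z))"
    unfolding z(1) by (simp flip: exp_of_real)
  show ?thesis
    unfolding ez
  proof (intro conjI asymptotics_of_tendsto)
    show "(\<lambda>n. toeplitz_det (n - 1) (f1 (2 * s / real n)) / (1 / 2 ^ n * of_real (real n powr (1 / 4))))
      \<longlonglongrightarrow> of_real (sqrt pi * 2 powr (1 / 12)) * of_real (exp (3 * z)) * of_real (exp (- s\<^sup>2 / 2)) * bessel_J 0 (\<i> * of_real s)"
      using toeplitz_det_f1_limit[OF assms z(2)] by (simp only: of_real_mult mult_ac)
    show "(\<lambda>n. toeplitz_det (n - 1) (f2 (2 * s / real n)) / (2 ^ (n - 1) * of_real (real n powr (1 / 4))))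
      \<longlonglongrightarrow> of_real (sqrt pi * 2 powr (1 / 12)) * of_real (exp (3 * z)) * of_real (exp (- s\<^sup>2 / 2)) * of_real (F_int s)"
      using toeplitz_det_f2_limit[OF assms z(2)] by (simp only: F_int_eq[OF assms] of_real_mult mult_ac)
  qed auto
qed

end
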